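(* For every computable function $T:\mathbb{N}\to\mathbb{N}$ there exists an effective shift $S$ on $\mathbb{Z}^2$ (over some finite alphabet) such that (i) for every $n$ and every pattern $P$ of size $n\times n$ that is globally admissible in $S$, $\mathrm{C}(P)=O(\log n)$; and (ii) there is a constant $c>0$ such that for infinitely many $n$, every pattern $P$ of size $n\times n$ that is globally admissible in $S$ satisfies $\mathrm{C}^{T(n)}(P)\ge c\, n^{1.5}$.
   Context: A shift on $\mathbb{Z}^2$ over a finite alphabet $\Sigma$ is a subset of $\Sigma^{\mathbb{Z}^2}$ invariant under all translations and closed in the product (Cantor) topology; equivalently, the set of configurations avoiding all patterns of some set of forbidden finite patterns. A pattern is a map from a finite subset (its support) of $\mathbb{Z}^2$ to $\Sigma$; a pattern of size $n\times n$ has support a translate of $\{1,\dots,n\}^2$. A shift is effective if it can be defined by a computable set of forbidden finite patterns. A finite pattern is globally admissible in $S$ if it is the restriction of some configuration of $S$. $\mathrm{C}(x)$ is the plain Kolmogorov complexity of $x$. $\mathrm{C}^{t}(x)$ is the length of a shortest $p$ such that a fixed optimal multi-tape Turing machine $U$ outputs $x$ on input $p$ within $t$ steps, $U$ being optimal in the sense that for every multi-tape Turing machine $V$ there is $c$ with $\mathrm{C}_U^{ct\log t}(x)\le \mathrm{C}_V^{t}(x)+c$ for all $x$; it is assumed $\mathrm{C}(x)\le \mathrm{C}^t(x)$. Complexity of a two-dimensional pattern means complexity of its code under a fixed computable encoding. *)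

theory Defs
  imports
    "HOL-Analysis.Function_Topology"
    "HOL-Library.Product_Plus"
    "HOL-Library.Extended_Real"
begin

text \<open>
  Machines are deterministic, with finitely many two-way infinite tapes. States are the numbers
  below \<open>n_states\<close>; state 0 is initial and state 1 is the halting state. Tape symbols are the
  numbers below \<open>n_symbols\<close>; 0 is the blank, 1 and 2 are the bits 0 and 1. Tape 0 is the input
  tape and tape 1 the output tape. The output tape is distinct from the input tape and initially
  blank, so a machine running for \<open>t\<close> steps outputs at most \<open>t\<close> bits.
\<close>

datatype move = Lft | Stay | Rgt

fun displacement :: "move \<Rightarrow> int" where
  "displacement Lft = -1"
| "displacement Stay = 0"
| "displacement Rgt = 1"

record machine =
  n_tapes :: nat
  n_states :: nat
  n_symbols :: nat
  trans_fun :: "nat \<Rightarrow> nat list \<Rightarrow> nat \<times> (nat \<times> move) list"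

definition turing_machine :: "machine \<Rightarrow> bool" where
  "turing_machine M \<longleftrightarrow>
     2 \<le> n_tapes M \<and> 2 \<le> n_states M \<and> 3 \<le> n_symbols M \<and>
     (\<forall>q ss. q < n_states M \<and> length ss = n_tapes M \<and> set ss \<subseteq> {..<n_symbols M} \<longrightarrow>
        fst (trans_fun M q ss) < n_states M \<and>
        length (snd (trans_fun M q ss)) = n_tapes M \<and>
        fst ` set (snd (trans_fun M q ss)) \<subseteq> {..<n_symbols M})"

text \<open>A head position together with the contents of all cells.\<close>

type_synonym tape = "int \<times> (int \<Rightarrow> nat)"

type_synonym configuration = "nat \<times> tape list"

definition halted :: "configuration \<Rightarrow> bool" where
  "halted cfg \<longleftrightarrow> fst cfg = 1"

definition scan :: "tape \<Rightarrow> nat" where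
  "scan tp = snd tp (fst tp)"

definition act :: "tape \<Rightarrow> nat \<times> move \<Rightarrow> tape" where
  "act tp a = (fst tp + displacement (snd a), (snd tp)(fst tp := fst a))"

definition step :: "machine \<Rightarrow> configuration \<Rightarrow> configuration" where
  "step M cfg =
     (if halted cfg then cfg
      else let (q, acts) = trans_fun M (fst cfg) (map scan (snd cfg))
           in (q, map2 act (snd cfg) acts))"

definition bit_symbol :: "bool \<Rightarrow> nat" where
  "bit_symbol b = (if b then 2 else 1)"

definition input_tape :: "bool list \<Rightarrow> tape" where
  "input_tape p =
     (0, \<lambda>i. if 0 \<le> i \<and> i < int (length p) then bit_symbol (p ! nat i) else 0)"

definition blank_tape :: tape where
  "blank_tape = (0, \<lambda>_. 0)"

definition initial :: "machine \<Rightarrow> bool list \<Rightarrow> configuration" where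
  "initial M p = (0, input_tape p # replicate (n_tapes M - 1) blank_tape)"

text \<open>The word read off from cell 0 of the output tape up to the first cell not holding a bit.\<close>

definition output_word :: "configuration \<Rightarrow> bool list \<Rightarrow> bool" where
  "output_word cfg x \<longleftrightarrow>
     (\<forall>i < length x. snd (snd cfg ! 1) (int i) = bit_symbol (x ! i)) \<and>
     snd (snd cfg ! 1) (int (length x)) \<notin> range bit_symbol"

definition outputs_within :: "machine \<Rightarrow> nat \<Rightarrow> bool list \<Rightarrow> bool list \<Rightarrow> bool" where
  "outputs_within M t p x \<longleftrightarrow>
     (\<exists>s\<le>t. halted ((step M ^^ s) (initial M p)) \<and> output_word ((step M ^^ s) (initial M p)) x)"

definition outputs :: "machine \<Rightarrow> bool list \<Rightarrow> bool list \<Rightarrow> bool" where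
  "outputs M p x \<longleftrightarrow> (\<exists>t. outputs_within M t p x)"

definition nat_code :: "nat \<Rightarrow> bool list" where
  "nat_code n = replicate n True @ [False]"

definition computable_fun :: "(nat \<Rightarrow> nat) \<Rightarrow> bool" where
  "computable_fun f \<longleftrightarrow>
     (\<exists>M. turing_machine M \<and> (\<forall>n. outputs M (nat_code n) (nat_code (f n))))"

definition computable_words :: "bool list set \<Rightarrow> bool" where
  "computable_words L \<longleftrightarrow> (\<exists>M. turing_machine M \<and> (\<forall>w. outputs M w [w \<in> L]))"

text \<open>The infimum of the empty set of lengths is \<open>\<infinity>\<close>: it is the value for words without a program.\<close>

definition complexity :: "machine \<Rightarrow> bool list \<Rightarrow> enat" where
  "complexity M x = (INF p \<in> {p. outputs M p x}. enat (length p))"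

definition complexity_within :: "machine \<Rightarrow> nat \<Rightarrow> bool list \<Rightarrow> enat" where
  "complexity_within M t x = (INF p \<in> {p. outputs_within M t p x}. enat (length p))"

definition optimal :: "machine \<Rightarrow> bool" where
  "optimal D \<longleftrightarrow> turing_machine D \<and>
     (\<forall>V. turing_machine V \<longrightarrow> (\<exists>c::nat. \<forall>x. complexity D x \<le> complexity V x + enat c))"

text \<open>
  The condition \<open>t \<ge> 2\<close> excludes the degenerate bound \<open>c * t * log t = 0\<close> at \<open>t \<le> 1\<close>, which
  no machine could satisfy. Since \<open>complexity_within V\<close> is antitone in the time bound, the case
  \<open>t = 2\<close> still controls what \<open>V\<close> outputs in fewer steps.
\<close>

definition time_optimal :: "machine \<Rightarrow> bool" where
  "time_optimal U \<longleftrightarrow> turing_machine U \<and>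
     (\<forall>V. turing_machine V \<longrightarrow>
        (\<exists>c::nat. \<forall>t\<ge>2. \<forall>x.
           complexity_within U (nat \<lfloor>real c * real t * log 2 (real t)\<rfloor>) x
             \<le> complexity_within V t x + enat c))"

type_synonym config2d = "int \<times> int \<Rightarrow> nat"

type_synonym pattern = "int \<times> int \<rightharpoonup> nat"

definition pattern_over :: "nat set \<Rightarrow> pattern \<Rightarrow> bool" where
  "pattern_over A P \<longleftrightarrow> finite (dom P) \<and> ran P \<subseteq> A"

text \<open>
  The code of a pattern lists the width and the height of its bounding box, followed by the
  cells of the box in row-major order. Two patterns have the same code iff they are translates
  of each other; this is harmless for sets of forbidden patterns and necessary for complexities
  of patterns to be independent of their position.
\<close>

definition pattern_cols :: "pattern \<Rightarrow> int list" where
  "pattern_cols P =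
     (if dom P = {} then [] else [Min (fst ` dom P)..Max (fst ` dom P)])"

definition pattern_rows :: "pattern \<Rightarrow> int list" where
  "pattern_rows P =
     (if dom P = {} then [] else [Min (snd ` dom P)..Max (snd ` dom P)])"

definition cell_code :: "nat option \<Rightarrow> bool list" where
  "cell_code s = (case s of None \<Rightarrow> nat_code 0 | Some a \<Rightarrow> nat_code (Suc a))"

definition pattern_code :: "pattern \<Rightarrow> bool list" where
  "pattern_code P =
     nat_code (length (pattern_cols P)) @ nat_code (length (pattern_rows P)) @
     concat [cell_code (P (i, j)). j \<leftarrow> pattern_rows P, i \<leftarrow> pattern_cols P]"

definition translate :: "int \<times> int \<Rightarrow> config2d \<Rightarrow> config2d" where
  "translate v x = (\<lambda>u. x (u + v))"

definition is_shift :: "nat set \<Rightarrow> config2d set \<Rightarrow> bool" where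
  "is_shift A S \<longleftrightarrow>
     closedin (product_topology (\<lambda>_. discrete_topology A) UNIV) S \<and>
     (\<forall>x\<in>S. \<forall>v. translate v x \<in> S)"

definition occurs_in :: "pattern \<Rightarrow> config2d \<Rightarrow> bool" where
  "occurs_in P x \<longleftrightarrow> (\<exists>v. \<forall>u\<in>dom P. P u = Some (x (u + v)))"

definition avoiding :: "nat set \<Rightarrow> pattern set \<Rightarrow> config2d set" where
  "avoiding A F = {x. range x \<subseteq> A \<and> (\<forall>P\<in>F. \<not> occurs_in P x)}"

definition effective_shift :: "nat set \<Rightarrow> config2d set \<Rightarrow> bool" where
  "effective_shift A S \<longleftrightarrow> is_shift A S \<and>
     (\<exists>F. (\<forall>P\<in>F. pattern_over A P) \<and> computable_words (pattern_code ` F) \<and>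
          S = avoiding A F)"

definition globally_admissible :: "config2d set \<Rightarrow> pattern \<Rightarrow> bool" where
  "globally_admissible S P \<longleftrightarrow> finite (dom P) \<and> (\<exists>x\<in>S. P = (Some \<circ> x) |` dom P)"

definition square_pattern :: "nat \<Rightarrow> pattern \<Rightarrow> bool" where
  "square_pattern n P \<longleftrightarrow>
     (\<exists>v. dom P = (\<lambda>u. u + v) ` ({1..int n} \<times> {1..int n}))"

end

theory Submission
  imports Defs "HOL-Library.Nat_Bijection"
begin

text \<open>
  Let \<open>N = 2^(4^k)\<close>. The configurations of the shift are, at every level \<open>k\<close>, tilings by an
  \<open>N \<times> N\<close> binary block \<open>B\<^sub>k\<close> and its complement. The block \<open>B\<^sub>k\<^sub>+\<^sub>1\<close> consists of \<open>m \<times> m\<close> such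
  blocks, \<open>m = N^3\<close>, a bit matrix \<open>R\<close> selecting the complemented ones. An \<open>N^4 \<times> N^4\<close> window
  of two-by-two adjacent (possibly complemented) copies of \<open>B\<^sub>k\<^sub>+\<^sub>1\<close> determines \<open>R\<close> once its offset and
  the complemented copies are known. So each output of one of the fewer than \<open>2^(m^2/2)\<close> programs
  of length below \<open>m^2/2\<close> spoils at most \<open>16 N^8\<close> of the \<open>2^(m^2)\<close> matrices, and some \<open>R\<close> makes all
  windows incompressible within the time bound \<open>T\<close>; here \<open>m^2/2 = (N^4)^1.5/2\<close>. As the least
  suitable block is computable from \<open>k\<close>, windows are described by their level and a position,
  that is by \<open>O(log N)\<close> bits; since the sides of consecutive levels are polynomially related,
  this covers squares of all sizes.

  Computability is handled through functions on numbers computed by counter programs, which run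
  on Turing machines whose head positions are the counters and which simulate Turing machines.
\<close>

section \<open>Structured Turing machine programs\<close>

text \<open>The shift is defined by windows alone: forbidden are the squares of side
  \<open>side k\<close> that are not windows of level \<open>k\<close>. Both complexity bounds only
  read windows; tilings serve to show that the shift is nonempty, without which both bounds would
  hold vacuously. The time bound is what makes it decidable whether a window has a short program, so
  that a suitable block can be found by exhaustive search and the forbidden set is computable. The
  complementation bits of a level are left free so that the next level can store \<open>R\<close> in
  them; a square of side N meets at most four copies, so this freedom costs four bits per window.
  Refining by m = N^r would give side N^(r+1) and N^(2r) stored bits, hence the exponent 2r/(r+1); r
  = 3 yields 1.5. Machines and functions on numbers must be related in both directions:
  \<open>T\<close> and \<open>U\<close> are given by machines but are used inside a search, while
  the search itself must become a machine that decides the forbidden patterns or decompresses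
  squares.\<close>

datatype prog =
  Do "nat list \<Rightarrow> (nat \<times> move) list"
| Seq prog prog (infixr ";;" 60)
| Cond "nat list \<Rightarrow> bool" prog prog
| While "nat list \<Rightarrow> bool" prog

inductive run :: "prog \<Rightarrow> tape list \<Rightarrow> tape list \<Rightarrow> bool" where
  Do: "run (Do f) ts (map2 act ts (f (map scan ts)))"
| Seq: "run p ts ts' \<Longrightarrow> run q ts' ts'' \<Longrightarrow> run (p ;; q) ts ts''"
| CondT: "c (map scan ts) \<Longrightarrow> run p ts ts' \<Longrightarrow> run (Cond c p q) ts ts'"
| CondF: "\<not> c (map scan ts) \<Longrightarrow> run q ts ts' \<Longrightarrow> run (Cond c p q) ts ts'"
| WhileF: "\<not> c (map scan ts) \<Longrightarrow> run (While c p) ts ts"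
| WhileT: "c (map scan ts) \<Longrightarrow> run p ts ts' \<Longrightarrow> run (While c p) ts' ts'' \<Longrightarrow> run (While c p) ts ts''"

definition idle :: "nat list \<Rightarrow> (nat \<times> move) list" where
  "idle ss = map (\<lambda>s. (s, Stay)) ss"

fun prog_size :: "prog \<Rightarrow> nat" where
  "prog_size (Do f) = 1"
| "prog_size (p ;; q) = prog_size p + prog_size q"
| "prog_size (Cond c p q) = Suc (prog_size p + prog_size q)"
| "prog_size (While c p) = Suc (prog_size p)"

text \<open>\<open>compile b x p\<close> lists the transitions of the states \<open>b, b + 1, \<dots>\<close>; state \<open>b\<close> is the
  entry point and \<open>x\<close> the state to continue in.\<close>

fun compile :: "nat \<Rightarrow> nat \<Rightarrow> prog \<Rightarrow> (nat list \<Rightarrow> nat \<times> (nat \<times> move) list) list" where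
  "compile b x (Do f) = [\<lambda>ss. (x, f ss)]"
| "compile b x (p ;; q) = compile b (b + prog_size p) p @ compile (b + prog_size p) x q"
| "compile b x (Cond c p q) =
     (\<lambda>ss. (if c ss then Suc b else Suc b + prog_size p, idle ss))
       # compile (Suc b) x p @ compile (Suc b + prog_size p) x q"
| "compile b x (While c p) =
     (\<lambda>ss. (if c ss then Suc b else x, idle ss)) # compile (Suc b) b p"

fun valid_prog :: "nat \<Rightarrow> prog \<Rightarrow> bool" where
  "valid_prog k (Do f) \<longleftrightarrow>
     (\<forall>ss. length ss = k \<and> set ss \<subseteq> {..<3} \<longrightarrow> length (f ss) = k \<and> fst ` set (f ss) \<subseteq> {..<3})"
| "valid_prog k (p ;; q) \<longleftrightarrow> valid_prog k p \<and> valid_prog k q"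
| "valid_prog k (Cond c p q) \<longleftrightarrow> valid_prog k p \<and> valid_prog k q"
| "valid_prog k (While c p) \<longleftrightarrow> valid_prog k p"

lemma length_compile [simp]: "length (compile b x p) = prog_size p"
  by (induction p arbitrary: b x) auto

lemma prog_size_pos [simp]: "0 < prog_size p"
  by (induction p) auto

lemma compile_valid:
  assumes "valid_prog k p" "i < prog_size p" "length ss = k" "set ss \<subseteq> {..<3}"
  shows "fst ((compile b x p ! i) ss) \<in> insert x {b..<b + prog_size p}"
    and "length (snd ((compile b x p ! i) ss)) = k"
    and "fst ` set (snd ((compile b x p ! i) ss)) \<subseteq> {..<3}"
proof -
  have "fst ((compile b x p ! i) ss) \<in> insert x {b..<b + prog_size p} \<and>
     length (snd ((compile b x p ! i) ss)) = k \<and> fst ` set (snd ((compile b x p ! i) ss)) \<subseteq> {..<3}"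
    using assms
  proof (induction p arbitrary: b x i)
    case (Do f) then show ?case by auto
  next
    case (Seq p q)
    show ?case
    proof (cases "i < prog_size p")
      case True
      then show ?thesis using Seq.IH(1)[of i b "b + prog_size p"] Seq.prems
        by (auto simp: nth_append)
    next
      case False
      then have "i - prog_size p < prog_size q" using Seq.prems by auto
      with False show ?thesis using Seq.IH(2)[of "i - prog_size p" "b + prog_size p" x] Seq.prems
        by (auto simp: nth_append)
    qed
  next
    case (Cond c p q)
    consider "i = 0" | j where "i = Suc j" "j < prog_size p"
      | j where "i = Suc j" "\<not> j < prog_size p" by (cases i) auto
    then show ?case
    proof cases
      case 1
      then show ?thesis using Cond.prems by (auto simp: idle_def)
    next
      case 2
      then show ?thesis using Cond.IH(1)[of j "Suc b" x] Cond.prems by (auto simp: nth_append)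
    next
      case 3
      then have "j - prog_size p < prog_size q" using Cond.prems by auto
      with 3 show ?thesis using Cond.IH(2)[of "j - prog_size p" "Suc b + prog_size p" x] Cond.prems
        by (auto simp: nth_append)
    qed
  next
    case (While c p)
    show ?case
    proof (cases i)
      case 0
      then show ?thesis using While.prems by (auto simp: idle_def)
    next
      case (Suc j)
      then show ?thesis using While.IH[of j "Suc b" b] While.prems by auto
    qed
  qed
  then show "fst ((compile b x p ! i) ss) \<in> insert x {b..<b + prog_size p}"
    and "length (snd ((compile b x p ! i) ss)) = k"
    and "fst ` set (snd ((compile b x p ! i) ss)) \<subseteq> {..<3}" by auto
qed

text \<open>States 0 and 1 are reserved for start and halt, so the compiled program occupies the
  states from 2 on and exits to 1. State 0 only passes control to 2. Three symbols are the least
  alphabet that \<open>turing_machine\<close> permits.\<close>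

definition machine_of :: "nat \<Rightarrow> prog \<Rightarrow> machine" where
  "machine_of k p = \<lparr>n_tapes = k, n_states = 2 + prog_size p, n_symbols = 3,
     trans_fun = (\<lambda>q ss. if q < 2 then (2, idle ss) else (compile 2 1 p ! (q - 2)) ss)\<rparr>"

lemma turing_machine_of:
  assumes "valid_prog k p" "2 \<le> k"
  shows "turing_machine (machine_of k p)"
proof -
  have "fst (trans_fun (machine_of k p) q ss) < 2 + prog_size p \<and>
        length (snd (trans_fun (machine_of k p) q ss)) = k \<and>
        fst ` set (snd (trans_fun (machine_of k p) q ss)) \<subseteq> {..<3}"
    if "q < 2 + prog_size p" "length ss = k" "set ss \<subseteq> {..<3}" for q ss
  proof (cases "q < 2")
    case True
    then show ?thesis using that by (auto simp: machine_of_def idle_def)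
  next
    case False
    then have "q - 2 < prog_size p" using that by auto
    from compile_valid[OF assms(1) this that(2,3), of 2 1] False show ?thesis
      by (auto simp: machine_of_def)
  qed
  then show ?thesis using assms(2) by (auto simp: turing_machine_def machine_of_def)
qed

definition reaches :: "machine \<Rightarrow> configuration \<Rightarrow> configuration \<Rightarrow> bool" where
  "reaches M c c' \<longleftrightarrow> (\<exists>s. (step M ^^ s) c = c')"

lemma reaches_refl: "reaches M c c"
  unfolding reaches_def by (metis funpow_0)

lemma reaches_trans: "reaches M c c' \<Longrightarrow> reaches M c' c'' \<Longrightarrow> reaches M c c''"
  unfolding reaches_def by (metis funpow_add comp_apply)

lemma reaches_step: "reaches M (step M c) c' \<Longrightarrow> reaches M c c'"
  unfolding reaches_def by (metis funpow_Suc_right comp_apply)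

lemma act_idle: "map2 act ts (idle (map scan ts)) = ts"
  by (rule nth_equalityI) (auto simp: idle_def act_def scan_def)

text \<open>Only the segment of \<open>M\<close> holding the code of \<open>p\<close> is
  constrained, so the induction applies to subprograms at any offset. A loop body is compiled with
  the loop's own entry as exit, hence returns to the test. \<open>2 \<le> b\<close> keeps every
  visited state of the program away from the halting state, where \<open>step\<close> would stand
  still.\<close>

lemma compile_reaches:
  assumes "run p ts ts'" "\<And>i. i < prog_size p \<Longrightarrow> trans_fun M (b + i) = compile b x p ! i" "2 \<le> b"
  shows "reaches M (b, ts) (x, ts')"
  using assms
proof (induction arbitrary: b x rule: run.induct)
  case (Do f ts b x)
  then have "trans_fun M b = (\<lambda>ss. (x, f ss))" using Do(1)[of 0] by auto
  then show ?case using Do(2)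
    by (rule_tac reaches_step) (simp add: step_def halted_def reaches_refl)
next
  case (Seq p ts ts' q ts'')
  have "reaches M (b, ts) (b + prog_size p, ts')"
  proof (rule Seq.IH(1))
    show "trans_fun M (b + i) = compile b (b + prog_size p) p ! i" if "i < prog_size p" for i
      using Seq.prems(1)[of i] that by (auto simp: nth_append)
  qed (use Seq.prems in auto)
  moreover have "reaches M (b + prog_size p, ts') (x, ts'')"
  proof (rule Seq.IH(2))
    show "trans_fun M (b + prog_size p + i) = compile (b + prog_size p) x q ! i" if "i < prog_size q" for i
      using Seq.prems(1)[of "prog_size p + i"] that by (auto simp: nth_append add.assoc)
  qed (use Seq.prems in auto)
  ultimately show ?case by (rule reaches_trans)
next
  case (CondT c ts p ts' q)
  have "step M (b, ts) = (Suc b, ts)"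
    using CondT.prems(1)[of 0] CondT.prems(2) CondT.hyps by (auto simp: step_def halted_def act_idle)
  moreover have "reaches M (Suc b, ts) (x, ts')"
  proof (rule CondT.IH)
    show "trans_fun M (Suc b + i) = compile (Suc b) x p ! i" if "i < prog_size p" for i
      using CondT.prems(1)[of "Suc i"] that by (auto simp: nth_append)
  qed (use CondT.prems in auto)
  ultimately show ?case by (metis reaches_step)
next
  case (CondF c ts q ts' p)
  have "step M (b, ts) = (Suc b + prog_size p, ts)"
    using CondF.prems(1)[of 0] CondF.prems(2) CondF.hyps by (auto simp: step_def halted_def act_idle)
  moreover have "reaches M (Suc b + prog_size p, ts) (x, ts')"
  proof (rule CondF.IH)
    show "trans_fun M (Suc b + prog_size p + i) = compile (Suc b + prog_size p) x q ! i" if "i < prog_size q" for i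
      using CondF.prems(1)[of "Suc (prog_size p + i)"] that by (auto simp: nth_append add.assoc)
  qed (use CondF.prems in auto)
  ultimately show ?case by (metis reaches_step)
next
  case (WhileF c ts p)
  have "step M (b, ts) = (x, ts)"
    using WhileF.prems(1)[of 0] WhileF.prems(2) WhileF.hyps by (auto simp: step_def halted_def act_idle)
  then show ?case by (metis reaches_step reaches_refl)
next
  case (WhileT c ts p ts' ts'')
  have "step M (b, ts) = (Suc b, ts)"
    using WhileT.prems(1)[of 0] WhileT.prems(2) WhileT.hyps by (auto simp: step_def halted_def act_idle)
  moreover have "reaches M (Suc b, ts) (b, ts')"
  proof (rule WhileT.IH(1))
    show "trans_fun M (Suc b + i) = compile (Suc b) b p ! i" if "i < prog_size p" for i
      using WhileT.prems(1)[of "Suc i"] that by auto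
  qed (use WhileT.prems in auto)
  moreover have "reaches M (b, ts') (x, ts'')"
    by (rule WhileT.IH(2)) (use WhileT.prems in auto)
  ultimately show ?case by (metis reaches_step reaches_trans)
qed

lemma machine_of_outputs:
  assumes "run p (snd (initial (machine_of k p) w)) ts'" and "output_word (1, ts') v"
  shows "outputs (machine_of k p) w v"
proof -
  let ?M = "machine_of k p"
  have "reaches ?M (2, snd (initial ?M w)) (1, ts')"
    by (rule compile_reaches[OF assms(1)]) (auto simp: machine_of_def)
  moreover have "step ?M (initial ?M w) = (2, snd (initial ?M w))"
  proof -
    have "initial ?M w = (0, snd (initial ?M w))" by (simp add: initial_def)
    moreover have "step ?M (0, ts) = (2, ts)" for ts
      using act_idle[of ts] by (simp add: step_def halted_def machine_of_def)
    ultimately show ?thesis by metis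
  qed
  ultimately have "reaches ?M (initial ?M w) (1, ts')" by (metis reaches_step)
  then obtain s where "(step ?M ^^ s) (initial ?M w) = (1, ts')" by (auto simp: reaches_def)
  then show ?thesis using assms(2)
    unfolding outputs_def outputs_within_def by (metis fst_conv halted_def le_refl)
qed

section \<open>Counter programs and recursive functions\<close>

text \<open>A counter is a tape marked at cell 0 only, its value being the position of the head.\<close>

definition counter :: "nat \<Rightarrow> tape" where
  "counter v = (int v, (\<lambda>_. 0)(0 := 1))"

definition tapes :: "nat \<Rightarrow> tape list \<Rightarrow> (nat \<Rightarrow> nat) \<Rightarrow> tape list" where
  "tapes K io \<sigma> = io @ map (\<lambda>r. counter (\<sigma> r)) [0..<K]"

text \<open>Quantifying over \<open>io\<close> says that the program ignores the input and output
  tapes; the same fact can then be used while those are being read or written.\<close>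

definition exec :: "nat \<Rightarrow> prog \<Rightarrow> (nat \<Rightarrow> nat) \<Rightarrow> (nat \<Rightarrow> nat) \<Rightarrow> bool" where
  "exec K p \<sigma> \<sigma>' \<longleftrightarrow> (\<forall>io. length io = 2 \<longrightarrow> run p (tapes K io \<sigma>) (tapes K io \<sigma>'))"

text \<open>Cell 0 of a counter is the only one marked, so the zero test is a single scan. The
  offset 2 skips the input and output tapes.\<close>

definition nonzero :: "nat \<Rightarrow> nat list \<Rightarrow> bool" where
  "nonzero r ss \<longleftrightarrow> ss ! (2 + r) \<noteq> 1"

definition "skip = Do idle"

definition "inc r = Do (\<lambda>ss. (idle ss)[2 + r := (ss ! (2 + r), Rgt)])"

definition "dec r =
  Do (\<lambda>ss. (idle ss)[2 + r := (ss ! (2 + r), if nonzero r ss then Lft else Stay)])"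

lemma length_idle [simp]: "length (idle ss) = length ss"
  by (simp add: idle_def)

lemma valid_update_idle:
  assumes "set ss \<subseteq> {..<3}" "i < length ss \<Longrightarrow> fst a < 3"
  shows "fst ` set ((idle ss)[i := a]) \<subseteq> {..<3}"
proof (cases "i < length ss")
  case True
  have "set ((idle ss)[i := a]) \<subseteq> insert a (set (idle ss))" by (rule set_update_subset_insert)
  then show ?thesis using assms True by (auto simp: idle_def)
next
  case False
  then have "(idle ss)[i := a] = idle ss" by (simp add: list_update_beyond)
  then show ?thesis using assms by (auto simp: idle_def)
qed

lemma valid_basic [simp]: "valid_prog k skip" "valid_prog k (inc r)" "valid_prog k (dec r)"
proof -
  have "fst ` set (idle ss) \<subseteq> {..<3}" if "set ss \<subseteq> {..<3}" for ss
    using that by (auto simp: idle_def)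
  then show "valid_prog k skip" by (simp add: skip_def)
  have *: "fst ` set ((idle ss)[2 + r := (ss ! (2 + r), m)]) \<subseteq> {..<3}" if "set ss \<subseteq> {..<3}" for ss m
    by (rule valid_update_idle[OF that]) (use that nth_mem in \<open>force simp: subset_iff\<close>)
  show "valid_prog k (inc r)" unfolding inc_def valid_prog.simps using * by simp
  show "valid_prog k (dec r)" unfolding dec_def valid_prog.simps using * by simp
qed

lemma length_tapes [simp]: "length io = 2 \<Longrightarrow> length (tapes K io \<sigma>) = 2 + K"
  by (simp add: tapes_def)

lemma nth_tapes [simp]:
  "length io = 2 \<Longrightarrow> r < K \<Longrightarrow> tapes K io \<sigma> ! Suc (Suc r) = counter (\<sigma> r)"
  by (simp add: tapes_def nth_append)

lemma scan_counter: "scan (counter v) = (if v = 0 then 1 else 0)"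
  by (simp add: scan_def counter_def)

lemma nonzero_tapes [simp]:
  "length io = 2 \<Longrightarrow> r < K \<Longrightarrow> nonzero r (map scan (tapes K io \<sigma>)) \<longleftrightarrow> \<sigma> r \<noteq> 0"
  by (simp add: nonzero_def scan_counter)

lemma map2_act_update:
  assumes "i < length ts"
  shows "map2 act ts ((idle (map scan ts))[i := a]) = ts[i := act (ts ! i) a]"
proof (rule nth_equalityI)
  fix j assume "j < length (map2 act ts ((idle (map scan ts))[i := a]))"
  then show "map2 act ts ((idle (map scan ts))[i := a]) ! j = ts[i := act (ts ! i) a] ! j"
    using assms by (cases "j = i") (auto simp: idle_def act_def scan_def)
qed simp

lemma tapes_update:
  "length io = 2 \<Longrightarrow> r < K \<Longrightarrow> (tapes K io \<sigma>)[Suc (Suc r) := counter v] = tapes K io (\<sigma>(r := v))"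
  by (rule nth_equalityI) (auto simp: tapes_def nth_append nth_list_update)

lemma exec_skip: "exec K skip \<sigma> \<sigma>"
  unfolding exec_def skip_def using run.Do[of idle] by (metis act_idle)

lemma exec_inc:
  assumes "r < K" shows "exec K (inc r) \<sigma> (\<sigma>(r := Suc (\<sigma> r)))"
  unfolding exec_def
proof (intro allI impI)
  fix io :: "tape list" assume io: "length io = 2"
  let ?ts = "tapes K io \<sigma>"
  have "run (inc r) ?ts (?ts[2 + r := act (?ts ! (2 + r)) (map scan ?ts ! (2 + r), Rgt)])"
    using run.Do[of "\<lambda>ss. (idle ss)[2 + r := (ss ! (2 + r), Rgt)]" ?ts] assms io
    by (subst map2_act_update[symmetric]) (auto simp: inc_def)
  moreover have "act (counter v) (scan (counter v), Rgt) = counter (Suc v)" for v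
    by (auto simp: act_def scan_def counter_def)
  ultimately show "run (inc r) ?ts (tapes K io (\<sigma>(r := Suc (\<sigma> r))))"
    using assms io by (simp add: tapes_update)
qed

lemma exec_dec:
  assumes "r < K" shows "exec K (dec r) \<sigma> (\<sigma>(r := \<sigma> r - 1))"
  unfolding exec_def
proof (intro allI impI)
  fix io :: "tape list" assume io: "length io = 2"
  let ?ts = "tapes K io \<sigma>"
  let ?m = "if \<sigma> r \<noteq> 0 then Lft else Stay"
  have "run (dec r) ?ts (?ts[2 + r := act (?ts ! (2 + r)) (map scan ?ts ! (2 + r), ?m)])"
    using run.Do[of "\<lambda>ss. (idle ss)[2 + r := (ss ! (2 + r), if nonzero r ss then Lft else Stay)]" ?ts] assms io
    by (subst map2_act_update[symmetric]) (auto simp: dec_def)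
  moreover have "act (counter v) (scan (counter v), if v \<noteq> 0 then Lft else Stay) = counter (v - 1)" for v
    by (auto simp: act_def scan_def counter_def)
  ultimately show "run (dec r) ?ts (tapes K io (\<sigma>(r := \<sigma> r - 1)))"
    using assms io by (simp add: tapes_update)
qed

lemma exec_seq: "exec K p \<sigma> \<sigma>' \<Longrightarrow> exec K q \<sigma>' \<sigma>'' \<Longrightarrow> exec K (p ;; q) \<sigma> \<sigma>''"
  by (auto simp: exec_def intro: run.Seq)

lemma exec_if:
  assumes "r < K" "\<sigma> r \<noteq> 0 \<Longrightarrow> exec K p \<sigma> \<sigma>'" "\<sigma> r = 0 \<Longrightarrow> exec K q \<sigma> \<sigma>'"
  shows "exec K (Cond (nonzero r) p q) \<sigma> \<sigma>'"
  using assms by (cases "\<sigma> r = 0") (auto simp: exec_def intro: run.CondT run.CondF)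

text \<open>The number of rounds and the whole trace \<open>S\<close> are supplied in advance, so
  that every later loop is verified by checking one round. The induction removes the first round and
  shifts \<open>S\<close>.\<close>

lemma run_while:
  assumes "\<And>i. i < n \<Longrightarrow> c (map scan (S i)) \<and> run p (S i) (S (Suc i))" "\<not> c (map scan (S n))"
  shows "run (While c p) (S 0) (S n)"
  using assms
proof (induction n arbitrary: S)
  case 0
  then show ?case by (auto intro: run.WhileF)
next
  case (Suc n)
  have "run (While c p) (S (Suc 0)) (S (Suc n))"
    using Suc.IH[of "\<lambda>i. S (Suc i)"] Suc.prems by auto
  with Suc.prems(1)[of 0] show ?case by (auto intro: run.WhileT)
qed

lemma exec_while:
  assumes "r < K" "\<And>i. i < n \<Longrightarrow> S i r \<noteq> 0 \<and> exec K p (S i) (S (Suc i))" "S n r = 0"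
    "S 0 = \<sigma>" "S n = \<sigma>'"
  shows "exec K (While (nonzero r) p) \<sigma> \<sigma>'"
  unfolding exec_def
proof (intro allI impI)
  fix io :: "tape list" assume io: "length io = 2"
  have "run (While (nonzero r) p) (tapes K io (S 0)) (tapes K io (S n))"
    by (rule run_while) (use assms io in \<open>auto simp: exec_def\<close>)
  then show "run (While (nonzero r) p) (tapes K io \<sigma>) (tapes K io \<sigma>')" using assms by simp
qed

section \<open>Counter arithmetic and Cantor pairing\<close>

definition "clear r = While (nonzero r) (dec r)"

lemma exec_clear:
  assumes "r < K" shows "exec K (clear r) \<sigma> (\<sigma>(r := 0))"
  unfolding clear_def
proof (rule exec_while[where S = "\<lambda>i. \<sigma>(r := \<sigma> r - i)" and n = "\<sigma> r"])
  fix i assume "i < \<sigma> r"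
  then show "(\<sigma>(r := \<sigma> r - i)) r \<noteq> 0 \<and> exec K (dec r) (\<sigma>(r := \<sigma> r - i)) (\<sigma>(r := \<sigma> r - Suc i))"
    using exec_dec[OF assms, of "\<sigma>(r := \<sigma> r - i)"] by simp
qed (use assms in auto)

definition "move r s = While (nonzero r) (dec r ;; inc s)"

lemma exec_move:
  assumes "r < K" "s < K" "r \<noteq> s" shows "exec K (move r s) \<sigma> (\<sigma>(r := 0, s := \<sigma> s + \<sigma> r))"
  unfolding move_def
proof (rule exec_while[where S = "\<lambda>i. \<sigma>(r := \<sigma> r - i, s := \<sigma> s + i)" and n = "\<sigma> r"])
  fix i assume i: "i < \<sigma> r"
  let ?\<tau> = "\<sigma>(r := \<sigma> r - i, s := \<sigma> s + i)"
  have "exec K (dec r ;; inc s) ?\<tau> (?\<tau>(r := ?\<tau> r - 1, s := Suc ((?\<tau>(r := ?\<tau> r - 1)) s)))"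
    by (intro exec_seq[OF exec_dec exec_inc] assms)
  moreover have "?\<tau>(r := ?\<tau> r - 1, s := Suc ((?\<tau>(r := ?\<tau> r - 1)) s)) = \<sigma>(r := \<sigma> r - Suc i, s := \<sigma> s + Suc i)"
    using assms by (auto simp: fun_eq_iff)
  ultimately show "?\<tau> r \<noteq> 0 \<and> exec K (dec r ;; inc s) ?\<tau> (\<sigma>(r := \<sigma> r - Suc i, s := \<sigma> s + Suc i))"
    using i assms by simp
qed (use assms in \<open>auto simp: fun_eq_iff\<close>)

text \<open>A counter can be read only by emptying it: the value is drained into \<open>s\<close>
  and \<open>t\<close> simultaneously and then restored from \<open>t\<close>.\<close>

definition "copy r s t = While (nonzero r) (dec r ;; inc s ;; inc t) ;; move t r"

lemma exec_copy:
  assumes "r < K" "s < K" "t < K" "r \<noteq> s" "r \<noteq> t" "s \<noteq> t" "\<sigma> t = 0"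
  shows "exec K (copy r s t) \<sigma> (\<sigma>(s := \<sigma> s + \<sigma> r))"
proof -
  let ?\<sigma>1 = "\<sigma>(r := 0, s := \<sigma> s + \<sigma> r, t := \<sigma> r)"
  have "exec K (While (nonzero r) (dec r ;; inc s ;; inc t)) \<sigma> ?\<sigma>1"
  proof (rule exec_while[where S = "\<lambda>i. \<sigma>(r := \<sigma> r - i, s := \<sigma> s + i, t := i)" and n = "\<sigma> r"])
    fix i assume i: "i < \<sigma> r"
    let ?\<tau> = "\<sigma>(r := \<sigma> r - i, s := \<sigma> s + i, t := i)"
    let ?\<tau>1 = "?\<tau>(r := ?\<tau> r - 1)"
    let ?\<tau>2 = "?\<tau>1(s := Suc (?\<tau>1 s))"
    have "exec K (dec r ;; inc s ;; inc t) ?\<tau> (?\<tau>2(t := Suc (?\<tau>2 t)))"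
      by (intro exec_seq[OF exec_dec exec_seq[OF exec_inc exec_inc]] assms)
    moreover have "?\<tau>2(t := Suc (?\<tau>2 t)) = \<sigma>(r := \<sigma> r - Suc i, s := \<sigma> s + Suc i, t := Suc i)"
      using assms by (auto simp: fun_eq_iff)
    ultimately show "?\<tau> r \<noteq> 0 \<and> exec K (dec r ;; inc s ;; inc t) ?\<tau>
        (\<sigma>(r := \<sigma> r - Suc i, s := \<sigma> s + Suc i, t := Suc i))"
      using i assms by simp
  qed (use assms in \<open>auto simp: fun_eq_iff\<close>)
  moreover have "exec K (move t r) ?\<sigma>1 (?\<sigma>1(t := 0, r := ?\<sigma>1 r + ?\<sigma>1 t))"
    by (rule exec_move) (use assms in auto)
  moreover have "?\<sigma>1(t := 0, r := ?\<sigma>1 r + ?\<sigma>1 t) = \<sigma>(s := \<sigma> s + \<sigma> r)"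
    using assms by (auto simp: fun_eq_iff)
  ultimately show ?thesis unfolding copy_def by (metis exec_seq)
qed

definition "pair_prog b =
  copy b (b + 1) (b + 3) ;; move (b + 2) (b + 1) ;;
  While (nonzero (b + 1)) (copy (b + 1) b (b + 3) ;; dec (b + 1))"

text \<open>The operands are in counters \<open>b\<close> and \<open>b + 2\<close>; counter \<open>b + 1\<close> runs down from their sum,
  adding up the triangle number in place.\<close>

lemma exec_pair_prog:
  assumes "b + 4 \<le> K" "\<sigma> (b + 1) = 0" "\<sigma> (b + 3) = 0"
  shows "exec K (pair_prog b) \<sigma> (\<sigma>(b := prod_encode (\<sigma> b, \<sigma> (b + 2)), b + 2 := 0))"
proof -
  let ?\<sigma>1 = "\<sigma>(b + 1 := \<sigma> b)"
  let ?s = "\<sigma> b + \<sigma> (b + 2)"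
  let ?\<sigma>2 = "\<sigma>(b + 1 := ?s, b + 2 := 0)"
  have 1: "exec K (copy b (b + 1) (b + 3)) \<sigma> ?\<sigma>1"
    using exec_copy[of b K "b + 1" "b + 3" \<sigma>] assms by simp
  have "?\<sigma>1(b + 2 := 0, b + 1 := ?\<sigma>1 (b + 1) + ?\<sigma>1 (b + 2)) = ?\<sigma>2"
    by (auto simp: fun_eq_iff)
  then have 2: "exec K (move (b + 2) (b + 1)) ?\<sigma>1 ?\<sigma>2"
    using exec_move[of "b + 2" K "b + 1" ?\<sigma>1] assms by simp
  let ?S = "\<lambda>i. ?\<sigma>2(b + 1 := ?s - i, b := \<sigma> b + (triangle ?s - triangle (?s - i)))"
  have 3: "exec K (While (nonzero (b + 1)) (copy (b + 1) b (b + 3) ;; dec (b + 1))) ?\<sigma>2 (?S ?s)"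
  proof (rule exec_while[where S = ?S and n = ?s])
    fix i assume i: "i < ?s"
    obtain j where j: "?s - i = Suc j" "?s - Suc i = j" using i by (metis Suc_diff_Suc)
    \<comment> \<open>The partial sums are written with truncated subtraction; monotonicity of
      \<open>triangle\<close> makes the differences genuine.\<close>
    have "triangle (Suc j) \<le> triangle ?s"
      unfolding triangle_def j(1)[symmetric] by (intro div_le_mono mult_le_mono) auto
    then have tri: "triangle ?s - triangle (Suc j) + Suc j = triangle ?s - triangle j" by simp
    let ?\<tau> = "?S i"
    have "exec K (copy (b + 1) b (b + 3) ;; dec (b + 1)) ?\<tau>
       (?\<tau>(b := ?\<tau> b + ?\<tau> (b + 1), b + 1 := (?\<tau>(b := ?\<tau> b + ?\<tau> (b + 1))) (b + 1) - 1))"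
      by (intro exec_seq[OF exec_copy exec_dec]) (use assms in auto)
    moreover have "?\<tau>(b := ?\<tau> b + ?\<tau> (b + 1), b + 1 := (?\<tau>(b := ?\<tau> b + ?\<tau> (b + 1))) (b + 1) - 1) = ?S (Suc i)"
      using tri j by (auto simp: fun_eq_iff)
    ultimately show "?\<tau> (b + 1) \<noteq> 0 \<and> exec K (copy (b + 1) b (b + 3) ;; dec (b + 1)) ?\<tau> (?S (Suc i))"
      using i by simp
  qed (use assms in \<open>auto simp: fun_eq_iff\<close>)
  have "?S ?s = \<sigma>(b := prod_encode (\<sigma> b, \<sigma> (b + 2)), b + 2 := 0)"
    using assms by (auto simp: fun_eq_iff prod_encode_def)
  with exec_seq[OF 1 exec_seq[OF 2 3]] show ?thesis by (simp only: pair_prog_def)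
qed

text \<open>Instead of inverting the pairing polynomial, the program walks through all pairs in the
  order of their codes; counter \<open>b + 2\<close> holds the number of steps still to go.\<close>

definition "unpair_prog b =
  move b (b + 2) ;;
  While (nonzero (b + 2))
    (dec (b + 2) ;;
     Cond (nonzero (b + 1)) (dec (b + 1) ;; inc b) (move b (b + 1) ;; inc (b + 1)))"

text \<open>The code of (m, n) is \<open>triangle (m + n) + m\<close>, so the successor moves one
  place along the antidiagonal, or from its last place (m, 0) to the first place of the next
  one.\<close>

lemma prod_decode_Suc:
  "prod_decode (Suc x) =
     (if snd (prod_decode x) = 0 then (0, Suc (fst (prod_decode x)))
      else (Suc (fst (prod_decode x)), snd (prod_decode x) - 1))"
proof -
  obtain m n where mn: "prod_decode x = (m, n)" by (cases "prod_decode x")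
  then have x: "x = prod_encode (m, n)" by (metis prod_decode_inverse)
  show ?thesis
  proof (cases n)
    case 0
    then have "Suc x = prod_encode (0, Suc m)" by (simp add: x prod_encode_def)
    then show ?thesis using 0 by (simp add: mn)
  next
    case (Suc k)
    then have "Suc x = prod_encode (Suc m, k)" by (simp add: x prod_encode_def)
    then show ?thesis using Suc by (simp add: mn)
  qed
qed

lemma prod_decode_0: "prod_decode 0 = (0, 0)"
proof -
  have "prod_encode (0, 0) = 0" by (simp add: prod_encode_def)
  then show ?thesis by (metis prod_encode_inverse)
qed

lemma exec_unpair_prog:
  assumes "b + 3 \<le> K" "\<sigma> (b + 1) = 0" "\<sigma> (b + 2) = 0"
  shows "exec K (unpair_prog b) \<sigma>
    (\<sigma>(b := fst (prod_decode (\<sigma> b)), b + 1 := snd (prod_decode (\<sigma> b))))"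
proof -
  let ?\<sigma>1 = "\<sigma>(b := 0, b + 2 := \<sigma> b)"
  have 1: "exec K (move b (b + 2)) \<sigma> ?\<sigma>1"
    using exec_move[of b K "b + 2" \<sigma>] assms by simp
  let ?S = "\<lambda>i. \<sigma>(b := fst (prod_decode i), b + 1 := snd (prod_decode i), b + 2 := \<sigma> b - i)"
  let ?body = "dec (b + 2) ;;
     Cond (nonzero (b + 1)) (dec (b + 1) ;; inc b) (move b (b + 1) ;; inc (b + 1))"
  have 2: "exec K (While (nonzero (b + 2)) ?body) ?\<sigma>1 (?S (\<sigma> b))"
  proof (rule exec_while[where S = ?S and n = "\<sigma> b"])
    fix i assume i: "i < \<sigma> b"
    let ?\<tau> = "?S i"
    let ?\<tau>1 = "?\<tau>(b + 2 := ?\<tau> (b + 2) - 1)"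
    have "exec K (Cond (nonzero (b + 1)) (dec (b + 1) ;; inc b) (move b (b + 1) ;; inc (b + 1))) ?\<tau>1 (?S (Suc i))"
    proof (rule exec_if)
      assume nz: "?\<tau>1 (b + 1) \<noteq> 0"
      let ?\<tau>2 = "?\<tau>1(b + 1 := ?\<tau>1 (b + 1) - 1)"
      have "exec K (dec (b + 1) ;; inc b) ?\<tau>1 (?\<tau>2(b := Suc (?\<tau>2 b)))"
        by (intro exec_seq[OF exec_dec exec_inc]) (use assms in auto)
      moreover have "?\<tau>2(b := Suc (?\<tau>2 b)) = ?S (Suc i)"
        using nz by (auto simp: fun_eq_iff prod_decode_Suc)
      ultimately show "exec K (dec (b + 1) ;; inc b) ?\<tau>1 (?S (Suc i))" by simp
    next
      assume z: "?\<tau>1 (b + 1) = 0"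
      let ?\<tau>2 = "?\<tau>1(b := 0, b + 1 := ?\<tau>1 (b + 1) + ?\<tau>1 b)"
      have "exec K (move b (b + 1) ;; inc (b + 1)) ?\<tau>1 (?\<tau>2(b + 1 := Suc (?\<tau>2 (b + 1))))"
        by (intro exec_seq[OF exec_move exec_inc]) (use assms in auto)
      moreover have "?\<tau>2(b + 1 := Suc (?\<tau>2 (b + 1))) = ?S (Suc i)"
        using z by (auto simp: fun_eq_iff prod_decode_Suc)
      ultimately show "exec K (move b (b + 1) ;; inc (b + 1)) ?\<tau>1 (?S (Suc i))" by simp
    qed (use assms in auto)
    moreover have "exec K (dec (b + 2)) ?\<tau> ?\<tau>1"
      by (rule exec_dec) (use assms in auto)
    ultimately show "?\<tau> (b + 2) \<noteq> 0 \<and> exec K ?body ?\<tau> (?S (Suc i))"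
      using i by (auto intro: exec_seq)
  qed (use assms in \<open>auto simp: fun_eq_iff prod_decode_0\<close>)
  have "?S (\<sigma> b) = \<sigma>(b := fst (prod_decode (\<sigma> b)), b + 1 := snd (prod_decode (\<sigma> b)))"
    using assms by (auto simp: fun_eq_iff)
  with exec_seq[OF 1 2] show ?thesis by (simp only: unpair_prog_def)
qed

lemma valid_compound [simp]:
  "valid_prog k (clear r)" "valid_prog k (move r s)" "valid_prog k (copy r s t)"
  "valid_prog k (pair_prog r)" "valid_prog k (unpair_prog r)"
  by (simp_all add: clear_def move_def copy_def pair_prog_def unpair_prog_def)

text \<open>The program at \<open>b\<close> treats the counters from \<open>b\<close> on as a stack and replaces its top \<open>x\<close> by
  \<open>f x\<close>; it needs \<open>d\<close> counters.\<close>

definition recursive :: "(nat \<Rightarrow> nat) \<Rightarrow> bool" where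
  "recursive f \<longleftrightarrow> (\<exists>p d. (\<forall>k b. valid_prog k (p b)) \<and>
     (\<forall>K b \<sigma>. b + d \<le> K \<longrightarrow> (\<forall>r>b. \<sigma> r = 0) \<longrightarrow> exec K (p b) \<sigma> (\<sigma>(b := f (\<sigma> b)))))"

lemma recursiveI:
  assumes "\<And>k b. valid_prog k (p b)"
    and "\<And>K b \<sigma>. b + d \<le> K \<Longrightarrow> (\<And>r. b < r \<Longrightarrow> \<sigma> r = 0) \<Longrightarrow> exec K (p b) \<sigma> (\<sigma>(b := f (\<sigma> b)))"
  shows "recursive f"
  unfolding recursive_def using assms by blast

section \<open>Pairing, composition and unbounded iteration\<close>

definition pfst :: "nat \<Rightarrow> nat" where "pfst z = fst (prod_decode z)"
definition psnd :: "nat \<Rightarrow> nat" where "psnd z = snd (prod_decode z)"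
definition pair :: "nat \<Rightarrow> nat \<Rightarrow> nat" where "pair x y = prod_encode (x, y)"

lemma pfst_pair [simp]: "pfst (pair x y) = x" and psnd_pair [simp]: "psnd (pair x y) = y"
  by (simp_all add: pfst_def psnd_def pair_def)

lemma pair_pfst_psnd [simp]: "pair (pfst z) (psnd z) = z"
  by (simp add: pfst_def psnd_def pair_def)

lemma recursive_id: "recursive (\<lambda>x. x)"
  by (rule recursiveI[of "\<lambda>b. skip" 0]) (simp_all add: exec_skip)

lemma recursive_0: "recursive (\<lambda>x. 0)"
  by (rule recursiveI[of clear 1]) (simp_all add: exec_clear)

lemma recursive_Suc_id: "recursive Suc"
  by (rule recursiveI[of inc 1]) (simp_all add: exec_inc)

lemma recursive_pred_id: "recursive (\<lambda>x. x - 1)"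
  by (rule recursiveI[of dec 1]) (use exec_dec in auto)

lemma recursive_pfst_id: "recursive pfst"
proof (rule recursiveI[of "\<lambda>b. unpair_prog b ;; clear (b + 1)" 3])
  fix K b and \<sigma> :: "nat \<Rightarrow> nat" assume K: "b + 3 \<le> K" and \<sigma>: "\<And>r. b < r \<Longrightarrow> \<sigma> r = 0"
  let ?\<tau> = "\<sigma>(b := fst (prod_decode (\<sigma> b)), b + 1 := snd (prod_decode (\<sigma> b)))"
  have "exec K (unpair_prog b ;; clear (b + 1)) \<sigma> (?\<tau>(b + 1 := 0))"
    by (intro exec_seq[OF exec_unpair_prog exec_clear]) (use K \<sigma> in auto)
  moreover have "?\<tau>(b + 1 := 0) = \<sigma>(b := pfst (\<sigma> b))"
    using \<sigma> by (auto simp: fun_eq_iff pfst_def)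
  ultimately show "exec K (unpair_prog b ;; clear (b + 1)) \<sigma> (\<sigma>(b := pfst (\<sigma> b)))" by simp
qed simp

lemma recursive_psnd_id: "recursive psnd"
proof (rule recursiveI[of "\<lambda>b. unpair_prog b ;; clear b ;; move (b + 1) b" 3])
  fix K b and \<sigma> :: "nat \<Rightarrow> nat" assume K: "b + 3 \<le> K" and \<sigma>: "\<And>r. b < r \<Longrightarrow> \<sigma> r = 0"
  let ?\<tau> = "\<sigma>(b := fst (prod_decode (\<sigma> b)), b + 1 := snd (prod_decode (\<sigma> b)))"
  let ?\<tau>1 = "?\<tau>(b := 0)"
  have "exec K (unpair_prog b ;; clear b ;; move (b + 1) b) \<sigma> (?\<tau>1(b + 1 := 0, b := ?\<tau>1 b + ?\<tau>1 (b + 1)))"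
    by (intro exec_seq[OF exec_unpair_prog exec_seq[OF exec_clear exec_move]]) (use K \<sigma> in auto)
  moreover have "?\<tau>1(b + 1 := 0, b := ?\<tau>1 b + ?\<tau>1 (b + 1)) = \<sigma>(b := psnd (\<sigma> b))"
    using \<sigma> by (auto simp: fun_eq_iff psnd_def)
  ultimately show "exec K (unpair_prog b ;; clear b ;; move (b + 1) b) \<sigma> (\<sigma>(b := psnd (\<sigma> b)))" by simp
qed simp

lemma recursive_comp:
  assumes "recursive f" "recursive g" shows "recursive (\<lambda>x. f (g x))"
proof -
  from assms obtain p d q e where p: "\<And>k b. valid_prog k (p b)"
    "\<And>K b \<sigma>. b + d \<le> K \<Longrightarrow> (\<forall>r>b. \<sigma> r = 0) \<Longrightarrow> exec K (p b) \<sigma> (\<sigma>(b := f (\<sigma> b)))"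
    and q: "\<And>k b. valid_prog k (q b)"
    "\<And>K b \<sigma>. b + e \<le> K \<Longrightarrow> (\<forall>r>b. \<sigma> r = 0) \<Longrightarrow> exec K (q b) \<sigma> (\<sigma>(b := g (\<sigma> b)))"
    unfolding recursive_def by metis
  show ?thesis
  proof (rule recursiveI[of "\<lambda>b. q b ;; p b" "d + e"])
    fix K b and \<sigma> :: "nat \<Rightarrow> nat" assume K: "b + (d + e) \<le> K" and \<sigma>: "\<And>r. b < r \<Longrightarrow> \<sigma> r = 0"
    have "exec K (q b) \<sigma> (\<sigma>(b := g (\<sigma> b)))" by (rule q) (use K \<sigma> in auto)
    moreover have "exec K (p b) (\<sigma>(b := g (\<sigma> b))) ((\<sigma>(b := g (\<sigma> b)))(b := f ((\<sigma>(b := g (\<sigma> b))) b)))"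
      by (rule p) (use K \<sigma> in auto)
    ultimately show "exec K (q b ;; p b) \<sigma> (\<sigma>(b := f (g (\<sigma> b))))"
      by (auto intro: exec_seq)
  qed (use p q in auto)
qed

text \<open>A program consumes its argument and needs zeros above it. So \<open>f\<close> runs at
  \<open>b + 1\<close> above a saved argument, its result is moved below that argument, and
  \<open>g\<close> runs at \<open>b + 2\<close>, which leaves the operands exactly where
  \<open>pair_prog\<close> expects them.\<close>

lemma recursive_pair:
  assumes "recursive f" "recursive g" shows "recursive (\<lambda>x. pair (f x) (g x))"
proof -
  from assms obtain p d q e where p: "\<And>k b. valid_prog k (p b)"
    "\<And>K b \<sigma>. b + d \<le> K \<Longrightarrow> (\<forall>r>b. \<sigma> r = 0) \<Longrightarrow> exec K (p b) \<sigma> (\<sigma>(b := f (\<sigma> b)))"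
    and q: "\<And>k b. valid_prog k (q b)"
    "\<And>K b \<sigma>. b + e \<le> K \<Longrightarrow> (\<forall>r>b. \<sigma> r = 0) \<Longrightarrow> exec K (q b) \<sigma> (\<sigma>(b := g (\<sigma> b)))"
    unfolding recursive_def by metis
  let ?P = "\<lambda>b. copy b (b + 1) (b + 2) ;; p (b + 1) ;; move b (b + 2) ;; move (b + 1) b ;; q (b + 2) ;; pair_prog b"
  show ?thesis
  proof (rule recursiveI[of ?P "d + e + 4"])
    fix K b and \<sigma> :: "nat \<Rightarrow> nat" assume K: "b + (d + e + 4) \<le> K" and \<sigma>: "\<And>r. b < r \<Longrightarrow> \<sigma> r = 0"
    let ?x = "\<sigma> b"
    have 1: "exec K (copy b (b + 1) (b + 2)) \<sigma> (\<sigma>(b + 1 := ?x))"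
      using exec_copy[of b K "b + 1" "b + 2" \<sigma>] K \<sigma> by simp
    have 2: "exec K (p (b + 1)) (\<sigma>(b + 1 := ?x)) (\<sigma>(b + 1 := f ?x))"
      using p(2)[of "b + 1" K "\<sigma>(b + 1 := ?x)"] K \<sigma> by simp
    have 3: "exec K (move b (b + 2)) (\<sigma>(b + 1 := f ?x)) (\<sigma>(b + 1 := f ?x, b := 0, b + 2 := ?x))"
      using exec_move[of b K "b + 2" "\<sigma>(b + 1 := f ?x)"] K \<sigma> by simp
    have "(\<sigma>(b + 1 := f ?x, b := 0, b + 2 := ?x))(b + 1 := 0, b := f ?x) = \<sigma>(b := f ?x, b + 2 := ?x)"
      using \<sigma> by (auto simp: fun_eq_iff)
    then have 4: "exec K (move (b + 1) b) (\<sigma>(b + 1 := f ?x, b := 0, b + 2 := ?x)) (\<sigma>(b := f ?x, b + 2 := ?x))"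
      using exec_move[of "b + 1" K b "\<sigma>(b + 1 := f ?x, b := 0, b + 2 := ?x)"] K by simp
    have 5: "exec K (q (b + 2)) (\<sigma>(b := f ?x, b + 2 := ?x)) (\<sigma>(b := f ?x, b + 2 := g ?x))"
      using q(2)[of "b + 2" K "\<sigma>(b := f ?x, b + 2 := ?x)"] K \<sigma> by simp
    have "\<sigma>(b := f ?x, b + 2 := g ?x, b := prod_encode (f ?x, g ?x), b + 2 := 0) = \<sigma>(b := pair (f ?x) (g ?x))"
      using \<sigma> by (auto simp: fun_eq_iff pair_def)
    then have 6: "exec K (pair_prog b) (\<sigma>(b := f ?x, b + 2 := g ?x)) (\<sigma>(b := pair (f ?x) (g ?x)))"
      using exec_pair_prog[of b K "\<sigma>(b := f ?x, b + 2 := g ?x)"] K \<sigma> by simp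
    show "exec K (?P b) \<sigma> (\<sigma>(b := pair (f ?x) (g ?x)))"
      by (rule exec_seq[OF 1 exec_seq[OF 2 exec_seq[OF 3 exec_seq[OF 4 exec_seq[OF 5 6]]]]])
  qed (use p q in simp)
qed

text \<open>This is the only source of unbounded search, so termination is demanded from every
  start. The test value lives in \<open>b + 1\<close> and is cleared before \<open>g\<close> runs,
  as the stack discipline requires.\<close>

lemma recursive_while:
  assumes "recursive f" "recursive g" "\<And>x. \<exists>n. f ((g ^^ n) x) = 0"
  shows "recursive (\<lambda>x. (g ^^ (LEAST n. f ((g ^^ n) x) = 0)) x)"
proof -
  from assms(1,2) obtain p d q e where p: "\<And>k b. valid_prog k (p b)"
    "\<And>K b \<sigma>. b + d \<le> K \<Longrightarrow> (\<forall>r>b. \<sigma> r = 0) \<Longrightarrow> exec K (p b) \<sigma> (\<sigma>(b := f (\<sigma> b)))"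
    and q: "\<And>k b. valid_prog k (q b)"
    "\<And>K b \<sigma>. b + e \<le> K \<Longrightarrow> (\<forall>r>b. \<sigma> r = 0) \<Longrightarrow> exec K (q b) \<sigma> (\<sigma>(b := g (\<sigma> b)))"
    unfolding recursive_def by metis
  let ?t = "\<lambda>b. copy b (b + 1) (b + 2) ;; p (b + 1)"
  let ?P = "\<lambda>b. ?t b ;; While (nonzero (b + 1)) (clear (b + 1) ;; q b ;; ?t b)"
  show ?thesis
  proof (rule recursiveI[of ?P "d + e + 3"])
    fix K b and \<sigma> :: "nat \<Rightarrow> nat" assume K: "b + (d + e + 3) \<le> K" and \<sigma>: "\<And>r. b < r \<Longrightarrow> \<sigma> r = 0"
    let ?x = "\<sigma> b"
    let ?n = "LEAST n. f ((g ^^ n) ?x) = 0"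
    let ?S = "\<lambda>i. \<sigma>(b := (g ^^ i) ?x, b + 1 := f ((g ^^ i) ?x))"
    have test: "exec K (?t b) (\<sigma>(b := y)) (\<sigma>(b := y, b + 1 := f y))" for y
    proof -
      have "exec K (copy b (b + 1) (b + 2)) (\<sigma>(b := y)) (\<sigma>(b := y, b + 1 := y))"
        using exec_copy[of b K "b + 1" "b + 2" "\<sigma>(b := y)"] K \<sigma> by simp
      moreover have "exec K (p (b + 1)) (\<sigma>(b := y, b + 1 := y)) (\<sigma>(b := y, b + 1 := f y))"
        using p(2)[of "b + 1" K "\<sigma>(b := y, b + 1 := y)"] K \<sigma> by simp
      ultimately show ?thesis by (rule exec_seq)
    qed
    have zero: "f ((g ^^ ?n) ?x) = 0" using assms(3) by (rule LeastI_ex)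
    have 2: "exec K (While (nonzero (b + 1)) (clear (b + 1) ;; q b ;; ?t b)) (?S 0) (?S ?n)"
    proof (rule exec_while[where S = ?S and n = ?n])
      fix i assume i: "i < ?n"
      have "\<sigma>(b := (g ^^ i) ?x, b + 1 := 0) = \<sigma>(b := (g ^^ i) ?x)" using \<sigma> by (auto simp: fun_eq_iff)
      then have 3: "exec K (clear (b + 1)) (?S i) (\<sigma>(b := (g ^^ i) ?x))"
        using exec_clear[of "b + 1" K "?S i"] K by simp
      have 4: "exec K (q b) (\<sigma>(b := (g ^^ i) ?x)) (\<sigma>(b := (g ^^ Suc i) ?x))"
        using q(2)[of b K "\<sigma>(b := (g ^^ i) ?x)"] K \<sigma> by simp
      have "exec K (clear (b + 1) ;; q b ;; ?t b) (?S i) (?S (Suc i))"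
        by (rule exec_seq[OF 3 exec_seq[OF 4 test]])
      moreover have "f ((g ^^ i) ?x) \<noteq> 0" using i by (rule not_less_Least)
      ultimately show "?S i (b + 1) \<noteq> 0 \<and> exec K (clear (b + 1) ;; q b ;; ?t b) (?S i) (?S (Suc i))" by simp
    qed (use K zero in auto)
    have eq: "?S ?n = \<sigma>(b := (g ^^ ?n) ?x)" using zero \<sigma> by (auto simp: fun_eq_iff)
    have 1: "exec K (?t b) \<sigma> (?S 0)" using test[of ?x] by simp
    show "exec K (?P b) \<sigma> (\<sigma>(b := (g ^^ ?n) ?x))" using exec_seq[OF 1 2] by (simp only: eq)
  qed (use p q in simp)
qed

section \<open>Transfer of words between tapes and counters by bijective binary numeration\<close>

fun nat_of_word :: "bool list \<Rightarrow> nat" where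
  "nat_of_word [] = 0"
| "nat_of_word (b # w) = 2 * nat_of_word w + (if b then 2 else 1)"

definition "double_prog = move 0 1 ;; While (nonzero 1) (dec 1 ;; inc 0 ;; inc 0)"

lemma exec_double_prog:
  assumes "2 \<le> K" "\<sigma> 1 = 0" shows "exec K double_prog \<sigma> (\<sigma>(0 := 2 * \<sigma> 0))"
proof -
  let ?S = "\<lambda>i. \<sigma>(0 := 2 * i, 1 := \<sigma> 0 - i)"
  have "\<sigma>(0 := 0, 1 := \<sigma> 0) = ?S 0" by (auto simp: fun_eq_iff)
  then have 1: "exec K (move 0 1) \<sigma> (?S 0)"
    using exec_move[of 0 K 1 \<sigma>] assms by simp
  have 2: "exec K (While (nonzero 1) (dec 1 ;; inc 0 ;; inc 0)) (?S 0) (?S (\<sigma> 0))"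
  proof (rule exec_while[where S = ?S and n = "\<sigma> 0"])
    fix i assume i: "i < \<sigma> 0"
    let ?\<tau> = "(?S i)(1 := ?S i 1 - 1)"
    let ?\<tau>1 = "?\<tau>(0 := Suc (?\<tau> 0))"
    have "exec K (dec 1 ;; inc 0 ;; inc 0) (?S i) (?\<tau>1(0 := Suc (?\<tau>1 0)))"
      by (intro exec_seq[OF exec_dec exec_seq[OF exec_inc exec_inc]]) (use assms in auto)
    moreover have "?\<tau>1(0 := Suc (?\<tau>1 0)) = ?S (Suc i)" by (auto simp: fun_eq_iff)
    ultimately show "?S i 1 \<noteq> 0 \<and> exec K (dec 1 ;; inc 0 ;; inc 0) (?S i) (?S (Suc i))" using i by simp
  qed (use assms in auto)
  have "?S (\<sigma> 0) = \<sigma>(0 := 2 * \<sigma> 0)" using assms by (auto simp: fun_eq_iff)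
  with exec_seq[OF 1 2] show ?thesis by (simp only: double_prog_def)
qed

text \<open>Counter 2 toggles with every unit taken from counter 0 and counter 1 advances at every
  second one, so quotient and remainder arise together.\<close>

definition "halve_prog = While (nonzero 0) (dec 0 ;; Cond (nonzero 2) (dec 2 ;; inc 1) (inc 2))"

lemma exec_halve_prog:
  assumes "3 \<le> K" "\<sigma> 1 = 0" "\<sigma> 2 = 0"
  shows "exec K halve_prog \<sigma> (\<sigma>(0 := 0, 1 := \<sigma> 0 div 2, 2 := \<sigma> 0 mod 2))"
  unfolding halve_prog_def
proof (rule exec_while[where S = "\<lambda>i. \<sigma>(0 := \<sigma> 0 - i, 1 := i div 2, 2 := i mod 2)" and n = "\<sigma> 0"])
  let ?S = "\<lambda>i. \<sigma>(0 := \<sigma> 0 - i, 1 := i div 2, 2 := i mod 2)"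
  fix i assume i: "i < \<sigma> 0"
  let ?\<tau> = "(?S i)(0 := ?S i 0 - 1)"
  have "exec K (Cond (nonzero 2) (dec 2 ;; inc 1) (inc 2)) ?\<tau> (?S (Suc i))"
  proof (rule exec_if)
    assume nz: "?\<tau> 2 \<noteq> 0"
    let ?\<tau>1 = "?\<tau>(2 := ?\<tau> 2 - 1)"
    have "exec K (dec 2 ;; inc 1) ?\<tau> (?\<tau>1(1 := Suc (?\<tau>1 1)))"
      by (intro exec_seq[OF exec_dec exec_inc]) (use assms in auto)
    moreover have "?\<tau>1(1 := Suc (?\<tau>1 1)) = ?S (Suc i)"
      using nz by (auto simp: fun_eq_iff) presburger+
    ultimately show "exec K (dec 2 ;; inc 1) ?\<tau> (?S (Suc i))" by simp
  next
    assume "?\<tau> 2 = 0"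
    then have "?\<tau>(2 := Suc (?\<tau> 2)) = ?S (Suc i)"
      by (auto simp: fun_eq_iff)
    then show "exec K (inc 2) ?\<tau> (?S (Suc i))" using exec_inc[of 2 K ?\<tau>] assms by simp
  qed (use assms in auto)
  moreover have "exec K (dec 0) (?S i) ?\<tau>" by (rule exec_dec) (use assms in auto)
  ultimately show "?S i 0 \<noteq> 0 \<and>
      exec K (dec 0 ;; Cond (nonzero 2) (dec 2 ;; inc 1) (inc 2)) (?S i) (?S (Suc i))"
    using i by (auto intro: exec_seq)
qed (use assms in \<open>auto simp: fun_eq_iff\<close>)

definition "move_input m = Do (\<lambda>ss. (idle ss)[0 := (ss ! 0, m)])"

lemma run_move_input:
  "run (move_input m) (tapes K [(h, c), o1] \<sigma>) (tapes K [(h + displacement m, c), o1] \<sigma>)"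
proof -
  let ?ts = "tapes K [(h, c), o1] \<sigma>"
  have "run (move_input m) ?ts (?ts[0 := act (?ts ! 0) (map scan ?ts ! 0, m)])"
    using run.Do[of "\<lambda>ss. (idle ss)[0 := (ss ! 0, m)]" ?ts]
    by (subst map2_act_update[symmetric]) (auto simp: move_input_def tapes_def)
  then show ?thesis by (simp add: tapes_def act_def scan_def)
qed

definition "write_output = Do (\<lambda>ss. (idle ss)[1 := (if nonzero 2 ss then 2 else 1, Rgt)])"

lemma run_write_output:
  assumes "3 \<le> K"
  shows "run write_output (tapes K [i1, (h, c)] \<sigma>)
    (tapes K [i1, (h + 1, c(h := bit_symbol (\<sigma> 2 \<noteq> 0)))] \<sigma>)"
proof -
  let ?ts = "tapes K [i1, (h, c)] \<sigma>"
  have "run write_output ?ts (?ts[1 := act (?ts ! 1) (if nonzero 2 (map scan ?ts) then 2 else 1, Rgt)])"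
    using run.Do[of "\<lambda>ss. (idle ss)[1 := (if nonzero 2 ss then 2 else 1, Rgt)]" ?ts] assms
    by (subst map2_act_update[symmetric]) (auto simp: write_output_def)
  moreover have "nonzero 2 (map scan ?ts) \<longleftrightarrow> \<sigma> 2 \<noteq> 0" using assms by simp
  ultimately show ?thesis by (simp add: tapes_def act_def scan_def bit_symbol_def)
qed

text \<open>Initially the counter tapes are completely blank; marking their cell 0 turns each into a
  counter of value 0.\<close>

definition "mark_prog = Do (\<lambda>ss. take 2 (idle ss) @ replicate (length ss - 2) (1, Stay))"

lemma run_mark_prog:
  "run mark_prog (snd (initial (machine_of (2 + K) p) w)) (tapes K [input_tape w, blank_tape] (\<lambda>_. 0))"
proof -
  let ?ts = "input_tape w # blank_tape # replicate K blank_tape"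
  let ?f = "\<lambda>ss. take 2 (idle ss) @ replicate (length ss - 2) (1, Stay)"
  have "map2 act ?ts (?f (map scan ?ts)) = tapes K [input_tape w, blank_tape] (\<lambda>_. 0)"
    by (rule nth_equalityI)
      (auto simp: tapes_def nth_append idle_def act_def scan_def counter_def blank_tape_def nth_Cons'
        fun_upd_idem input_tape_def)
  moreover have "snd (initial (machine_of (2 + K) p) w) = ?ts"
    by (simp add: initial_def machine_of_def)
  ultimately show ?thesis using run.Do[of ?f ?ts] by (simp add: mark_prog_def)
qed

text \<open>The first letter is the lowest digit, so Horner's rule has to start at the right end:
  the head first runs to the blank behind the word and then reads backwards. The digits are 1 and 2,
  whence one unconditional and one conditional \<open>inc\<close>.\<close>

definition "read_prog =
  While (\<lambda>ss. ss ! 0 \<noteq> 0) (move_input Rgt) ;; move_input Lft ;;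
  While (\<lambda>ss. ss ! 0 \<noteq> 0)
    (double_prog ;; inc 0 ;; Cond (\<lambda>ss. ss ! 0 = 2) (inc 0) skip ;; move_input Lft)"

lemma exec_run: "exec K p \<sigma> \<sigma>' \<Longrightarrow> length io = 2 \<Longrightarrow> run p (tapes K io \<sigma>) (tapes K io \<sigma>')"
  by (simp add: exec_def)

lemma run_read_prog:
  assumes "2 \<le> K"
  shows "\<exists>i1. run read_prog (tapes K [input_tape w, o1] (\<lambda>_. 0))
     (tapes K [i1, o1] ((\<lambda>_. 0)(0 := nat_of_word w)))"
proof -
  define c where "c = snd (input_tape w)"
  have c: "c i = (if 0 \<le> i \<and> i < int (length w) then bit_symbol (w ! nat i) else 0)" for i
    by (simp add: c_def input_tape_def)
  have scan0: "map scan (tapes K [(h, c), o1] \<sigma>) ! 0 = c h" for h \<sigma>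
    by (simp add: tapes_def scan_def)
  define S where "S i = tapes K [(int i, c), o1] (\<lambda>_. 0)" for i
  have S0: "tapes K [input_tape w, o1] (\<lambda>_. 0) = S 0"
    by (simp add: S_def c_def input_tape_def)
  have 1: "run (While (\<lambda>ss. ss ! 0 \<noteq> 0) (move_input Rgt)) (S 0) (S (length w))"
  proof (rule run_while)
    fix i assume "i < length w"
    then show "map scan (S i) ! 0 \<noteq> 0 \<and> run (move_input Rgt) (S i) (S (Suc i))"
      using run_move_input[of Rgt K "int i" c o1 "\<lambda>_. 0"]
      by (simp add: S_def scan0 c bit_symbol_def add.commute)
  qed (simp add: S_def scan0 c)
  \<comment> \<open>The last \<open>i\<close> letters have been read after \<open>i\<close> rounds.
    After the last round the head is on cell -1, whose blank ends the loop.\<close>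
  define S' where "S' i = tapes K [(int (length w) - 1 - int i, c), o1]
     ((\<lambda>_. 0)(0 := nat_of_word (drop (length w - i) w)))" for i
  have 2: "run (move_input Lft) (S (length w)) (S' 0)"
  proof -
    have "(\<lambda>_ :: nat. 0 :: nat)(0 := 0) = (\<lambda>_. 0)" by auto
    then show ?thesis using run_move_input[of Lft K "int (length w)" c o1 "\<lambda>_. 0"]
      by (simp add: S_def S'_def)
  qed
  have 3: "run (While (\<lambda>ss. ss ! 0 \<noteq> 0)
    (double_prog ;; inc 0 ;; Cond (\<lambda>ss. ss ! 0 = 2) (inc 0) skip ;; move_input Lft)) (S' 0) (S' (length w))"
  proof (rule run_while)
    fix i assume i: "i < length w"
    define j where "j = length w - Suc i"
    have j: "int (length w) - 1 - int i = int j" "length w - i = Suc j" "j < length w"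
      using i by (auto simp: j_def)
    have dr: "drop j w = w ! j # drop (Suc j) w" using j by (simp add: Cons_nth_drop_Suc)
    let ?io = "[(int j, c), o1]"
    let ?v = "nat_of_word (drop (Suc j) w)"
    let ?\<sigma> = "\<lambda>v. (\<lambda>_ :: nat. 0 :: nat)(0 := v)"
    have S'i: "S' i = tapes K ?io (?\<sigma> ?v)" using j by (simp add: S'_def)
    have a: "run double_prog (tapes K ?io (?\<sigma> ?v)) (tapes K ?io (?\<sigma> (2 * ?v)))"
      using exec_run[OF exec_double_prog[of K "?\<sigma> ?v"], of ?io] assms by simp
    have b: "run (inc 0) (tapes K ?io (?\<sigma> v)) (tapes K ?io (?\<sigma> (Suc v)))" for v
      using exec_run[OF exec_inc[of 0 K "?\<sigma> v"], of ?io] assms by simp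
    have cj: "c (int j) = bit_symbol (w ! j)" using j by (simp add: c)
    have d: "run (Cond (\<lambda>ss. ss ! 0 = 2) (inc 0) skip) (tapes K ?io (?\<sigma> (Suc (2 * ?v))))
       (tapes K ?io (?\<sigma> (nat_of_word (drop j w))))"
    proof (cases "w ! j")
      case True
      with cj show ?thesis using b[of "Suc (2 * ?v)"]
        by (intro run.CondT) (simp_all add: dr scan0 bit_symbol_def)
    next
      case False
      with cj show ?thesis
        using exec_run[OF exec_skip, of ?io K "?\<sigma> (Suc (2 * ?v))"]
        by (intro run.CondF) (simp_all add: dr scan0 bit_symbol_def)
    qed
    have e: "run (move_input Lft) (tapes K ?io (?\<sigma> (nat_of_word (drop j w)))) (S' (Suc i))"
      using run_move_input[of Lft K "int j" c o1] j by (simp add: S'_def j_def algebra_simps)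
    have "run (double_prog ;; inc 0 ;; Cond (\<lambda>ss. ss ! 0 = 2) (inc 0) skip ;; move_input Lft)
       (S' i) (S' (Suc i))"
      unfolding S'i by (rule run.Seq[OF a run.Seq[OF b run.Seq[OF d e]]])
    moreover have "map scan (S' i) ! 0 \<noteq> 0"
      unfolding S'i scan0 using j by (simp add: c bit_symbol_def)
    ultimately show "map scan (S' i) ! 0 \<noteq> 0 \<and> run (double_prog ;; inc 0 ;; Cond (\<lambda>ss. ss ! 0 = 2) (inc 0) skip ;; move_input Lft)
       (S' i) (S' (Suc i))" by simp
  qed (simp add: S'_def scan0 c)
  have "run read_prog (S 0) (S' (length w))"
    unfolding read_prog_def by (rule run.Seq[OF 1 run.Seq[OF 2 3]])
  then show ?thesis unfolding S0 by (auto simp: S'_def)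
qed

text \<open>A positive number is 2q + d with d in {1, 2}. Decrementing before halving therefore
  leaves d - 1, the bit to be written, in counter 2 and q in counter 1.\<close>

definition "write_prog =
  While (nonzero 0) (dec 0 ;; halve_prog ;; write_output ;; clear 2 ;; move 1 0)"

lemma run_write_prog:
  assumes "3 \<le> K"
  shows "run write_prog (tapes K [i1, blank_tape] ((\<lambda>_. 0)(0 := nat_of_word w)))
     (tapes K [i1, (int (length w), snd (input_tape w))] (\<lambda>_. 0))"
proof -
  \<comment> \<open>\<open>input_tape\<close> is reused only as a name for the contents of a tape
    that holds a word from cell 0 on.\<close>
  define S where "S i = tapes K [i1, (int i, snd (input_tape (take i w)))]
     ((\<lambda>_. 0)(0 := nat_of_word (drop i w)))" for i
  have "run write_prog (S 0) (S (length w))"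
    unfolding write_prog_def
  proof (rule run_while)
    fix i assume i: "i < length w"
    have dr: "drop i w = w ! i # drop (Suc i) w" using i by (simp add: Cons_nth_drop_Suc)
    let ?v = "nat_of_word (drop (Suc i) w)"
    let ?\<sigma> = "\<lambda>v. (\<lambda>_ :: nat. 0 :: nat)(0 := v)"
    let ?io = "[i1, (int i, snd (input_tape (take i w)))]"
    let ?io' = "[i1, (int (Suc i), snd (input_tape (take (Suc i) w)))]"
    let ?u = "2 * ?v + of_bool (w ! i)"
    let ?\<tau> = "(\<lambda>_ :: nat. 0 :: nat)(1 := ?v, 2 := of_bool (w ! i))"
    have nw: "nat_of_word (drop i w) = Suc ?u" by (simp add: dr)
    have a: "run (dec 0) (S i) (tapes K ?io (?\<sigma> ?u))"
      using exec_run[OF exec_dec[of 0 K "?\<sigma> (Suc ?u)"], of ?io] assms by (simp add: S_def nw)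
    have "(?\<sigma> ?u)(0 := 0, 1 := ?u div 2, 2 := ?u mod 2) = ?\<tau>"
      by (cases "w ! i") (auto simp: fun_eq_iff)
    then have b: "run halve_prog (tapes K ?io (?\<sigma> ?u)) (tapes K ?io ?\<tau>)"
      using exec_run[OF exec_halve_prog[of K "?\<sigma> ?u"], of ?io] assms by simp
    have "(snd (input_tape (take i w)))(int i := bit_symbol (w ! i)) = snd (input_tape (take (Suc i) w))"
      using i by (auto simp: input_tape_def fun_eq_iff nth_take min_def less_Suc_eq nat_less_iff)
    then have d: "run write_output (tapes K ?io ?\<tau>) (tapes K ?io' ?\<tau>)"
      using run_write_output[OF assms, of i1 "int i" "snd (input_tape (take i w))" ?\<tau>]
      by (simp add: add.commute)
    have "?\<tau>(2 := 0) = (\<lambda>_ :: nat. 0 :: nat)(1 := ?v)" by (auto simp: fun_eq_iff)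
    then have e: "run (clear 2) (tapes K ?io' ?\<tau>) (tapes K ?io' ((\<lambda>_. 0)(1 := ?v)))"
      using exec_run[OF exec_clear[of 2 K ?\<tau>], of ?io'] assms by simp
    have "((\<lambda>_ :: nat. 0 :: nat)(1 := ?v))(1 := 0, 0 := ?v) = ?\<sigma> ?v" by (auto simp: fun_eq_iff)
    then have f: "run (move 1 0) (tapes K ?io' ((\<lambda>_. 0)(1 := ?v))) (S (Suc i))"
      using exec_run[OF exec_move[of 1 K 0 "(\<lambda>_. 0)(1 := ?v)"], of ?io'] assms by (simp add: S_def)
    have "nonzero 0 (map scan (S i))" using assms by (simp add: S_def nw)
    moreover have "run (dec 0 ;; halve_prog ;; write_output ;; clear 2 ;; move 1 0) (S i) (S (Suc i))"
      by (rule run.Seq[OF a run.Seq[OF b run.Seq[OF d run.Seq[OF e f]]]])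
    ultimately show "nonzero 0 (map scan (S i)) \<and>
       run (dec 0 ;; halve_prog ;; write_output ;; clear 2 ;; move 1 0) (S i) (S (Suc i))" by simp
  qed (use assms in \<open>simp add: S_def\<close>)
  moreover have "blank_tape = (0, snd (input_tape []))"
    by (auto simp: blank_tape_def input_tape_def)
  moreover have "(\<lambda>_ :: nat. 0 :: nat)(0 := 0) = (\<lambda>_. 0)" by auto
  ultimately show ?thesis by (simp add: S_def)
qed

lemma valid_io [simp]:
  "valid_prog k mark_prog" "valid_prog k read_prog" "valid_prog k write_prog"
proof -
  have "valid_prog k (move_input m)" for m
    unfolding move_input_def valid_prog.simps
    by (intro allI impI conjI valid_update_idle) (auto simp: subset_iff)
  moreover have "valid_prog k write_output"
    unfolding write_output_def valid_prog.simps
    by (intro allI impI conjI valid_update_idle) (auto simp: subset_iff)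
  ultimately show "valid_prog k read_prog" "valid_prog k write_prog"
    by (simp_all add: read_prog_def write_prog_def double_prog_def halve_prog_def)
  show "valid_prog k mark_prog"
    by (auto simp: mark_prog_def idle_def subset_iff dest!: in_set_takeD)
qed

text \<open>The bridge from numbers to machines; it is used both for deciding forbidden codes and
  for decompression.\<close>

lemma recursive_machine:
  assumes "recursive f" "\<And>w. f (nat_of_word w) = nat_of_word (g w)"
  shows "\<exists>M. turing_machine M \<and> (\<forall>w. outputs M w (g w))"
proof -
  from assms(1) obtain p d where p: "\<And>k b. valid_prog k (p b)"
    "\<And>K b \<sigma>. b + d \<le> K \<Longrightarrow> (\<forall>r>b. \<sigma> r = 0) \<Longrightarrow> exec K (p b) \<sigma> (\<sigma>(b := f (\<sigma> b)))"
    unfolding recursive_def by metis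
  \<comment> \<open>\<open>d\<close> counters serve the program of \<open>f\<close> and three
    suffice for reading and writing; the input and output tapes come on top.\<close>
  define K where "K = d + 3"
  define q where "q = mark_prog ;; read_prog ;; p 0 ;; write_prog"
  have "turing_machine (machine_of (2 + K) q)"
    by (rule turing_machine_of) (use p in \<open>simp_all add: q_def\<close>)
  moreover have "outputs (machine_of (2 + K) q) w (g w)" for w
  proof -
    let ?\<sigma> = "\<lambda>v. (\<lambda>_ :: nat. 0 :: nat)(0 := v)"
    obtain i1 where r: "run read_prog (tapes K [input_tape w, blank_tape] (\<lambda>_. 0))
     (tapes K [i1, blank_tape] (?\<sigma> (nat_of_word w)))"
      using run_read_prog[of K w blank_tape] by (auto simp: K_def)
    have a: "run (p 0) (tapes K [i1, blank_tape] (?\<sigma> (nat_of_word w)))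
        (tapes K [i1, blank_tape] (?\<sigma> (nat_of_word (g w))))"
      using exec_run[OF p(2)[of 0 K "?\<sigma> (nat_of_word w)"], of "[i1, blank_tape]"] assms(2)
      by (simp add: K_def)
    have b: "run write_prog (tapes K [i1, blank_tape] (?\<sigma> (nat_of_word (g w))))
       (tapes K [i1, (int (length (g w)), snd (input_tape (g w)))] (\<lambda>_. 0))"
      by (rule run_write_prog) (simp add: K_def)
    have "run q (snd (initial (machine_of (2 + K) q) w))
      (tapes K [i1, (int (length (g w)), snd (input_tape (g w)))] (\<lambda>_. 0))"
      unfolding q_def by (rule run.Seq[OF run_mark_prog run.Seq[OF r run.Seq[OF a b]]])
    then show ?thesis
      by (rule machine_of_outputs) (auto simp: output_word_def tapes_def input_tape_def bit_symbol_def)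
  qed
  ultimately show ?thesis by blast
qed

section \<open>Closure properties of recursive functions\<close>

named_theorems recursive_intros

definition decidable :: "(nat \<Rightarrow> bool) \<Rightarrow> bool" where
  "decidable P \<longleftrightarrow> recursive (\<lambda>x. of_bool (P x))"

lemma recursive_Suc [recursive_intros]: "recursive f \<Longrightarrow> recursive (\<lambda>x. Suc (f x))"
  by (rule recursive_comp[OF recursive_Suc_id])

lemma recursive_pfst [recursive_intros]: "recursive f \<Longrightarrow> recursive (\<lambda>x. pfst (f x))"
  by (rule recursive_comp[OF recursive_pfst_id])

lemma recursive_psnd [recursive_intros]: "recursive f \<Longrightarrow> recursive (\<lambda>x. psnd (f x))"
  by (rule recursive_comp[OF recursive_psnd_id])

lemma recursive_const [recursive_intros]: "recursive (\<lambda>x. c)"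
  by (induction c) (auto intro: recursive_0 recursive_Suc)

declare recursive_id [recursive_intros] recursive_pair [recursive_intros]

text \<open>A function of two arguments is recursive as a function of a pair. Feeding it the pair of
  \<open>f x\<close> and \<open>g x\<close> yields all instances, which serves to instantiate
  parameters under quantifiers and recursors.\<close>

lemma recursive_lift2:
  assumes "recursive (\<lambda>z. F (pfst z) (psnd z))" "recursive f" "recursive g"
  shows "recursive (\<lambda>x. F (f x) (g x))"
  using recursive_comp[OF assms(1) recursive_pair[OF assms(2,3)]] by simp

lemma recursive_lift3:
  assumes "recursive (\<lambda>z. F (pfst z) (pfst (psnd z)) (psnd (psnd z)))"
    "recursive f" "recursive g" "recursive h"
  shows "recursive (\<lambda>x. F (f x) (g x) (h x))"
  using recursive_comp[OF assms(1) recursive_pair[OF assms(2) recursive_pair[OF assms(3,4)]]] by simp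

lemma decidable_lift2:
  assumes "decidable (\<lambda>z. P (pfst z) (psnd z))" "recursive f" "recursive g"
  shows "decidable (\<lambda>x. P (f x) (g x))"
  using recursive_lift2[of "\<lambda>a b. of_bool (P a b)" f g] assms by (simp add: decidable_def)

lemma decidable_lift3:
  assumes "decidable (\<lambda>z. P (pfst z) (pfst (psnd z)) (psnd (psnd z)))"
    "recursive f" "recursive g" "recursive h"
  shows "decidable (\<lambda>x. P (f x) (g x) (h x))"
  using recursive_lift3[of "\<lambda>a b c. of_bool (P a b c)" f g h] assms by (simp add: decidable_def)

text \<open>A counted loop as a special case of \<open>recursive_while\<close>: the state carries
  the parameter, the number of rounds left and the current value, and the first zero of the round
  counter ends it.\<close>

lemma recursive_funpow:
  assumes G: "recursive (\<lambda>z. G (pfst z) (psnd z))" and n: "recursive n" and a: "recursive a"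
  shows "recursive (\<lambda>x. (G x ^^ n x) (a x))"
proof -
  define g where "g z = pair (pfst z) (pair (pfst (psnd z) - 1) (G (pfst z) (psnd (psnd z))))" for z
  define f where "f z = pfst (psnd z)" for z
  have iter: "(g ^^ i) (pair x (pair m y)) = pair x (pair (m - i) ((G x ^^ i) y))" for i x m y
    by (induction i) (auto simp: g_def)
  have iter': "(g ^^ i) z = pair (pfst z) (pair (pfst (psnd z) - i) ((G (pfst z) ^^ i) (psnd (psnd z))))" for i z
    using iter[of i "pfst z" "pfst (psnd z)" "psnd (psnd z)"] by simp
  have "recursive (\<lambda>x. x - 1)" by (rule recursive_pred_id)
  then have pred: "recursive (\<lambda>z. pfst (psnd z) - 1)"
    by (rule recursive_comp) (intro recursive_intros)
  have "recursive f" unfolding f_def by (intro recursive_intros)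
  moreover have "recursive g" unfolding g_def
    by (intro recursive_intros pred recursive_lift2[OF G])
  moreover have "\<exists>i. f ((g ^^ i) z) = 0" for z
    by (rule exI[of _ "pfst (psnd z)"]) (simp add: iter' f_def)
  ultimately have "recursive (\<lambda>z. (g ^^ (LEAST i. f ((g ^^ i) z) = 0)) z)"
    by (rule recursive_while)
  moreover have "(LEAST i. f ((g ^^ i) z) = 0) = pfst (psnd z)" for z
    by (rule Least_equality) (auto simp: iter' f_def)
  ultimately have "recursive (\<lambda>z. (g ^^ (pfst (psnd z))) z)" by simp
  then have "recursive (\<lambda>x. (g ^^ (pfst (psnd (pair x (pair (n x) (a x)))))) (pair x (pair (n x) (a x))))"
    by (rule recursive_comp) (intro recursive_intros n a)
  then have "recursive (\<lambda>x. psnd (psnd ((g ^^ (pfst (psnd (pair x (pair (n x) (a x)))))) (pair x (pair (n x) (a x))))))"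
    by (intro recursive_intros)
  then show ?thesis by (simp add: iter)
qed

text \<open>Primitive recursion is iteration on pairs of the running index and the value so
  far.\<close>

lemma recursive_rec_nat [recursive_intros]:
  assumes g: "recursive g" and h: "recursive (\<lambda>z. h (pfst z) (pfst (psnd z)) (psnd (psnd z)))"
    and n: "recursive n"
  shows "recursive (\<lambda>x. rec_nat (g x) (\<lambda>y r. h x y r) (n x))"
proof -
  define G where "G x s = pair (Suc (pfst s)) (h x (pfst s) (psnd s))" for x s
  have "recursive (\<lambda>z. G (pfst z) (psnd z))"
    unfolding G_def by (intro recursive_intros recursive_lift3[OF h])
  then have "recursive (\<lambda>x. psnd ((G x ^^ n x) (pair 0 (g x))))"
    by (intro recursive_intros recursive_funpow n g)
  moreover have "(G x ^^ m) (pair 0 (g x)) = pair m (rec_nat (g x) (\<lambda>y r. h x y r) m)" for x m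
    by (induction m) (auto simp: G_def)
  ultimately show ?thesis by simp
qed

section \<open>Arithmetic, logic and search\<close>

lemma recursive_add [recursive_intros]:
  assumes "recursive f" "recursive g" shows "recursive (\<lambda>x. f x + g x)"
proof (rule recursive_lift2[OF _ assms])
  have "recursive (\<lambda>z. rec_nat (pfst z) (\<lambda>_ r. Suc r) (psnd z))" by (intro recursive_intros)
  moreover have "rec_nat a (\<lambda>_ r. Suc r) b = a + b" for a b by (induction b) auto
  ultimately show "recursive (\<lambda>z. pfst z + psnd z)" by simp
qed

lemma recursive_mult [recursive_intros]:
  assumes "recursive f" "recursive g" shows "recursive (\<lambda>x. f x * g x)"
proof (rule recursive_lift2[OF _ assms])
  have "recursive (\<lambda>z. rec_nat 0 (\<lambda>_ r. r + pfst z) (psnd z))" by (intro recursive_intros)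
  moreover have "rec_nat 0 (\<lambda>_ r. r + a) b = a * b" for a b by (induction b) auto
  ultimately show "recursive (\<lambda>z. pfst z * psnd z)" by simp
qed

lemma recursive_minus [recursive_intros]:
  assumes "recursive f" "recursive g" shows "recursive (\<lambda>x. f x - g x)"
proof (rule recursive_lift2[OF _ assms])
  have "recursive (\<lambda>z. rec_nat (pfst z) (\<lambda>_ r. r - 1) (psnd z))"
    by (intro recursive_intros recursive_comp[OF recursive_pred_id])
  moreover have "rec_nat a (\<lambda>_ r. r - 1) b = a - b" for a b by (induction b) auto
  ultimately show "recursive (\<lambda>z. pfst z - psnd z)" by simp
qed

lemma recursive_power [recursive_intros]:
  assumes "recursive f" "recursive g" shows "recursive (\<lambda>x. f x ^ g x)"
proof (rule recursive_lift2[OF _ assms])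
  have "recursive (\<lambda>z. rec_nat 1 (\<lambda>_ r. r * pfst z) (psnd z))" by (intro recursive_intros)
  moreover have "rec_nat 1 (\<lambda>_ r. r * a) b = a ^ b" for a b :: nat by (induction b) auto
  ultimately show "recursive (\<lambda>z. pfst z ^ psnd z)" by simp
qed

lemma recursive_of_bool [recursive_intros]: "decidable P \<Longrightarrow> recursive (\<lambda>x. of_bool (P x))"
  by (simp add: decidable_def)

lemma recursive_if [recursive_intros]:
  assumes "decidable P" "recursive f" "recursive g"
  shows "recursive (\<lambda>x. if P x then f x else g x)"
proof -
  have "recursive (\<lambda>x. of_bool (P x) * f x + (1 - of_bool (P x)) * g x)"
    by (intro recursive_intros assms)
  then show ?thesis by (rule back_subst[of recursive]) (auto simp: fun_eq_iff)
qed

lemma decidable_not [recursive_intros]: "decidable P \<Longrightarrow> decidable (\<lambda>x. \<not> P x)"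
proof -
  assume P: "decidable P"
  have "recursive (\<lambda>x. 1 - of_bool (P x))" by (intro recursive_intros P)
  then show ?thesis unfolding decidable_def
    by (rule back_subst[of recursive]) (auto simp: fun_eq_iff)
qed

lemma decidable_conj [recursive_intros]:
  assumes "decidable P" "decidable Q" shows "decidable (\<lambda>x. P x \<and> Q x)"
proof -
  have "recursive (\<lambda>x. of_bool (P x) * of_bool (Q x))" by (intro recursive_intros assms)
  then show ?thesis unfolding decidable_def
    by (rule back_subst[of recursive]) (auto simp: fun_eq_iff)
qed

lemma decidable_disj [recursive_intros]:
  assumes "decidable P" "decidable Q" shows "decidable (\<lambda>x. P x \<or> Q x)"
proof -
  have "decidable (\<lambda>x. \<not> (\<not> P x \<and> \<not> Q x))" by (intro recursive_intros assms)
  then show ?thesis by simp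
qed

lemma decidable_imp [recursive_intros]:
  assumes "decidable P" "decidable Q" shows "decidable (\<lambda>x. P x \<longrightarrow> Q x)"
proof -
  have "decidable (\<lambda>x. \<not> P x \<or> Q x)" by (intro recursive_intros assms)
  then show ?thesis by (rule back_subst[of decidable]) auto
qed

lemma decidable_iff [recursive_intros]:
  assumes "decidable P" "decidable Q" shows "decidable (\<lambda>x. P x \<longleftrightarrow> Q x)"
proof -
  have "decidable (\<lambda>x. (P x \<longrightarrow> Q x) \<and> (Q x \<longrightarrow> P x))" by (intro recursive_intros assms)
  then show ?thesis by (rule back_subst[of decidable]) auto
qed

lemma decidable_less [recursive_intros]:
  assumes "recursive f" "recursive g" shows "decidable (\<lambda>x. f x < g x)"
proof -
  have "recursive (\<lambda>x. 1 - (1 - (g x - f x)))" by (intro recursive_intros assms)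
  then show ?thesis unfolding decidable_def
    by (rule back_subst[of recursive]) (auto simp: fun_eq_iff)
qed

lemma decidable_le [recursive_intros]:
  assumes "recursive f" "recursive g" shows "decidable (\<lambda>x. f x \<le> g x)"
  using decidable_not[OF decidable_less[OF assms(2,1)]] by (simp add: not_less)

lemma decidable_eq [recursive_intros]:
  assumes "recursive f" "recursive g" shows "decidable (\<lambda>x. f x = g x)"
  using decidable_conj[OF decidable_le[OF assms] decidable_le[OF assms(2,1)]]
  by (rule back_subst[of decidable]) auto

lemma decidable_all_less [recursive_intros]:
  assumes "recursive b" "decidable (\<lambda>z. P (pfst z) (psnd z))"
  shows "decidable (\<lambda>x. \<forall>i<b x. P x i)"
proof -
  have "recursive (\<lambda>x. rec_nat 1 (\<lambda>i r. r * of_bool (P x i)) (b x))"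
    by (intro recursive_intros assms decidable_lift2[OF assms(2)])
  moreover have "rec_nat 1 (\<lambda>i r. r * of_bool (P x i)) n = (of_bool (\<forall>i<n. P x i) :: nat)" for x n
    by (induction n) (auto simp: less_Suc_eq)
  ultimately show ?thesis by (simp add: decidable_def)
qed

lemma decidable_ex_less [recursive_intros]:
  assumes "recursive b" "decidable (\<lambda>z. P (pfst z) (psnd z))"
  shows "decidable (\<lambda>x. \<exists>i<b x. P x i)"
proof -
  have "decidable (\<lambda>x. \<not> (\<forall>i<b x. \<not> P x i))" by (intro recursive_intros assms)
  then show ?thesis by simp
qed

lemma recursive_Least:
  assumes P: "decidable (\<lambda>z. P (pfst z) (psnd z))" and ex: "\<And>x. \<exists>y. P x y"
  shows "recursive (\<lambda>x. LEAST y. P x y)"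
proof -
  \<comment> \<open>The test asks for a witness up to the current number, not at it:
    \<open>recursive_while\<close> requires termination from every state, including those that start
    beyond all witnesses.\<close>
  define f :: "nat \<Rightarrow> nat" where "f z = of_bool (\<forall>y<Suc (psnd z). \<not> P (pfst z) y)" for z
  define g where "g z = pair (pfst z) (Suc (psnd z))" for z
  have iter: "(g ^^ i) z = pair (pfst z) (psnd z + i)" for i z
    by (induction i) (auto simp: g_def)
  have "recursive f" unfolding f_def by (intro recursive_intros decidable_lift2[OF P])
  moreover have "recursive g" unfolding g_def by (intro recursive_intros)
  moreover have "\<exists>i. f ((g ^^ i) z) = 0" for z
  proof -
    obtain y where "P (pfst z) y" using ex by blast
    moreover have "y < Suc (psnd z + y)" by simp
    ultimately have "\<exists>y'<Suc (psnd z + y). P (pfst z) y'" by blast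
    then have "f ((g ^^ y) z) = 0" by (auto simp: f_def iter)
    then show ?thesis by blast
  qed
  ultimately have "recursive (\<lambda>z. (g ^^ (LEAST i. f ((g ^^ i) z) = 0)) z)"
    by (rule recursive_while)
  then have "recursive (\<lambda>x. (g ^^ (LEAST i. f ((g ^^ i) (pair x 0)) = 0)) (pair x 0))"
    by (rule recursive_comp) (intro recursive_intros)
  then have "recursive (\<lambda>x. psnd ((g ^^ (LEAST i. f ((g ^^ i) (pair x 0)) = 0)) (pair x 0)))"
    by (rule recursive_psnd)
  moreover have "(LEAST i. f ((g ^^ i) (pair x 0)) = 0) = (LEAST y. P x y)" for x
  proof (rule Least_equality)
    show "f ((g ^^ (LEAST y. P x y)) (pair x 0)) = 0"
      using LeastI_ex[OF ex, of x] by (auto simp: iter f_def)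
    show "(LEAST y. P x y) \<le> i" if "f ((g ^^ i) (pair x 0)) = 0" for i
    proof -
      have "\<exists>y\<le>i. P x y" using that by (auto simp: iter f_def less_Suc_eq_le)
      then show ?thesis by (metis Least_le order_trans)
    qed
  qed
  ultimately show ?thesis by (simp add: iter)
qed

lemma recursive_div [recursive_intros]:
  assumes "recursive f" "recursive g" shows "recursive (\<lambda>x. f x div g x)"
proof (rule recursive_lift2[OF _ assms])
  \<comment> \<open>The first disjunct makes the search terminate for divisor 0 and yields 0 there,
    in agreement with \<open>div\<close>.\<close>
  have "recursive (\<lambda>z. LEAST q. psnd z = 0 \<or> pfst z < Suc q * psnd z)"
  proof (rule recursive_Least)
    show "\<exists>q. psnd z = 0 \<or> pfst z < Suc q * psnd z" for z
      by (metis dividend_less_times_div mult.commute mult_Suc_right neq0_conv)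
  qed (intro recursive_intros)
  moreover have "(LEAST q. b = 0 \<or> a < Suc q * b) = a div b" for a b
  proof (rule Least_equality)
    show "b = 0 \<or> a < Suc (a div b) * b" by (metis dividend_less_div_times add.commute mult_Suc neq0_conv)
    show "a div b \<le> q" if "b = 0 \<or> a < Suc q * b" for q
      using that by (metis Suc_eq_plus1 div_by_0 le0 less_Suc_eq_le less_mult_imp_div_less)
  qed
  ultimately show "recursive (\<lambda>z. pfst z div psnd z)" by simp
qed

lemma recursive_mod [recursive_intros]:
  assumes "recursive f" "recursive g" shows "recursive (\<lambda>x. f x mod g x)"
proof -
  have "recursive (\<lambda>x. f x - f x div g x * g x)" by (intro recursive_intros assms)
  then show ?thesis by (simp add: minus_div_mult_eq_mod)
qed

lemma decidable_bit [recursive_intros]: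
  assumes "recursive f" "recursive g" shows "decidable (\<lambda>x. bit (f x) (g x))"
proof -
  have "decidable (\<lambda>x. f x div 2 ^ g x mod 2 = 1)" by (intro recursive_intros assms)
  then show ?thesis by (simp add: bit_iff_odd odd_iff_mod_2_eq_one)
qed

text \<open>A finite table is a nest of conditionals, however its entries are defined. This is how
  the transition function of a given machine becomes recursive.\<close>

lemma recursive_finite_support:
  assumes "finite A" shows "recursive (\<lambda>z. if z \<in> A then f z else 0)"
  using assms
proof (induction A rule: finite_induct)
  case empty
  then show ?case by (simp add: recursive_const)
next
  case (insert a A)
  have "recursive (\<lambda>z. if z = a then f a else if z \<in> A then f z else 0)"
    by (intro recursive_intros insert.IH)
  then show ?case by (rule back_subst[of recursive]) auto
qed

section \<open>Simulating Turing machines by recursive functions\<close>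

text \<open>A number is read as the stack with top \<open>pfst\<close> and remainder \<open>psnd\<close>. Since \<open>0\<close> decodes to
  the pair \<open>(0, 0)\<close>, every stack ends in infinitely many blanks.\<close>

definition cell :: "nat \<Rightarrow> nat \<Rightarrow> nat" where
  "cell L i = pfst ((psnd ^^ i) L)"

text \<open>The recursion pushes the entries from the last to the first, so that entry 0 ends on
  top; below the \<open>n\<close> entries only blanks follow.\<close>

definition tab :: "(nat \<Rightarrow> nat) \<Rightarrow> nat \<Rightarrow> nat" where
  "tab f n = rec_nat 0 (\<lambda>i r. pair (f (n - Suc i)) r) n"

lemma cell_0 [simp]: "cell L 0 = pfst L"
  by (simp add: cell_def)

lemma cell_pair_Suc [simp]: "cell (pair a L) (Suc i) = cell L i"
  by (simp add: cell_def funpow_Suc_right del: funpow.simps)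

lemma cell_psnd: "cell (psnd L) i = cell L (Suc i)"
  by (simp add: cell_def funpow_Suc_right del: funpow.simps)

lemma pair_00: "pair 0 0 = 0"
  by (simp add: pair_def prod_encode_def)

lemma pfst_0 [simp]: "pfst 0 = 0" and psnd_0 [simp]: "psnd 0 = 0"
  by (simp_all add: pfst_def psnd_def prod_decode_0)

lemma cell_zero [simp]: "cell 0 i = 0"
proof -
  have "(psnd ^^ i) 0 = 0" by (induction i) auto
  then show ?thesis by (simp add: cell_def)
qed

lemma cell_tab: "cell (tab f n) i = (if i < n then f i else 0)"
proof -
  have "cell (rec_nat 0 (\<lambda>i r. pair (f (n - Suc i)) r) m) i = (if i < m then f (n - m + i) else 0)"
    if "m \<le> n" for m i
    using that
  proof (induction m arbitrary: i)
    case (Suc m)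
    have "n - m = Suc (n - Suc m)" using Suc.prems by simp
    with Suc show ?case by (cases i) auto
  qed simp
  from this[of n i] show ?thesis by (simp add: tab_def)
qed

lemma tab_cong:
  assumes "\<And>i. i < n \<Longrightarrow> f i = g i" shows "tab f n = tab g n"
proof -
  have "rec_nat 0 (\<lambda>i r. pair (f (n - Suc i)) r) m = rec_nat 0 (\<lambda>i r. pair (g (n - Suc i)) r) m"
    if "m \<le> n" for m
    using that by (induction m) (auto simp: assms)
  then show ?thesis by (simp add: tab_def)
qed

lemma recursive_cell [recursive_intros]:
  assumes "recursive f" "recursive g" shows "recursive (\<lambda>x. cell (f x) (g x))"
  unfolding cell_def
  by (intro recursive_intros recursive_funpow[of "\<lambda>_. psnd"] assms)

lemma recursive_tab [recursive_intros]:
  assumes "recursive (\<lambda>z. f (pfst z) (psnd z))" "recursive n"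
  shows "recursive (\<lambda>x. tab (f x) (n x))"
  unfolding tab_def by (intro recursive_intros assms recursive_lift2[OF assms(1)] recursive_comp[OF assms(2)])

lemma nat_of_word_bounds:
  "2 ^ length w \<le> Suc (nat_of_word w)" "Suc (nat_of_word w) < 2 ^ Suc (length w)"
  by (induction w) auto

text \<open>\<open>Suc (nat_of_word w)\<close> is the ordinary binary number with the letters of
  \<open>w\<close> as digits, lowest first, and one further leading 1 at position
  \<open>length w\<close>. This also explains the bounds above.\<close>

lemma bit_nat_of_word: "i < length w \<Longrightarrow> bit (Suc (nat_of_word w)) i \<longleftrightarrow> w ! i"
proof (induction w arbitrary: i)
  case (Cons b w)
  have "Suc (nat_of_word (b # w)) = 2 * Suc (nat_of_word w) + of_bool b" by simp
  then have *: "Suc (nat_of_word (b # w)) div 2 = Suc (nat_of_word w)"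
    "odd (Suc (nat_of_word (b # w))) \<longleftrightarrow> b" by auto
  show ?case
  proof (cases i)
    case 0
    then show ?thesis using * by (simp add: bit_0)
  next
    case (Suc j)
    then show ?thesis using * Cons by (simp add: bit_Suc del: nat_of_word.simps)
  qed
qed simp

lemma nat_of_word_eq_iff: "nat_of_word v = nat_of_word w \<longleftrightarrow> v = w"
proof
  assume eq: "nat_of_word v = nat_of_word w"
  have len: "length v = length w"
  proof (rule ccontr)
    assume "length v \<noteq> length w"
    then have "Suc (length v) \<le> length w \<or> Suc (length w) \<le> length v" by linarith
    then have "(2 :: nat) ^ Suc (length v) \<le> 2 ^ length w \<or> (2 :: nat) ^ Suc (length w) \<le> 2 ^ length v"
      by (metis one_le_numeral power_increasing)
    with nat_of_word_bounds[of v] nat_of_word_bounds[of w] eq show False by linarith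
  qed
  then show "v = w" using bit_nat_of_word[of _ v] bit_nat_of_word[of _ w] eq
    by (intro nth_equalityI) auto
qed simp

lemma nat_of_word_surj: "\<exists>w. nat_of_word w = n"
proof (induction n rule: less_induct)
  case (less n)
  show ?case
  proof (cases n)
    case 0
    then show ?thesis by (metis nat_of_word.simps(1))
  next
    case (Suc m)
    then have "m div 2 < n" by simp
    then obtain w where "nat_of_word w = m div 2" using less by blast
    then have "nat_of_word (odd m # w) = n" using Suc by auto
    then show ?thesis by blast
  qed
qed

definition word_of_nat :: "nat \<Rightarrow> bool list" where
  "word_of_nat n = (THE w. nat_of_word w = n)"

lemma word_of_nat_of_word [simp]: "word_of_nat (nat_of_word w) = w"
  unfolding word_of_nat_def by (rule the_equality) (auto simp: nat_of_word_eq_iff)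

lemma nat_of_word_of_nat [simp]: "nat_of_word (word_of_nat n) = n"
  by (metis nat_of_word_surj word_of_nat_of_word)

lemma nth_word_of_nat: "i < length (word_of_nat n) \<Longrightarrow> word_of_nat n ! i \<longleftrightarrow> bit (Suc n) i"
  using bit_nat_of_word[of i "word_of_nat n"] by simp

lemma recursive_length_word [recursive_intros]:
  assumes "recursive f" shows "recursive (\<lambda>x. length (word_of_nat (f x)))"
proof (rule recursive_comp[OF _ assms])
  have "recursive (\<lambda>n. LEAST l. Suc n < 2 ^ Suc l)"
    by (rule recursive_Least, intro recursive_intros)
      (metis nat_of_word_bounds(2) nat_of_word_of_nat)
  moreover have "(LEAST l. Suc n < 2 ^ Suc l) = length (word_of_nat n)" for n
  proof (rule Least_equality)
    show "Suc n < 2 ^ Suc (length (word_of_nat n))"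
      using nat_of_word_bounds(2)[of "word_of_nat n"] by simp
    show "length (word_of_nat n) \<le> l" if "Suc n < 2 ^ Suc l" for l
    proof (rule ccontr)
      assume "\<not> length (word_of_nat n) \<le> l"
      then have "(2 :: nat) ^ Suc l \<le> 2 ^ length (word_of_nat n)" by (intro power_increasing) auto
      with that nat_of_word_bounds(1)[of "word_of_nat n"] show False by simp
    qed
  qed
  ultimately show "recursive (\<lambda>n. length (word_of_nat n))" by simp
qed

text \<open>A tape is coded by its head position, as a difference, and the two stacks of cells left of
  the head and from the head on.\<close>

definition tape_rep :: "nat \<Rightarrow> tape \<Rightarrow> bool" where
  "tape_rep z tp \<longleftrightarrow> fst tp = int (pfst (pfst z)) - int (psnd (pfst z)) \<and>
     (\<forall>i. cell (pfst (psnd z)) i = snd tp (fst tp - 1 - int i)) \<and>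
     (\<forall>i. cell (psnd (psnd z)) i = snd tp (fst tp + int i))"

text \<open>The comparison of \<open>i\<close> with the head position is written additively, since
  the head may stand at a negative cell.\<close>

definition tape_cell :: "nat \<Rightarrow> nat \<Rightarrow> nat" where
  "tape_cell z i =
     (if i + psnd (pfst z) < pfst (pfst z)
      then cell (pfst (psnd z)) (pfst (pfst z) - Suc (i + psnd (pfst z)))
      else cell (psnd (psnd z)) (i + psnd (pfst z) - pfst (pfst z)))"

lemma tape_cell: "tape_rep z tp \<Longrightarrow> tape_cell z i = snd tp (int i)"
  by (auto simp: tape_rep_def tape_cell_def of_nat_diff intro!: arg_cong[of _ _ "snd tp"])

lemma tape_rep_scan: "tape_rep z tp \<Longrightarrow> pfst (psnd (psnd z)) = scan tp"
  by (metis tape_rep_def scan_def cell_0 add_0_right of_nat_0)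

lemma recursive_tape_cell [recursive_intros]:
  assumes "recursive f" "recursive g" shows "recursive (\<lambda>x. tape_cell (f x) (g x))"
  unfolding tape_cell_def by (intro recursive_intros assms)

fun move_code :: "move \<Rightarrow> nat" where
  "move_code Stay = 0" | "move_code Lft = 1" | "move_code Rgt = 2"

text \<open>Moving the head carries one symbol from one stack to the other. The position is a
  difference, so a left move increments the subtrahend and nothing is ever decremented.\<close>

definition act_code :: "nat \<Rightarrow> nat \<Rightarrow> nat" where
  "act_code z a =
     (if psnd a = 0 then
        pair (pfst z) (pair (pfst (psnd z)) (pair (pfst a) (psnd (psnd (psnd z)))))
      else if psnd a = 1 then
        pair (pair (pfst (pfst z)) (Suc (psnd (pfst z))))
          (pair (psnd (pfst (psnd z)))
            (pair (pfst (pfst (psnd z))) (pair (pfst a) (psnd (psnd (psnd z))))))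
      else
        pair (pair (Suc (pfst (pfst z))) (psnd (pfst z)))
          (pair (pair (pfst a) (pfst (psnd z))) (psnd (psnd (psnd z)))))"

lemma tape_rep_act:
  assumes "tape_rep z tp"
  shows "tape_rep (act_code z (pair s (move_code m))) (act tp (s, m))"
proof -
  obtain h c where tp: "tp = (h, c)" by force
  define L R where "L = pfst (psnd z)" and "R = psnd (psnd z)"
  have h: "h = int (pfst (pfst z)) - int (psnd (pfst z))"
    and L: "\<And>i. cell L i = c (h - 1 - int i)" and R: "\<And>i. cell R i = c (h + int i)"
    using assms by (auto simp: tape_rep_def tp L_def R_def)
  have R': "cell (pair s (psnd R)) i = (c(h := s)) (h + int i)" for i
    using R[of i] by (cases i) (auto simp: cell_psnd)
  have L0: "pfst L = c (h - 1)" using L[of 0] by simp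
  show ?thesis
  proof (cases m)
    case Stay
    then show ?thesis using L R' h
      by (auto simp: tape_rep_def act_code_def act_def tp L_def[symmetric] R_def[symmetric])
  next
    case Lft
    have "cell (pair (pfst L) (pair s (psnd R))) i = (c(h := s)) (h - 1 + int i)" for i
      using R' L0 by (cases i) auto
    moreover have "cell (psnd L) i = (c(h := s)) (h - 1 - 1 - int i)" for i
      using L[of "Suc i"] by (auto simp: cell_psnd algebra_simps)
    ultimately show ?thesis using h Lft
      by (auto simp: tape_rep_def act_code_def act_def tp L_def[symmetric] R_def[symmetric])
  next
    case Rgt
    have "cell (psnd R) i = (c(h := s)) (h + 1 + int i)" for i
      using R[of "Suc i"] by (auto simp: cell_psnd algebra_simps)
    moreover have "cell (pair s L) i = (c(h := s)) (h + 1 - 1 - int i)" for i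
    proof (cases i)
      case (Suc j)
      then show ?thesis using L[of j] by (auto simp: algebra_simps)
    qed simp
    ultimately show ?thesis using h Rgt
      by (auto simp: tape_rep_def act_code_def act_def tp L_def[symmetric] R_def[symmetric])
  qed
qed

lemma recursive_act_code [recursive_intros]:
  assumes "recursive f" "recursive g" shows "recursive (\<lambda>x. act_code (f x) (g x))"
  unfolding act_code_def by (intro recursive_intros assms)

text \<open>This invariant guarantees that the lookup in the finite table \<open>trans_code\<close>
  never misses.\<close>

definition wf_configuration :: "machine \<Rightarrow> configuration \<Rightarrow> bool" where
  "wf_configuration M cfg \<longleftrightarrow> fst cfg < n_states M \<and> length (snd cfg) = n_tapes M \<and>
     (\<forall>tp\<in>set (snd cfg). \<forall>j. snd tp j < n_symbols M)"

lemma wf_scan: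
  assumes "wf_configuration M cfg" shows "set (map scan (snd cfg)) \<subseteq> {..<n_symbols M}"
  using assms by (auto simp: wf_configuration_def scan_def)

lemma wf_step:
  assumes "turing_machine M" "wf_configuration M cfg"
  shows "wf_configuration M (step M cfg)"
proof (cases "halted cfg")
  case False
  obtain q acts where qa: "trans_fun M (fst cfg) (map scan (snd cfg)) = (q, acts)" by force
  have "fst cfg < n_states M \<and> length (map scan (snd cfg)) = n_tapes M \<and>
     set (map scan (snd cfg)) \<subseteq> {..<n_symbols M}"
    using wf_scan[OF assms(2)] assms(2) by (auto simp: wf_configuration_def)
  then have *: "q < n_states M" "length acts = n_tapes M" "fst ` set acts \<subseteq> {..<n_symbols M}"
    using assms(1) qa unfolding turing_machine_def by (metis fst_conv snd_conv)+
  have "snd tp j < n_symbols M" if "tp \<in> set (map2 act (snd cfg) acts)" for tp j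
  proof -
    from that obtain z where z: "z \<in> set (zip (snd cfg) acts)" and tp: "tp = act (fst z) (snd z)"
      by auto
    then have "fst z \<in> set (snd cfg)" "snd z \<in> set acts"
      by (metis prod.collapse set_zip_leftD set_zip_rightD)+
    then show ?thesis using * assms(2) by (auto simp: tp act_def wf_configuration_def image_subset_iff)
  qed
  then show ?thesis using False * assms(2)
    by (auto simp: step_def qa wf_configuration_def)
qed (use assms in \<open>simp add: step_def\<close>)

lemma wf_initial:
  assumes "turing_machine M" shows "wf_configuration M (initial M p)"
  using assms
  by (auto simp: wf_configuration_def initial_def turing_machine_def input_tape_def
      blank_tape_def bit_symbol_def)

lemma wf_run:
  assumes "turing_machine M" shows "wf_configuration M ((step M ^^ t) (initial M p))"
  by (induction t) (use assms in \<open>auto simp: wf_initial wf_step\<close>)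

section \<open>Machine configurations as numbers\<close>

definition config_rep :: "nat \<Rightarrow> configuration \<Rightarrow> bool" where
  "config_rep c cfg \<longleftrightarrow> pfst c = fst cfg \<and>
     (\<forall>i<length (snd cfg). tape_rep (cell (psnd c) i) (snd cfg ! i))"

text \<open>\<open>trans_fun\<close> is an arbitrary HOL function; restricted to the finitely many
  legal arguments, and 0 elsewhere, it is recursive.\<close>

definition trans_code :: "machine \<Rightarrow> nat \<Rightarrow> nat" where
  "trans_code M z =
     (if z \<in> (\<lambda>(q, ss). pair q (tab ((!) ss) (n_tapes M))) `
         ({..<n_states M} \<times> {ss. set ss \<subseteq> {..<n_symbols M} \<and> length ss = n_tapes M})
      then case trans_fun M (pfst z) (map (cell (psnd z)) [0..<n_tapes M]) of
        (q, acts) \<Rightarrow> pair q (tab (\<lambda>i. pair (fst (acts ! i)) (move_code (snd (acts ! i)))) (n_tapes M))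
      else 0)"

lemma recursive_trans_code: "recursive (trans_code M)"
  unfolding trans_code_def
  by (intro recursive_finite_support finite_imageI finite_cartesian_product finite_lists_length_eq) auto

lemma trans_code_eq:
  assumes "q < n_states M" "set ss \<subseteq> {..<n_symbols M}" "length ss = n_tapes M"
    "trans_fun M q ss = (q', acts)"
  shows "trans_code M (pair q (tab ((!) ss) (n_tapes M))) =
     pair q' (tab (\<lambda>i. pair (fst (acts ! i)) (move_code (snd (acts ! i)))) (n_tapes M))"
proof -
  have "map (cell (tab ((!) ss) (n_tapes M))) [0..<n_tapes M] = ss"
    using assms(3) by (intro nth_equalityI) (auto simp: cell_tab)
  moreover have "pair q (tab ((!) ss) (n_tapes M)) \<in> (\<lambda>(q, ss). pair q (tab ((!) ss) (n_tapes M))) `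
         ({..<n_states M} \<times> {ss. set ss \<subseteq> {..<n_symbols M} \<and> length ss = n_tapes M})"
    by (rule image_eqI[of _ _ "(q, ss)"]) (use assms in auto)
  ultimately show ?thesis using assms(4) by (simp add: trans_code_def)
qed

definition step_code :: "machine \<Rightarrow> nat \<Rightarrow> nat" where
  "step_code M c =
     (if pfst c = 1 then c
      else (\<lambda>d. pair (pfst d) (tab (\<lambda>i. act_code (cell (psnd c) i) (cell (psnd d) i)) (n_tapes M)))
        (trans_code M (pair (pfst c) (tab (\<lambda>i. pfst (psnd (psnd (cell (psnd c) i)))) (n_tapes M)))))"

lemma recursive_step_code [recursive_intros]:
  assumes "recursive f" shows "recursive (\<lambda>x. step_code M (f x))"
proof (rule recursive_comp[OF _ assms])
  show "recursive (step_code M)"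
    unfolding step_code_def
    by (intro recursive_intros recursive_comp[OF recursive_trans_code])
qed

lemma config_rep_step:
  assumes "turing_machine M" "wf_configuration M cfg" "config_rep c cfg"
  shows "config_rep (step_code M c) (step M cfg)"
proof (cases "halted cfg")
  case True
  then show ?thesis using assms by (simp add: step_code_def step_def halted_def config_rep_def)
next
  case False
  let ?ss = "map scan (snd cfg)"
  obtain q acts where qa: "trans_fun M (fst cfg) ?ss = (q, acts)" by force
  have wf: "fst cfg < n_states M" "length ?ss = n_tapes M" "set ?ss \<subseteq> {..<n_symbols M}"
    using wf_scan[OF assms(2)] assms(2) by (auto simp: wf_configuration_def)
  then have acts: "length acts = n_tapes M"
    using assms(1) qa unfolding turing_machine_def by (metis snd_conv)
  have "tab (\<lambda>i. pfst (psnd (psnd (cell (psnd c) i)))) (n_tapes M) = tab ((!) ?ss) (n_tapes M)"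
    using wf assms(3) by (intro tab_cong) (simp add: config_rep_def tape_rep_scan)
  moreover have "pfst c = fst cfg" using assms(3) by (simp add: config_rep_def)
  ultimately have sc: "step_code M c = pair q (tab (\<lambda>i. act_code (cell (psnd c) i)
     (cell (tab (\<lambda>i. pair (fst (acts ! i)) (move_code (snd (acts ! i)))) (n_tapes M)) i)) (n_tapes M))"
    using False trans_code_eq[OF wf(1,3,2) qa] by (simp add: step_code_def halted_def)
  have "tape_rep (act_code (cell (psnd c) i) (pair (fst (acts ! i)) (move_code (snd (acts ! i)))))
     (act (snd cfg ! i) (acts ! i))" if "i < n_tapes M" for i
    using tape_rep_act[of "cell (psnd c) i" "snd cfg ! i" "fst (acts ! i)" "snd (acts ! i)"]
      that assms(3) wf by (simp add: config_rep_def)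
  then show ?thesis using False acts wf
    by (auto simp: config_rep_def sc step_def qa cell_tab)
qed

text \<open>\<open>R\<close> is the stack of input symbols from cell 0 on. The other tapes are coded
  by 0, which decodes to a blank tape with its head on cell 0.\<close>

definition run_code :: "machine \<Rightarrow> nat \<Rightarrow> nat \<Rightarrow> nat" where
  "run_code M R t = (step_code M ^^ t) (pair 0 (tab (\<lambda>i. if i = 0 then pair 0 (pair 0 R) else 0) (n_tapes M)))"

lemma recursive_run_code [recursive_intros]:
  assumes "recursive f" "recursive g" shows "recursive (\<lambda>x. run_code M (f x) (g x))"
  unfolding run_code_def
  by (intro recursive_intros recursive_funpow[of "\<lambda>_. step_code M"] assms recursive_comp[OF assms(1)])

lemma config_rep_run:
  assumes M: "turing_machine M" and R: "\<And>i. cell R i = (if i < length p then bit_symbol (p ! i) else 0)"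
  shows "config_rep (run_code M R t) ((step M ^^ t) (initial M p))"
proof -
  let ?c = "pair 0 (tab (\<lambda>i. if i = 0 then pair 0 (pair 0 R) else 0) (n_tapes M))"
  have "2 \<le> n_tapes M" using M by (simp add: turing_machine_def)
  moreover have "tape_rep (pair 0 (pair 0 R)) (input_tape p)"
    using R by (simp add: tape_rep_def input_tape_def)
  moreover have "tape_rep 0 blank_tape" by (simp add: tape_rep_def blank_tape_def)
  ultimately have "config_rep ?c (initial M p)"
    by (auto simp: config_rep_def initial_def cell_tab nth_Cons' pair_00)
  then have "config_rep ((step_code M ^^ t) ?c) ((step M ^^ t) (initial M p))"
    by (induction t) (auto simp: config_rep_step[OF M wf_run[OF M]])
  then show ?thesis by (simp add: run_code_def)
qed

lemma halted_mono:
  assumes "halted ((step M ^^ s) c)" "s \<le> t" shows "(step M ^^ t) c = (step M ^^ s) c"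
  using assms(2,1) by (induction t rule: dec_induct) (auto simp: step_def)

text \<open>Halted configurations no longer change, so it suffices to look at time \<open>t\<close>
  itself.\<close>

lemma outputs_within_iff:
  "outputs_within M t p x \<longleftrightarrow>
     halted ((step M ^^ t) (initial M p)) \<and> output_word ((step M ^^ t) (initial M p)) x"
  unfolding outputs_within_def by (metis halted_mono order_refl)

lemma decidable_outputs_within [recursive_intros]:
  assumes M: "turing_machine M" and t: "recursive t" and p: "recursive p" and v: "recursive v"
  shows "decidable (\<lambda>x. outputs_within M (t x) (word_of_nat (p x)) (word_of_nat (v x)))"
proof -
  \<comment> \<open>The letters of \<open>word_of_nat n\<close> are the low bits of
    \<open>Suc n\<close>; here they become tape symbols.\<close>
  define R where "R n = tab (\<lambda>i. if bit (Suc n) i then 2 else 1) (length (word_of_nat n))" for n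
  define c where "c x = run_code M (R (p x)) (t x)" for x
  define out where "out x = tape_cell (cell (psnd (c x)) 1)" for x
  have R: "recursive R" unfolding R_def by (intro recursive_intros)
  have c: "recursive c" unfolding c_def by (intro recursive_intros t recursive_comp[OF R] p)
  have "decidable (\<lambda>x. pfst (c x) = 1 \<and>
      (\<forall>i<length (word_of_nat (v x)). out x i = (if bit (Suc (v x)) i then 2 else 1)) \<and>
      \<not> (out x (length (word_of_nat (v x))) = 1 \<or> out x (length (word_of_nat (v x))) = 2))"
    unfolding out_def by (intro recursive_intros recursive_comp[OF c] recursive_comp[OF v])
  moreover have "outputs_within M (t x) (word_of_nat (p x)) (word_of_nat (v x)) \<longleftrightarrow> pfst (c x) = 1 \<and>
      (\<forall>i<length (word_of_nat (v x)). out x i = (if bit (Suc (v x)) i then 2 else 1)) \<and>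
      \<not> (out x (length (word_of_nat (v x))) = 1 \<or> out x (length (word_of_nat (v x))) = 2)" for x
  proof -
    let ?cfg = "(step M ^^ t x) (initial M (word_of_nat (p x)))"
    have rep: "config_rep (c x) ?cfg"
      unfolding c_def by (rule config_rep_run[OF M])
        (auto simp: R_def cell_tab nth_word_of_nat bit_symbol_def)
    have "1 < length (snd ?cfg)"
      using M wf_run[OF M] by (simp add: wf_configuration_def turing_machine_def)
    with rep have "tape_rep (cell (psnd (c x)) 1) (snd ?cfg ! 1)" by (simp add: config_rep_def)
    then have out: "snd (snd ?cfg ! 1) (int i) = out x i" for i
      by (simp add: out_def tape_cell)
    have rng: "range bit_symbol = {1, 2}" by (auto simp: bit_symbol_def image_iff)
    have sym: "bit_symbol (word_of_nat n ! i) = (if bit (Suc n) i then 2 else 1)"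
      if "i < length (word_of_nat n)" for n i
      using that by (simp add: bit_symbol_def nth_word_of_nat)
    have q: "fst ?cfg = pfst (c x)" using rep by (simp add: config_rep_def)
    show ?thesis
      unfolding outputs_within_iff halted_def output_word_def out rng q by (simp add: sym del: One_nat_def)
  qed
  ultimately show ?thesis by simp
qed

text \<open>The machine is simulated up to its least halting time, found by search. The output is
  unary, so the value is the index of the first output cell that does not hold the symbol 2.\<close>

lemma computable_fun_recursive:
  assumes "computable_fun T" shows "recursive T"
proof -
  obtain M where M: "turing_machine M" and out: "\<And>n. outputs M (nat_code n) (nat_code (T n))"
    using assms by (auto simp: computable_fun_def)
  \<comment> \<open>The unary input: \<open>n\<close> symbols 2 and the terminating bit, symbol
    1.\<close>
  define R where "R n = tab (\<lambda>i. if i < n then 2 else 1) (Suc n)" for n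
  have R: "recursive R" unfolding R_def by (intro recursive_intros)
  let ?cfg = "\<lambda>n t. (step M ^^ t) (initial M (nat_code n))"
  have rep: "config_rep (run_code M (R n) t) (?cfg n t)" for n t
    by (rule config_rep_run[OF M]) (auto simp: R_def cell_tab nat_code_def nth_append bit_symbol_def less_Suc_eq)
  define h where "h n = (LEAST t. pfst (run_code M (R n) t) = 1)" for n
  have halt: "\<exists>t. pfst (run_code M (R n) t) = 1" for n
    using out[of n] rep[of n] by (auto simp: outputs_def outputs_within_def config_rep_def halted_def)
  have "recursive h" unfolding h_def
    by (rule recursive_Least) (intro recursive_intros recursive_comp[OF R] halt)+
  define o1 where "o1 n = tape_cell (cell (psnd (run_code M (R n) (h n))) 1)" for n
  have o1: "o1 n j = (if j < T n then 2 else 1)" if "j \<le> T n" for n j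
  proof -
    have "pfst (run_code M (R n) (h n)) = 1" unfolding h_def using halt by (rule LeastI_ex)
    then have hh: "halted (?cfg n (h n))" using rep[of n "h n"] by (simp add: config_rep_def halted_def)
    obtain s where s: "halted (?cfg n s)" "output_word (?cfg n s) (nat_code (T n))"
      using out[of n] by (auto simp: outputs_def outputs_within_def)
    \<comment> \<open>The output is only known at some halting time \<open>s\<close>; the
      configuration is the same at all halting times.\<close>
    have "?cfg n s = ?cfg n (h n)"
      using halted_mono[OF hh, of s] halted_mono[OF s(1), of "h n"] by (cases "h n \<le> s") auto
    then have ow: "output_word (?cfg n (h n)) (nat_code (T n))" using s by simp
    have "1 < length (snd (?cfg n (h n)))" using M wf_run[OF M] by (simp add: wf_configuration_def turing_machine_def)
    with rep have "tape_rep (cell (psnd (run_code M (R n) (h n))) 1) (snd (?cfg n (h n)) ! 1)"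
      by (simp add: config_rep_def)
    then have "o1 n j = snd (snd (?cfg n (h n)) ! 1) (int j)" by (simp add: o1_def tape_cell)
    also have "\<dots> = bit_symbol (nat_code (T n) ! j)"
      using ow that by (simp add: output_word_def nat_code_def)
    finally show ?thesis using that by (auto simp: nat_code_def nth_append bit_symbol_def)
  qed
  have "recursive (\<lambda>n. LEAST j. o1 n j \<noteq> 2)"
  proof (rule recursive_Least)
    show "decidable (\<lambda>z. o1 (pfst z) (psnd z) \<noteq> 2)" unfolding o1_def
      by (intro recursive_intros recursive_comp[OF R] recursive_comp[OF \<open>recursive h\<close>])
    show "\<exists>j. o1 n j \<noteq> 2" for n using o1[of "T n" n] by (intro exI[of _ "T n"]) simp
  qed
  moreover have "(LEAST j. o1 n j \<noteq> 2) = T n" for n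
  proof (rule Least_equality)
    show "o1 n (T n) \<noteq> 2" using o1[of "T n" n] by simp
    show "T n \<le> j" if "o1 n j \<noteq> 2" for j
      using o1[of j n] that by (metis nle_le not_less)
  qed
  ultimately show ?thesis by simp
qed

section \<open>Blocks with incompressible windows\<close>

lemma nat_code_Suc: "nat_code (Suc n) = True # nat_code n"
  by (simp add: nat_code_def)

text \<open>\<open>nat_code\<close> is a prefix code: the first \<open>False\<close> ends
  it.\<close>

lemma nat_code_append_inject:
  "nat_code a @ u = nat_code b @ v \<longleftrightarrow> a = b \<and> u = v"
proof (induction a arbitrary: b)
  case 0
  then show ?case by (cases b) (auto simp: nat_code_def)
next
  case (Suc a)
  then show ?case by (cases b) (auto simp: nat_code_Suc nat_code_def[of 0])
qed

lemma concat_nat_code_inject: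
  assumes "length xs = length ys"
  shows "concat (map nat_code xs) = concat (map nat_code ys) \<longleftrightarrow> xs = ys"
  using assms by (induction xs ys rule: list_induct2) (auto simp: nat_code_append_inject)

text \<open>The form that \<open>pattern_code\<close> takes on full binary squares:
  \<open>t mod n\<close> is the column and \<open>t div n\<close> the row of the t-th cell. The
  \<open>Suc\<close> stems from \<open>cell_code\<close>, where 0 stands for an undefined
  cell.\<close>

definition square_code :: "nat \<Rightarrow> (nat \<Rightarrow> nat \<Rightarrow> bool) \<Rightarrow> bool list" where
  "square_code n c = nat_code n @ nat_code n @
     concat (map (\<lambda>t. nat_code (Suc (of_bool (c (t mod n) (t div n))))) [0..<n * n])"

lemma index_less:
  assumes "(i :: nat) < n" "j < m" shows "j * n + i < m * n"
proof -
  have "j * n + i < Suc j * n" using assms by simp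
  also have "\<dots> \<le> m * n" using assms by (intro mult_le_mono1) simp
  finally show ?thesis .
qed

lemma square_code_eq_iff:
  "square_code n c = square_code n' c' \<longleftrightarrow> n = n' \<and> (\<forall>i<n. \<forall>j<n. c i j = c' i j)"
proof -
  have "(\<forall>t<n * n. c (t mod n) (t div n) = c' (t mod n) (t div n)) \<longleftrightarrow>
      (\<forall>i<n. \<forall>j<n. c i j = c' i j)" (is "?l \<longleftrightarrow> ?r")
  proof
    assume l: ?l
    show ?r
    proof (intro allI impI)
      fix i j assume "i < n" "j < n"
      then have "j * n + i < n * n" by (intro index_less)
      with l have "c ((j * n + i) mod n) ((j * n + i) div n) = c' ((j * n + i) mod n) ((j * n + i) div n)"
        by blast
      then show "c i j = c' i j" using \<open>i < n\<close> by simp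
    qed
  next
    assume ?r
    then show ?l by (metis less_mult_imp_div_less mod_less_divisor mult_0 neq0_conv not_less_zero)
  qed
  moreover have "square_code n c = square_code n c' \<longleftrightarrow>
      (\<forall>t<n * n. c (t mod n) (t div n) = c' (t mod n) (t div n))"
  proof -
    have "concat (map nat_code (map (\<lambda>t. Suc (of_bool (c (t mod n) (t div n)))) [0..<n * n])) =
        concat (map nat_code (map (\<lambda>t. Suc (of_bool (c' (t mod n) (t div n)))) [0..<n * n])) \<longleftrightarrow>
        map (\<lambda>t. Suc (of_bool (c (t mod n) (t div n)))) [0..<n * n] =
        map (\<lambda>t. Suc (of_bool (c' (t mod n) (t div n)))) [0..<n * n]"
      by (rule concat_nat_code_inject) simp
    also have "\<dots> \<longleftrightarrow> (\<forall>t<n * n. c (t mod n) (t div n) = c' (t mod n) (t div n))"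
      by auto
    finally show ?thesis by (simp add: square_code_def comp_def)
  qed
  moreover have "n = n'" if "square_code n c = square_code n' c'"
    using that by (simp add: square_code_def nat_code_append_inject)
  ultimately show ?thesis by blast
qed

lemma recursive_nat_code_append [recursive_intros]:
  assumes "recursive a" "recursive u"
  shows "recursive (\<lambda>x. nat_of_word (nat_code (a x) @ word_of_nat (u x)))"
proof -
  \<comment> \<open>Prepending \<open>False\<close> maps a word number r to 2r + 1, prepending
    \<open>True\<close> maps it to 2r + 2.\<close>
  have "recursive (\<lambda>x. rec_nat (2 * u x + 1) (\<lambda>_ r. 2 * r + 2) (a x))"
    by (intro recursive_intros assms)
  moreover have "rec_nat (2 * v + 1) (\<lambda>_ r. 2 * r + 2) n = nat_of_word (nat_code n @ word_of_nat v)" for v n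
    by (induction n) (auto simp: nat_code_def)
  ultimately show ?thesis by simp
qed

lemma recursive_concat_nat_code:
  assumes a: "recursive (\<lambda>z. a (pfst z) (psnd z))" and n: "recursive n"
  shows "recursive (\<lambda>x. nat_of_word (concat (map (\<lambda>t. nat_code (a x t)) [0..<n x])))"
proof -
  have "recursive (\<lambda>x. rec_nat 0 (\<lambda>i r. nat_of_word (nat_code (a x (n x - Suc i)) @ word_of_nat r)) (n x))"
    by (intro recursive_intros recursive_lift2[OF a] n recursive_comp[OF n])
  moreover have "rec_nat 0 (\<lambda>i r. nat_of_word (nat_code (f (l - Suc i)) @ word_of_nat r)) l =
     nat_of_word (concat (map (\<lambda>t. nat_code (f t)) [0..<l]))" for f l
  proof -
    have "rec_nat 0 (\<lambda>i r. nat_of_word (nat_code (f (l - Suc i)) @ word_of_nat r)) m =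
       nat_of_word (concat (map (\<lambda>t. nat_code (f t)) [l - m..<l]))" if "m \<le> l" for m
      using that
    proof (induction m)
      case (Suc m)
      then have "[l - Suc m..<l] = (l - Suc m) # [l - m..<l]"
        by (metis Suc_diff_Suc Suc_le_lessD diff_Suc_less le_zero_eq less_le_trans not_gr_zero upt_conv_Cons zero_less_Suc)
      with Suc show ?case by simp
    qed simp
    from this[of l] show ?thesis by simp
  qed
  ultimately show ?thesis by simp
qed

lemma recursive_square_code:
  assumes c: "decidable (\<lambda>z. c (pfst z) (pfst (psnd z)) (psnd (psnd z)))" and n: "recursive n"
  shows "recursive (\<lambda>x. nat_of_word (square_code (n x) (c x)))"
proof -
  have "recursive (\<lambda>x. nat_of_word (concat (map (\<lambda>t. nat_code (Suc (of_bool (c x (t mod n x) (t div n x))))) [0..<n x * n x])))"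
    by (intro recursive_concat_nat_code recursive_intros decidable_lift3[OF c] n recursive_comp[OF n])
  then have "recursive (\<lambda>x. nat_of_word (nat_code (n x) @ word_of_nat (nat_of_word (nat_code (n x) @
      word_of_nat (nat_of_word (concat (map (\<lambda>t. nat_code (Suc (of_bool (c x (t mod n x) (t div n x))))) [0..<n x * n x])))))))"
    by (intro recursive_intros n)
  then show ?thesis by (simp add: square_code_def)
qed

definition side :: "nat \<Rightarrow> nat" where
  "side k = 2 ^ 4 ^ k"

lemma side_Suc: "side (Suc k) = side k * side k ^ 3"
proof -
  have "side (Suc k) = side k ^ 4" by (simp add: side_def power_mult[symmetric] mult.commute)
  then show ?thesis by (simp add: eval_nat_numeral)
qed

lemma side_pos [simp]: "0 < side k"
  by (simp add: side_def)

lemma side_gt: "k < side k"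
proof -
  have "k < 4 ^ k" by (induction k) auto
  also have "4 ^ k < side k" unfolding side_def by (rule less_exp)
  finally show ?thesis .
qed

text \<open>\<open>B\<close> codes an \<open>N \<times> N\<close> block. The window is seen at offset \<open>(v1, v2)\<close> in four adjacent copies
  of that block, those selected by the bits of \<open>g\<close> being complemented.\<close>

definition window :: "nat \<Rightarrow> nat \<Rightarrow> nat \<Rightarrow> nat \<Rightarrow> nat \<Rightarrow> nat \<Rightarrow> nat \<Rightarrow> bool" where
  "window N B v1 v2 g i j \<longleftrightarrow>
     bit B ((i + v1) mod N * N + (j + v2) mod N) \<noteq> bit g (2 * ((i + v1) div N) + (j + v2) div N)"

text \<open>\<open>R\<close> is a flattened square bit matrix of side \<open>side k ^ 3\<close>.
  Inequality of truth values acts as exclusive or, so a set bit complements its copy of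
  \<open>b\<close>.\<close>

definition refines :: "nat \<Rightarrow> nat \<Rightarrow> nat \<Rightarrow> bool" where
  "refines k b B \<longleftrightarrow> (\<exists>R<(2 :: nat) ^ (side k ^ 3 * side k ^ 3). \<forall>i<side (Suc k). \<forall>j<side (Suc k).
     bit B (i * side (Suc k) + j) \<longleftrightarrow>
       bit b (i mod side k * side k + j mod side k) \<noteq> bit R (i div side k * side k ^ 3 + j div side k))"

text \<open>\<open>X\<close> stays abstract as the words that a level must not show. Existence of
  good blocks depends only on the size of \<open>X\<close>, computability only on its
  decidability.\<close>

definition good :: "(nat \<Rightarrow> bool list set) \<Rightarrow> nat \<Rightarrow> nat \<Rightarrow> nat \<Rightarrow> bool" where
  "good X k b B \<longleftrightarrow> refines k b B \<and>
     (\<forall>v1<side (Suc k). \<forall>v2<side (Suc k). \<forall>g<16.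
        \<not> square_code (side (Suc k)) (window (side (Suc k)) B v1 v2 g) \<in> X (Suc k))"

text \<open>The second disjunct bounds the search, so that the block is recursive before any
  counting argument; \<open>good_block\<close> shows that the bound is never what stops it. Level 0
  is the constant block of side 2.\<close>

primrec block :: "(nat \<Rightarrow> bool list set) \<Rightarrow> nat \<Rightarrow> nat" where
  "block X 0 = 0"
| "block X (Suc k) =
     (LEAST B. good X k (block X k) B \<or> 2 ^ (side (Suc k) * side (Suc k)) \<le> B)"

lemma ex_bits: "\<exists>B<2 ^ L. \<forall>i<L. bit (B :: nat) i \<longleftrightarrow> f i"
proof (induction L)
  case (Suc L)
  then obtain B :: nat where B: "B < 2 ^ L" "\<forall>i<L. bit B i \<longleftrightarrow> f i" by blast
  let ?C = "B + of_bool (f L) * 2 ^ L"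
  have "?C < 2 ^ Suc L" using B by simp
  moreover have "bit ?C i \<longleftrightarrow> f i" if "i < Suc L" for i
  proof (cases "i = L")
    case True
    have "?C div 2 ^ L = of_bool (f L)" using B by simp
    then show ?thesis using True by (simp add: bit_iff_odd)
  next
    case False
    then have "i < L" using that by simp
    then have "take_bit L ?C = take_bit L B" by (simp add: take_bit_eq_mod)
    then have "bit ?C i \<longleftrightarrow> bit B i" using \<open>i < L\<close> by (metis bit_take_bit_iff)
    then show ?thesis using B \<open>i < L\<close> by simp
  qed
  ultimately show ?case by blast
qed auto

lemma eq_if_bits:
  assumes "(a :: nat) < 2 ^ L" "b < 2 ^ L" "\<And>i. i < L \<Longrightarrow> bit a i \<longleftrightarrow> bit b i"
  shows "a = b"
proof (rule bit_eqI)
  fix i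
  have "take_bit L a = a" "take_bit L b = b" using assms(1,2) by (simp_all add: take_bit_eq_mod)
  then show "bit a i \<longleftrightarrow> bit b i" using assms(3) by (metis bit_take_bit_iff)
qed

text \<open>A window as large as the block meets every residue pair, whatever its offset, and so
  shows every cell of the block. With the same \<open>g\<close> the complementation is the same in
  both windows and cancels.\<close>

lemma window_determines:
  assumes "square_code N (window N B v1 v2 g) = square_code N (window N B' v1 v2 g)"
    and "v1 < N" "v2 < N" "p < N" "q < N"
  shows "bit B (p * N + q) \<longleftrightarrow> bit B' (p * N + q)"
proof -
  have shift: "\<exists>i<N. (i + v) mod N = p" if "v < N" "p < N" for v p
  proof (cases "v \<le> p")
    case True
    then show ?thesis using that by (intro exI[of _ "p - v"]) auto
  next
    case False
    then show ?thesis using that by (intro exI[of _ "p + N - v"]) auto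
  qed
  from shift assms obtain i j where "i < N" "(i + v1) mod N = p" "j < N" "(j + v2) mod N = q" by meson
  then show ?thesis using assms(1) unfolding square_code_eq_iff window_def by blast
qed

text \<open>For \<open>a = 4 ^ k\<close> this says that the number of window parameters, 2^(8a+4),
  is smaller than 2^(m^2/2) with m^2/2 = 2^(6a-1).\<close>

lemma exponent_bound: "8 * a + 4 < (2 :: nat) ^ (6 * a - 1)" if "1 \<le> a"
  using that
proof (induction a rule: dec_induct)
  case (step a)
  have "6 * Suc a - 1 = 6 + (6 * a - 1)" using step by simp
  then have "(2 :: nat) ^ (6 * Suc a - 1) = 64 * 2 ^ (6 * a - 1)"
    by (simp only: power_add) simp
  moreover have "8 * Suc a + 4 < 64 * (2 :: nat) ^ (6 * a - 1)" using step by simp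
  ultimately show ?case by (simp only:)
qed simp

text \<open>If every matrix were spoiled, choosing a forbidden window for each would inject the
  2^(m^2) matrices into pairs of an element of \<open>X (Suc k)\<close> and window parameters, of
  which there are too few.\<close>

lemma ex_good:
  assumes fin: "finite (X (Suc k))" and card: "card (X (Suc k)) \<le> 2 ^ 2 ^ (6 * 4 ^ k - 1)"
  shows "\<exists>B<2 ^ (side (Suc k) * side (Suc k)). good X k b B"
proof (rule ccontr)
  assume contra: "\<not> ?thesis"
  let ?n = "side k" and ?N = "side (Suc k)" and ?m = "side k ^ 3"
  let ?L = "?m * ?m"
  have N: "?N = ?n * ?m" by (rule side_Suc)
  have m: "0 < ?m" by simp
  have "\<exists>B :: nat. B < 2 ^ (?N * ?N) \<and> (\<forall>i<?N. \<forall>j<?N. bit B (i * ?N + j) \<longleftrightarrow>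
       (bit b (i mod ?n * ?n + j mod ?n) \<noteq> bit R (i div ?n * ?m + j div ?n)))" for R :: nat
  proof -
    obtain B :: nat where B: "B < 2 ^ (?N * ?N)" "\<And>t. t < ?N * ?N \<Longrightarrow> bit B t \<longleftrightarrow>
       bit b (t div ?N mod ?n * ?n + t mod ?N mod ?n) \<noteq> bit R (t div ?N div ?n * ?m + t mod ?N div ?n)"
      using ex_bits[of "?N * ?N" "\<lambda>t. bit b (t div ?N mod ?n * ?n + t mod ?N mod ?n) \<noteq> bit R (t div ?N div ?n * ?m + t mod ?N div ?n)"]
      by blast
    have "bit B (i * ?N + j) \<longleftrightarrow>
       bit b (i mod ?n * ?n + j mod ?n) \<noteq> bit R (i div ?n * ?m + j div ?n)" if "i < ?N" "j < ?N" for i j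
    proof -
      have "i * ?N + j < ?N * ?N" using that by (intro index_less)
      moreover have "(i * ?N + j) div ?N = i" "(i * ?N + j) mod ?N = j" using that by simp_all
      ultimately show ?thesis using B(2)[of "i * ?N + j"] by simp
    qed
    with B(1) show ?thesis by blast
  qed
  then obtain C :: "nat \<Rightarrow> nat" where C: "\<And>R. C R < 2 ^ (?N * ?N)" "\<And>R i j. i < ?N \<Longrightarrow> j < ?N \<Longrightarrow> bit (C R) (i * ?N + j) \<longleftrightarrow>
       bit b (i mod ?n * ?n + j mod ?n) \<noteq> bit R (i div ?n * ?m + j div ?n)"
    by metis
  let ?code = "\<lambda>R (v1, v2, g). square_code ?N (window ?N (C R) v1 v2 g)"
  have "\<exists>v. v \<in> {..<?N} \<times> {..<?N} \<times> {..<16} \<and> ?code R v \<in> X (Suc k)" if "R < 2 ^ ?L" for R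
  proof -
    have "refines k b (C R)" unfolding refines_def using C(2) that by blast
    moreover have "\<not> good X k b (C R)" using contra C(1) by blast
    ultimately obtain v1 v2 g where "v1 < ?N" "v2 < ?N" "g < 16"
      "square_code ?N (window ?N (C R) v1 v2 g) \<in> X (Suc k)"
      unfolding good_def by blast
    then show ?thesis by (intro exI[of _ "(v1, v2, g)"]) simp
  qed
  then obtain h where h: "\<And>R. R < 2 ^ ?L \<Longrightarrow> h R \<in> {..<?N} \<times> {..<?N} \<times> {..<16} \<and> ?code R (h R) \<in> X (Suc k)"
    by metis
  have inj: "inj_on (\<lambda>R. (?code R (h R), h R)) {..<2 ^ ?L}"
  proof (rule inj_onI)
    fix R R' assume R: "R \<in> {..<2 ^ ?L}" "R' \<in> {..<2 ^ ?L}"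
      and eq: "(?code R (h R), h R) = (?code R' (h R'), h R')"
    obtain v1 v2 g where v: "h R = (v1, v2, g)" by (cases "h R") auto
    have codes: "square_code ?N (window ?N (C R) v1 v2 g) = square_code ?N (window ?N (C R') v1 v2 g)"
      and v': "v1 < ?N" "v2 < ?N" using eq v h[of R] R by auto
    show "R = R'"
    proof (rule eq_if_bits[of _ ?L])
      fix r assume "r < ?L"
      define s t where "s = r div ?m" and "t = r mod ?m"
      have st: "s < ?m" "t < ?m" "r = s * ?m + t"
        using less_mult_imp_div_less[OF \<open>r < ?L\<close>]
        by (simp_all only: s_def t_def div_mult_mod_eq mod_less_divisor[OF m])
      then have *: "s * ?n < ?N" "t * ?n < ?N" by (simp_all add: N)
      \<comment> \<open>Compared are the corner cells of copy (s, t): there both blocks combine the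
        same bit of \<open>b\<close> with bit \<open>r\<close> of their matrix.\<close>
      have "bit (C R) (s * ?n * ?N + t * ?n) \<longleftrightarrow> bit (C R') (s * ?n * ?N + t * ?n)"
        by (rule window_determines[OF codes v' *])
      then show "bit R r \<longleftrightarrow> bit R' r" using st(3) by (auto simp: C(2)[OF *])
    qed (use R in auto)
  qed
  have "card {..<(2 :: nat) ^ ?L} \<le> card (X (Suc k) \<times> {..<?N} \<times> {..<?N} \<times> {..<16 :: nat})"
  proof (rule card_inj_on_le[OF inj])
    show "(\<lambda>R. (?code R (h R), h R)) ` {..<2 ^ ?L} \<subseteq> X (Suc k) \<times> {..<?N} \<times> {..<?N} \<times> {..<16}"
    proof (rule image_subsetI)
      fix R :: nat assume "R \<in> {..<2 ^ ?L}"
      then have "R < 2 ^ ?L" by (simp only: lessThan_iff)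
      from h[OF this] show "(?code R (h R), h R) \<in> X (Suc k) \<times> {..<?N} \<times> {..<?N} \<times> {..<16}"
        unfolding mem_Sigma_iff by blast
    qed
  qed (use fin in simp)
  then have "2 ^ ?L \<le> card (X (Suc k)) * (?N * (?N * 16))" by (simp add: card_cartesian_product)
  also have "\<dots> \<le> 2 ^ 2 ^ (6 * 4 ^ k - 1) * (?N * (?N * 16))" using card by simp
  \<comment> \<open>\<open>?N\<close> is 2^(4 * 4^k); the factor 16 counts the values of
    \<open>g\<close>.\<close>
  also have "?N * (?N * 16) = 2 ^ (8 * 4 ^ k + 4)"
    by (simp add: side_def power_add[symmetric] mult.assoc[symmetric]) (simp add: power_add)
  finally have "2 ^ ?L \<le> (2 :: nat) ^ (2 ^ (6 * 4 ^ k - 1) + (8 * 4 ^ k + 4))" by (simp add: power_add)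
  then have "?L \<le> 2 ^ (6 * 4 ^ k - 1) + (8 * 4 ^ k + 4)" by simp
  moreover have "?L = 2 * 2 ^ (6 * 4 ^ k - 1)"
  proof -
    have "?L = 2 ^ (6 * 4 ^ k)"
      by (simp add: side_def power_mult[symmetric] power_add[symmetric])
    also have "6 * 4 ^ k = Suc (6 * 4 ^ k - 1 :: nat)" by simp
    finally show ?thesis by (simp only: power_Suc)
  qed
  ultimately show False using exponent_bound[of "4 ^ k"] by simp
qed

lemma good_block:
  assumes "finite (X (Suc k))" "card (X (Suc k)) \<le> 2 ^ 2 ^ (6 * 4 ^ k - 1)"
  shows "good X k (block X k) (block X (Suc k))"
proof -
  obtain B where B: "B < 2 ^ (side (Suc k) * side (Suc k))" "good X k (block X k) B"
    using ex_good[of X k, OF assms] by blast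
  then have "block X (Suc k) \<le> B" by (auto intro: Least_le)
  moreover have "good X k (block X k) (block X (Suc k)) \<or> 2 ^ (side (Suc k) * side (Suc k)) \<le> block X (Suc k)"
    using LeastI[of "\<lambda>B. good X k (block X k) B \<or> 2 ^ (side (Suc k) * side (Suc k)) \<le> B" B] B(2) by simp
  ultimately show ?thesis using B(1) by linarith
qed

section \<open>Computability of the blocks\<close>

lemma recursive_side [recursive_intros]: "recursive f \<Longrightarrow> recursive (\<lambda>x. side (f x))"
  unfolding side_def by (intro recursive_intros)

lemma decidable_window [recursive_intros]:
  assumes "recursive N" "recursive B" "recursive v1" "recursive v2" "recursive g" "recursive i" "recursive j"
  shows "decidable (\<lambda>x. window (N x) (B x) (v1 x) (v2 x) (g x) (i x) (j x))"
  unfolding window_def by (intro recursive_intros assms)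

lemma decidable_refines [recursive_intros]:
  assumes "recursive k" "recursive b" "recursive B"
  shows "decidable (\<lambda>x. refines (k x) (b x) (B x))"
proof (rule decidable_lift3[OF _ assms])
  show "decidable (\<lambda>z. refines (pfst z) (pfst (psnd z)) (psnd (psnd z)))"
    unfolding refines_def by (intro recursive_intros)
qed

lemma decidable_good:
  assumes X: "decidable (\<lambda>z. word_of_nat (psnd z) \<in> X (pfst z))"
    and "recursive k" "recursive b" "recursive B"
  shows "decidable (\<lambda>x. good X (k x) (b x) (B x))"
proof (rule decidable_lift3[OF _ assms(2-4)])
  have X': "decidable (\<lambda>x. square_code (n x) (c x) \<in> X (l x))"
    if "recursive l" "recursive (\<lambda>x. nat_of_word (square_code (n x) (c x)))" for l n c
    using decidable_lift2[of "\<lambda>k v. word_of_nat v \<in> X k", OF X that] by simp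
  show "decidable (\<lambda>z. good X (pfst z) (pfst (psnd z)) (psnd (psnd z)))"
    unfolding good_def by (intro recursive_intros X' recursive_square_code)
qed

lemma recursive_block:
  assumes X: "decidable (\<lambda>z. word_of_nat (psnd z) \<in> X (pfst z))" and "recursive f"
  shows "recursive (\<lambda>x. block X (f x))"
proof (rule recursive_comp[OF _ assms(2)])
  define next_block where "next_block k b =
    (LEAST B. good X k b B \<or> 2 ^ (side (Suc k) * side (Suc k)) \<le> B)" for k b
  have nb: "recursive (\<lambda>z. next_block (pfst z) (psnd z))"
    unfolding next_block_def
  proof (rule recursive_Least)
    show "decidable (\<lambda>z. good X (pfst (pfst z)) (psnd (pfst z)) (psnd z) \<or>
        2 ^ (side (Suc (pfst (pfst z))) * side (Suc (pfst (pfst z)))) \<le> psnd z)"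
      by (intro recursive_intros decidable_good[OF X])
  qed blast
  have "recursive (\<lambda>k. rec_nat 0 next_block k)"
    by (intro recursive_intros recursive_lift2[OF nb])
  moreover have "rec_nat 0 next_block k = block X k" for k
    by (induction k) (simp_all add: next_block_def)
  ultimately show "recursive (block X)" by simp
qed

section \<open>The shift avoiding all other windows\<close>

lemma topspace_full_shift:
  "topspace (product_topology (\<lambda>_ :: int \<times> int. discrete_topology A) UNIV) = {x. range x \<subseteq> A}"
  by (auto simp: PiE_def)

lemma closedin_avoiding:
  assumes "\<And>P. P \<in> F \<Longrightarrow> finite (dom P)"
  shows "closedin (product_topology (\<lambda>_. discrete_topology A) UNIV) (avoiding A F)"
proof -
  let ?X = "product_topology (\<lambda>_ :: int \<times> int. discrete_topology A) UNIV"
  \<comment> \<open>The configurations that differ from \<open>P\<close>, placed at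
    \<open>v\<close>, in some cell. This is a finite union of closed sets because the support is
    finite.\<close>
  let ?C = "\<lambda>P v. \<Union>u\<in>dom P. {x \<in> topspace ?X. x (u + v) \<in> A \<inter> {y. P u \<noteq> Some y}}"
  have "closedin ?X (?C P v)" if "P \<in> F" for P v
  proof (rule closedin_Union)
    fix S assume "S \<in> (\<lambda>u. {x \<in> topspace ?X. x (u + v) \<in> A \<inter> {y. P u \<noteq> Some y}}) ` dom P"
    then obtain u where S: "S = {x \<in> topspace ?X. x (u + v) \<in> A \<inter> {y. P u \<noteq> Some y}}" by blast
    have "continuous_map ?X (discrete_topology A) (\<lambda>x. x (u + v))"
      by (rule continuous_map_product_projection) simp
    then show "closedin ?X S" unfolding S by (rule closedin_continuous_map_preimage) simp
  qed (use assms[OF that] in simp)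
  then have "closedin ?X (\<Inter> (insert (topspace ?X) {?C P v | P v. P \<in> F}))"
    by (intro closedin_Inter) (use closedin_topspace[of ?X] in blast)+
  moreover have "avoiding A F = \<Inter> (insert (topspace ?X) {?C P v | P v. P \<in> F})"
  proof (intro equalityI subsetI)
    fix x assume x: "x \<in> avoiding A F"
    then have tx: "x \<in> topspace ?X" by (simp only: avoiding_def topspace_full_shift mem_Collect_eq)
    have "x \<in> ?C P v" if "P \<in> F" for P v
    proof -
      have "\<not> occurs_in P x" using x that by (simp add: avoiding_def)
      then obtain u where "u \<in> dom P" "P u \<noteq> Some (x (u + v))" unfolding occurs_in_def by blast
      moreover have "x (u + v) \<in> A" using tx unfolding topspace_full_shift by blast
      ultimately show ?thesis using tx by blast
    qed
    with tx show "x \<in> \<Inter> (insert (topspace ?X) {?C P v | P v. P \<in> F})" by blast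
  next
    fix x assume x: "x \<in> \<Inter> (insert (topspace ?X) {?C P v | P v. P \<in> F})"
    have "\<not> occurs_in P x" if "P \<in> F" for P
      unfolding occurs_in_def
    proof
      assume "\<exists>v. \<forall>u\<in>dom P. P u = Some (x (u + v))"
      then obtain v where v: "\<forall>u\<in>dom P. P u = Some (x (u + v))" by blast
      have "x \<in> ?C P v" using x that by blast
      with v show False by blast
    qed
    moreover have "range x \<subseteq> A" using x unfolding topspace_full_shift by blast
    ultimately show "x \<in> avoiding A F" by (simp add: avoiding_def)
  qed
  ultimately show ?thesis by simp
qed

lemma avoiding_UN_iff:
  "I \<noteq> {} \<Longrightarrow> x \<in> avoiding A (\<Union>i\<in>I. F i) \<longleftrightarrow> (\<forall>i\<in>I. x \<in> avoiding A (F i))"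
  by (auto simp: avoiding_def)

lemma is_shift_avoiding:
  assumes "\<And>P. P \<in> F \<Longrightarrow> finite (dom P)"
  shows "is_shift A (avoiding A F)"
proof -
  have "translate v x \<in> avoiding A F" if x: "x \<in> avoiding A F" for v x
  proof -
    have "occurs_in P x" if "occurs_in P (translate v x)" for P
    proof -
      from that obtain w where "\<forall>u\<in>dom P. P u = Some (x (u + w + v))"
        by (auto simp: occurs_in_def translate_def)
      then show ?thesis unfolding occurs_in_def by (intro exI[of _ "w + v"]) (simp add: add.assoc)
    qed
    moreover have "range (translate v x) \<subseteq> range x" by (auto simp: translate_def)
    ultimately show ?thesis using x by (auto simp: avoiding_def)
  qed
  with closedin_avoiding[OF assms] show ?thesis by (simp add: is_shift_def)
qed

section \<open>Codes of square patterns and the forbidden set\<close>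

lemma concat_map_upt:
  "concat (map (\<lambda>j. map (\<lambda>i. f i j) [0..<n]) [0..<m]) = map (\<lambda>t. f (t mod n) (t div n)) [0..<m * n]"
proof (induction m)
  case (Suc m)
  have "map (\<lambda>i. f i m) [0..<n] = map (\<lambda>t. f (t mod n) (t div n)) [m * n..<m * n + n]"
    by (rule nth_equalityI) auto
  moreover have "[0..<Suc m * n] = [0..<m * n] @ [m * n..<m * n + n]"
    using upt_add_eq_append[of 0 "m * n" n] by (simp add: add.commute)
  ultimately show ?case using Suc by simp
qed simp

lemma upto_eq_map: "[a + 1..a + int n] = map (\<lambda>i. a + 1 + int i) [0..<n]"
  by (rule nth_equalityI) auto

text \<open>The bounding box of a full square is the square itself, so no cell is undefined and the
  general code becomes a \<open>square_code\<close>, the only form used from here on.\<close>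

lemma pattern_code_square:
  assumes n: "0 < n" and dom: "dom P = (\<lambda>u. u + v) ` ({1..int n} \<times> {1..int n})" and ran: "ran P \<subseteq> {0, 1}"
  shows "pattern_code P = square_code n (\<lambda>i j. P (fst v + 1 + int i, snd v + 1 + int j) = Some 1)"
proof -
  let ?c = "\<lambda>i j. P (fst v + 1 + int i, snd v + 1 + int j) = Some 1"
  have proj: "fst ` dom P = {fst v + 1..fst v + int n}" "snd ` dom P = {snd v + 1..snd v + int n}"
  proof -
    have "fst ` dom P = (\<lambda>i. i + fst v) ` fst ` ({1..int n} \<times> {1..int n})"
      "snd ` dom P = (\<lambda>i. i + snd v) ` snd ` ({1..int n} \<times> {1..int n})"
      by (simp_all only: dom image_image fst_add snd_add)
    moreover have "{1..int n} \<noteq> {}" using n by simp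
    ultimately show "fst ` dom P = {fst v + 1..fst v + int n}" "snd ` dom P = {snd v + 1..snd v + int n}"
      by (simp_all only: fst_image_times snd_image_times if_False image_add_atLeastAtMost' add.commute)
  qed
  have ne: "dom P \<noteq> {}" using n by (simp add: dom)
  have Min_Max: "Min {a + 1..a + int n} = a + 1" "Max {a + 1..a + int n} = a + int n" for a
    using n by (auto intro!: Min_eqI Max_eqI)
  have cols: "pattern_cols P = map (\<lambda>i. fst v + 1 + int i) [0..<n]"
    and rows: "pattern_rows P = map (\<lambda>i. snd v + 1 + int i) [0..<n]"
    by (simp_all only: pattern_cols_def pattern_rows_def ne proj Min_Max upto_eq_map if_False)
  have cell: "cell_code (P (fst v + 1 + int i, snd v + 1 + int j)) = nat_code (Suc (of_bool (?c i j)))"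
    if "i < n" "j < n" for i j
  proof -
    have "(fst v + 1 + int i, snd v + 1 + int j) \<in> dom P"
      unfolding dom by (rule image_eqI[of _ _ "(1 + int i, 1 + int j)"]) (use that in \<open>auto simp: prod_eq_iff\<close>)
    then obtain a where a: "P (fst v + 1 + int i, snd v + 1 + int j) = Some a" by blast
    then have "a \<in> ran P" by (rule ranI)
    then have "a = 0 \<or> a = 1" using ran by blast
    then show ?thesis by (auto simp: a cell_code_def)
  qed
  have "concat [cell_code (P (i, j)). j \<leftarrow> pattern_rows P, i \<leftarrow> pattern_cols P] =
      concat (concat (map (\<lambda>j. map (\<lambda>i. nat_code (Suc (of_bool (?c i j)))) [0..<n]) [0..<n]))"
    unfolding rows cols map_map comp_def
    by (intro arg_cong[of _ _ concat] map_cong refl) (simp add: cell)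
  also have "\<dots> = concat (map (\<lambda>t. nat_code (Suc (of_bool (?c (t mod n) (t div n))))) [0..<n * n])"
    by (simp only: concat_map_upt)
  finally show ?thesis unfolding pattern_code_def square_code_def by (simp add: rows cols)
qed

text \<open>Supports of square patterns are translates of squares that start at 1, so the square
  with lower corner (a, b) is translated by (a - 1, b - 1).\<close>

definition subsquare :: "config2d \<Rightarrow> nat \<Rightarrow> int \<Rightarrow> int \<Rightarrow> pattern" where
  "subsquare x n a b = (Some \<circ> x) |` ((\<lambda>u. u + (a - 1, b - 1)) ` ({1..int n} \<times> {1..int n}))"

lemma dom_subsquare: "dom (subsquare x n a b) = (\<lambda>u. u + (a - 1, b - 1)) ` ({1..int n} \<times> {1..int n})"
proof -
  have "dom (Some \<circ> x) = UNIV" by auto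
  then show ?thesis by (simp add: subsquare_def)
qed

lemma subsquare_facts:
  assumes "range x \<subseteq> {0, 1}" "0 < n"
  shows "pattern_over {0, 1} (subsquare x n a b)" "square_pattern n (subsquare x n a b)"
    "pattern_code (subsquare x n a b) = square_code n (\<lambda>i j. x (a + int i, b + int j) = 1)"
proof -
  have "ran (subsquare x n a b) \<subseteq> range x"
    by (auto simp: subsquare_def ran_def restrict_map_def split: if_splits)
  with assms(1) have ran: "ran (subsquare x n a b) \<subseteq> {0, 1}" by (rule order_trans[rotated])
  then show "pattern_over {0, 1} (subsquare x n a b)"
    by (simp add: pattern_over_def dom_subsquare)
  show "square_pattern n (subsquare x n a b)"
    unfolding square_pattern_def using dom_subsquare by blast
  have "subsquare x n a b (a + int i, b + int j) = Some (x (a + int i, b + int j))" if "i < n" "j < n" for i j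
  proof -
    have "(a + int i, b + int j) \<in> (\<lambda>u. u + (a - 1, b - 1)) ` ({1..int n} \<times> {1..int n})"
      by (rule image_eqI[of _ _ "(1 + int i, 1 + int j)"]) (use that in auto)
    then show ?thesis by (simp add: subsquare_def)
  qed
  then show "pattern_code (subsquare x n a b) = square_code n (\<lambda>i j. x (a + int i, b + int j) = 1)"
    using pattern_code_square[OF assms(2) dom_subsquare ran] by (simp add: square_code_eq_iff)
qed

definition has_window_code :: "(nat \<Rightarrow> bool list set) \<Rightarrow> nat \<Rightarrow> bool list \<Rightarrow> bool" where
  "has_window_code X k w \<longleftrightarrow> (\<exists>v1<side k. \<exists>v2<side k. \<exists>g<(16 :: nat).
     w = square_code (side k) (window (side k) (block X k) v1 v2 g))"

text \<open>Membership is phrased through the code, which is all that a decision procedure for the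
  forbidden words sees.\<close>

definition level_forbidden :: "(nat \<Rightarrow> bool list set) \<Rightarrow> nat \<Rightarrow> pattern set" where
  "level_forbidden X k = {P. pattern_over {0, 1} P \<and> square_pattern (side k) P \<and>
     \<not> has_window_code X k (pattern_code P)}"

text \<open>The interface between shift and blocks: it replaces occurrences of patterns by the codes
  of all squares of side \<open>side k\<close> in \<open>x\<close>.\<close>

lemma avoiding_level_iff:
  "x \<in> avoiding {0, 1} (level_forbidden X k) \<longleftrightarrow> range x \<subseteq> {0, 1} \<and>
     (\<forall>a b. has_window_code X k (square_code (side k) (\<lambda>i j. x (a + int i, b + int j) = 1)))"
    (is "?l \<longleftrightarrow> ?r")
proof
  assume l: ?l
  then have rng: "range x \<subseteq> {0, 1}" by (simp add: avoiding_def)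
  moreover have "has_window_code X k (square_code (side k) (\<lambda>i j. x (a + int i, b + int j) = 1))" for a b
  proof -
    let ?P = "subsquare x (side k) a b"
    have "occurs_in ?P x" unfolding occurs_in_def
      by (intro exI[of _ 0]) (auto simp: subsquare_def restrict_map_def split: if_splits)
    then have "?P \<notin> level_forbidden X k" using l by (auto simp: avoiding_def)
    then show ?thesis using subsquare_facts[OF rng side_pos] by (simp add: level_forbidden_def)
  qed
  ultimately show ?r by blast
next
  assume r: ?r
  have "\<not> occurs_in P x" if P: "P \<in> level_forbidden X k" for P
  proof
    assume "occurs_in P x"
    then obtain w where w: "\<forall>u\<in>dom P. P u = Some (x (u + w))" by (auto simp: occurs_in_def)
    from P obtain v where v: "dom P = (\<lambda>u. u + v) ` ({1..int (side k)} \<times> {1..int (side k)})"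
      and ran: "ran P \<subseteq> {0, 1}"
      by (auto simp: level_forbidden_def square_pattern_def pattern_over_def)
    have "P (fst v + 1 + int i, snd v + 1 + int j) =
        Some (x (fst v + 1 + fst w + int i, snd v + 1 + snd w + int j))" if "i < side k" "j < side k" for i j
    proof -
      have "(fst v + 1 + int i, snd v + 1 + int j) \<in> dom P"
        unfolding v by (rule image_eqI[of _ _ "(1 + int i, 1 + int j)"]) (use that in \<open>auto simp: prod_eq_iff\<close>)
      moreover have "(fst v + 1 + int i, snd v + 1 + int j) + w =
          (fst v + 1 + fst w + int i, snd v + 1 + snd w + int j)" by (simp add: prod_eq_iff)
      ultimately show ?thesis using w by metis
    qed
    then have "pattern_code P = square_code (side k)
        (\<lambda>i j. x (fst v + 1 + fst w + int i, snd v + 1 + snd w + int j) = 1)"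
      using pattern_code_square[OF side_pos v ran] by (simp add: square_code_eq_iff)
    then have "has_window_code X k (pattern_code P)" using r by simp
    then show False using P by (simp add: level_forbidden_def)
  qed
  with r show ?l by (simp add: avoiding_def)
qed

text \<open>Tilings aligned with the origin suffice, since they only serve as witnesses of
  nonemptiness. The complementation \<open>G\<close> is arbitrary.\<close>

definition layered :: "(nat \<Rightarrow> bool list set) \<Rightarrow> nat \<Rightarrow> config2d \<Rightarrow> bool" where
  "layered X k x \<longleftrightarrow> (\<exists>G :: int \<Rightarrow> int \<Rightarrow> bool. \<forall>i j.
     x (i, j) = of_bool (bit (block X k) (nat (i mod int (side k)) * side k + nat (j mod int (side k)))
       \<noteq> G (i div int (side k)) (j div int (side k))))"

lemma layered_window:
  assumes "layered X k x" shows "x \<in> avoiding {0, 1} (level_forbidden X k)"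
proof -
  let ?N = "side k"
  obtain G :: "int \<Rightarrow> int \<Rightarrow> bool" where G: "\<And>i j.
     x (i, j) = of_bool (bit (block X k) (nat (i mod int ?N) * ?N + nat (j mod int ?N))
       \<noteq> G (i div int ?N) (j div int ?N))"
    using assms by (auto simp: layered_def)
  \<comment> \<open>Splits a position into offset and copy: with v = a mod N, the sum i + v never
    becomes negative and can be divided as a natural number.\<close>
  have shift: "nat ((a + int i) mod int ?N) = (i + nat (a mod int ?N)) mod ?N \<and>
     (a + int i) div int ?N = a div int ?N + int ((i + nat (a mod int ?N)) div ?N)" for a i
  proof -
    define v where "v = nat (a mod int ?N)"
    have "a mod int ?N = int v" by (simp add: v_def)
    then have a: "a = a div int ?N * int ?N + int v" by (metis div_mult_mod_eq)
    then have "a + int i = int (i + v) + a div int ?N * int ?N" by simp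
    then have "(a + int i) mod int ?N = int (i + v) mod int ?N"
      "(a + int i) div int ?N = a div int ?N + int (i + v) div int ?N"
      by (metis mod_mult_self1, metis add.commute div_mult_self1 of_nat_0_less_iff order_less_irrefl side_pos)
    then show ?thesis
      unfolding v_def[symmetric] by (simp only: zmod_int[symmetric] zdiv_int[symmetric] nat_int)
  qed
  have "has_window_code X k (square_code ?N (\<lambda>i j. x (a + int i, b + int j) = 1))" for a b
  proof -
    define v1 v2 where "v1 = nat (a mod int ?N)" and "v2 = nat (b mod int ?N)"
    have v: "v1 < ?N" "v2 < ?N" by (simp_all add: v1_def v2_def nat_less_iff)
    obtain g :: nat where g: "g < 2 ^ 4"
      "\<And>t. t < 4 \<Longrightarrow> bit g t \<longleftrightarrow> G (a div int ?N + int (t div 2)) (b div int ?N + int (t mod 2))"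
      using ex_bits[of 4 "\<lambda>t. G (a div int ?N + int (t div 2)) (b div int ?N + int (t mod 2))"] by blast
    have "(x (a + int i, b + int j) = 1) \<longleftrightarrow> window ?N (block X k) v1 v2 g i j" if "i < ?N" "j < ?N" for i j
    proof -
      define s t where "s = (i + v1) div ?N" and "t = (j + v2) div ?N"
      \<comment> \<open>Since i + v1 and j + v2 are below 2N, the square meets at most two copies in
        each direction; \<open>g\<close> records \<open>G\<close> on these four.\<close>
      have "s < 2" "t < 2" unfolding s_def t_def using that v by (auto intro: less_mult_imp_div_less)
      then have "bit g (2 * s + t) \<longleftrightarrow> G (a div int ?N + int s) (b div int ?N + int t)"
        using g(2)[of "2 * s + t"] by simp
      then show ?thesis
        using shift[of a i] shift[of b j] by (simp add: G window_def v1_def[symmetric] v2_def[symmetric] s_def t_def)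
    qed
    then have "square_code ?N (\<lambda>i j. x (a + int i, b + int j) = 1) =
        square_code ?N (window ?N (block X k) v1 v2 g)"
      by (simp add: square_code_eq_iff)
    with v g(1) show ?thesis unfolding has_window_code_def by auto
  qed
  moreover have "range x \<subseteq> {0, 1}"
  proof (rule image_subsetI)
    show "x u \<in> {0, 1}" for u
      using G[of "fst u" "snd u"] by (simp add: of_bool_def)
  qed
  ultimately show ?thesis unfolding avoiding_level_iff by blast
qed

text \<open>Each large block is an array of complemented or plain small ones. A small copy is thus
  complemented by the exclusive or of its bit in \<open>R\<close> and the complementation of the
  large block around it.\<close>

lemma layered_Suc:
  assumes ref: "refines k (block X k) (block X (Suc k))" and lay: "layered X (Suc k) x"
  shows "layered X k x"
proof -
  let ?n = "side k" and ?N = "side (Suc k)" and ?m = "side k ^ 3"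
  have N: "int ?N = int ?n * int ?m" by (simp add: side_Suc)
  obtain R where R: "\<And>i j. i < ?N \<Longrightarrow> j < ?N \<Longrightarrow> bit (block X (Suc k)) (i * ?N + j) \<longleftrightarrow>
       bit (block X k) (i mod ?n * ?n + j mod ?n) \<noteq> bit (R :: nat) (i div ?n * ?m + j div ?n)"
    using ref unfolding refines_def by blast
  obtain G :: "int \<Rightarrow> int \<Rightarrow> bool" where G: "\<And>i j.
     x (i, j) = of_bool (bit (block X (Suc k)) (nat (i mod int ?N) * ?N + nat (j mod int ?N))
       \<noteq> G (i div int ?N) (j div int ?N))"
    using lay unfolding layered_def by blast
  have I: "nat (i mod int ?N) mod ?n = nat (i mod int ?n) \<and>
      nat (i mod int ?N) div ?n = nat (i div int ?n mod int ?m) \<and>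
      i div int ?N = i div int ?n div int ?m \<and> nat (i mod int ?N) < ?N" for i
  proof -
    have "i mod int ?N = int ?n * (i div int ?n mod int ?m) + i mod int ?n"
      unfolding N by (rule zmod_zmult2_eq) simp
    moreover have "i div int ?n mod int ?m = int (nat (i div int ?n mod int ?m))" by simp
    moreover have "i mod int ?n = int (nat (i mod int ?n))" by simp
    ultimately have "i mod int ?N = int (?n * nat (i div int ?n mod int ?m) + nat (i mod int ?n))"
      by (metis of_nat_add of_nat_mult)
    then have "nat (i mod int ?N) = ?n * nat (i div int ?n mod int ?m) + nat (i mod int ?n)" by linarith
    moreover have "nat (i mod int ?n) < ?n" by (simp add: nat_less_iff)
    moreover have "i div int ?N = i div int ?n div int ?m" unfolding N by (rule zdiv_zmult2_eq) simp
    moreover have "nat (i mod int ?N) < ?N" by (simp add: nat_less_iff)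
    ultimately show ?thesis by simp
  qed
  have "x (i, j) = of_bool (bit (block X k) (nat (i mod int ?n) * ?n + nat (j mod int ?n)) \<noteq>
     (bit R (nat (i div int ?n mod int ?m) * ?m + nat (j div int ?n mod int ?m)) \<noteq>
      G (i div int ?n div int ?m) (j div int ?n div int ?m)))" for i j
  proof -
    have "bit (block X (Suc k)) (nat (i mod int ?N) * ?N + nat (j mod int ?N)) \<longleftrightarrow>
       bit (block X k) (nat (i mod int ?n) * ?n + nat (j mod int ?n)) \<noteq>
       bit R (nat (i div int ?n mod int ?m) * ?m + nat (j div int ?n mod int ?m))"
      using R[of "nat (i mod int ?N)" "nat (j mod int ?N)"] I[of i] I[of j] by simp
    then show ?thesis unfolding G using I[of i] I[of j]
      by (simp only: of_bool_eq_iff) blast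
  qed
  then show ?thesis unfolding layered_def
    by (intro exI[of _ "\<lambda>a b. bit R (nat (a mod int ?m) * ?m + nat (b mod int ?m)) \<noteq> G (a div int ?m) (b div int ?m)"]) blast
qed

definition forbidden :: "(nat \<Rightarrow> bool list set) \<Rightarrow> pattern set" where
  "forbidden X = (\<Union>k. level_forbidden X k)"

text \<open>The periodic tiling by \<open>block X n\<close> is layered at all levels up to
  \<open>n\<close>, by descent. So the configurations legal for the first levels form a decreasing
  sequence of nonempty closed sets in a compact space.\<close>

lemma avoiding_nonempty:
  assumes "\<And>k. refines k (block X k) (block X (Suc k))"
  shows "avoiding {0, 1} (forbidden X) \<noteq> {}"
proof -
  let ?T = "product_topology (\<lambda>_ :: int \<times> int. discrete_topology {0, 1 :: nat}) UNIV"
  define C where "C n = avoiding {0, 1} (\<Union>k\<le>n. level_forbidden X k)" for n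
  have C_iff: "x \<in> C n \<longleftrightarrow> (\<forall>k\<le>n. x \<in> avoiding {0, 1} (level_forbidden X k))" for x n
    unfolding C_def by (subst avoiding_UN_iff) (simp_all add: Ball_def)
  have "C n \<noteq> {}" for n
  proof -
    let ?x = "\<lambda>(i, j). of_bool (bit (block X n)
      (nat (i mod int (side n)) * side n + nat (j mod int (side n)))) :: nat"
    have top: "layered X n ?x"
      unfolding layered_def by (intro exI[of _ "\<lambda>_ _. False"]) simp
    have "layered X k ?x" if "k \<le> n" for k
      using that
    proof (induction k rule: inc_induct)
      case (step k)
      show ?case by (rule layered_Suc[OF assms step.IH])
    qed (rule top)
    then have "?x \<in> avoiding {0, 1} (level_forbidden X k)" if "k \<le> n" for k
      using that by (intro layered_window)
    then have "?x \<in> C n" unfolding C_iff by simp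
    then show ?thesis by blast
  qed
  moreover have "closedin ?T (C n)" for n
    unfolding C_def by (rule closedin_avoiding) (auto simp: level_forbidden_def pattern_over_def)
  moreover have "decseq C"
  proof (unfold decseq_def, intro allI impI subsetI)
    fix m n x assume "m \<le> n" "x \<in> C n"
    then show "x \<in> C m" unfolding C_iff by simp
  qed
  moreover have "compact_space ?T"
    by (simp add: compact_space_product_topology compact_space_discrete_topology)
  ultimately have "(\<Inter>n. C n) \<noteq> {}" by (intro compact_space_imp_nest[of ?T])
  then obtain x where x: "\<And>n. x \<in> C n" by auto
  have "x \<in> avoiding {0, 1} (level_forbidden X k)" for k
    using x[of k] unfolding C_iff by simp
  then have "x \<in> avoiding {0, 1} (forbidden X)"
    unfolding forbidden_def by (subst avoiding_UN_iff) simp_all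
  then show ?thesis by blast
qed

lemma in_avoiding_forbidden:
  "x \<in> avoiding {0, 1} (forbidden X) \<Longrightarrow> x \<in> avoiding {0, 1} (level_forbidden X k)"
  by (auto simp: avoiding_def forbidden_def)

lemma admissible_square:
  assumes "0 < n" "square_pattern n P" "globally_admissible (avoiding {0, 1} (forbidden X)) P"
  obtains x a b where "x \<in> avoiding {0, 1} (forbidden X)"
    "pattern_code P = square_code n (\<lambda>i j. x (a + int i, b + int j) = 1)"
proof -
  from assms obtain x v where x: "x \<in> avoiding {0, 1} (forbidden X)" and P: "P = (Some \<circ> x) |` dom P"
    and v: "dom P = (\<lambda>u. u + v) ` ({1..int n} \<times> {1..int n})"
    by (auto simp: square_pattern_def globally_admissible_def)
  have "P = subsquare x n (fst v + 1) (snd v + 1)" unfolding subsquare_def using P v by simp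
  moreover have "range x \<subseteq> {0, 1}" using x by (simp add: avoiding_def)
  ultimately show ?thesis using that x subsquare_facts(3)[OF _ assms(1)] by metis
qed

text \<open>All quantifiers are bounded on the right, which makes membership decidable:
  \<open>M\<close> runs through all binary squares of side \<open>side k\<close>.\<close>

lemma nat_of_word_forbidden:
  "e \<in> nat_of_word ` pattern_code ` forbidden X \<longleftrightarrow>
     (\<exists>k<Suc e. \<exists>M<2 ^ (side k * side k).
        e = nat_of_word (square_code (side k) (\<lambda>i j. bit (M :: nat) (i * side k + j))) \<and>
        \<not> (\<exists>v1<side k. \<exists>v2<side k. \<exists>g<16.
           e = nat_of_word (square_code (side k) (window (side k) (block X k) v1 v2 g))))"
    (is "?l \<longleftrightarrow> ?r")
proof
  assume ?l
  then obtain P k where e: "e = nat_of_word (pattern_code P)" and P: "P \<in> level_forbidden X k"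
    by (auto simp: forbidden_def)
  let ?N = "side k"
  from P obtain v where v: "dom P = (\<lambda>u. u + v) ` ({1..int ?N} \<times> {1..int ?N})"
    and ran: "ran P \<subseteq> {0, 1}" and no: "\<not> has_window_code X k (pattern_code P)"
    by (auto simp: level_forbidden_def square_pattern_def pattern_over_def)
  obtain c where c: "pattern_code P = square_code ?N c"
    using pattern_code_square[OF side_pos v ran] by blast
  obtain M :: nat where M: "M < 2 ^ (?N * ?N)" "\<And>t. t < ?N * ?N \<Longrightarrow> bit M t \<longleftrightarrow> c (t div ?N) (t mod ?N)"
    using ex_bits[of "?N * ?N" "\<lambda>t. c (t div ?N) (t mod ?N)"] by blast
  have "c i j \<longleftrightarrow> bit M (i * ?N + j)" if "i < ?N" "j < ?N" for i j
    using M(2)[OF index_less[OF that(2,1)]] that by simp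
  then have "square_code ?N c = square_code ?N (\<lambda>i j. bit M (i * ?N + j))"
    unfolding square_code_eq_iff by simp
  then have "e = nat_of_word (square_code ?N (\<lambda>i j. bit M (i * ?N + j)))"
    by (simp only: e c)
  moreover have "\<not> (\<exists>v1<?N. \<exists>v2<?N. \<exists>g<16.
      e = nat_of_word (square_code ?N (window ?N (block X k) v1 v2 g)))"
    using no unfolding e nat_of_word_eq_iff has_window_code_def .
  \<comment> \<open>A code is longer than the side of its square, which exceeds its level, and
    \<open>Suc e\<close> is at least exponential in the length of the code.\<close>
  moreover have "k < Suc e"
  proof -
    have "?N \<le> length (square_code ?N c)" by (simp add: square_code_def nat_code_def)
    also have "\<dots> < 2 ^ length (square_code ?N c)" by (rule less_exp)
    also have "\<dots> \<le> Suc e" unfolding e c by (rule nat_of_word_bounds)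
    finally show ?thesis using side_gt[of k] by simp
  qed
  ultimately show ?r using M(1) by (intro exI[of _ k] conjI exI[of _ M])
next
  assume ?r
  then obtain k M where e: "e = nat_of_word (square_code (side k) (\<lambda>i j. bit (M :: nat) (i * side k + j)))"
    and no: "\<not> (\<exists>v1<side k. \<exists>v2<side k. \<exists>g<16.
           e = nat_of_word (square_code (side k) (window (side k) (block X k) v1 v2 g)))"
    by blast
  let ?x = "\<lambda>(i, j). of_bool (bit M (nat i * side k + nat j)) :: nat"
  let ?P = "subsquare ?x (side k) 0 0"
  have "range ?x \<subseteq> {0, 1}" by auto
  note sub = subsquare_facts[OF this side_pos, of k 0 0]
  have code: "pattern_code ?P = square_code (side k) (\<lambda>i j. bit M (i * side k + j))"
    unfolding sub(3) by (simp add: square_code_eq_iff)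
  have "\<not> has_window_code X k (pattern_code ?P)"
    using no unfolding e has_window_code_def code nat_of_word_eq_iff .
  with sub(1,2) have "?P \<in> forbidden X" unfolding forbidden_def level_forbidden_def by blast
  moreover have "e = nat_of_word (pattern_code ?P)" by (simp only: code e)
  ultimately show ?l by (simp only: image_eqI)
qed

lemma computable_words_forbidden:
  assumes X: "decidable (\<lambda>z. word_of_nat (psnd z) \<in> X (pfst z))"
  shows "computable_words (pattern_code ` forbidden X)"
proof -
  let ?L = "pattern_code ` forbidden X"
  have "decidable (\<lambda>e. e \<in> nat_of_word ` ?L)"
    unfolding nat_of_word_forbidden
    by (intro recursive_intros recursive_square_code recursive_block[OF X])
  \<comment> \<open>2 and 1 are the numbers of the words \<open>[True]\<close> and
    \<open>[False]\<close>.\<close>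
  then have "recursive (\<lambda>e. if e \<in> nat_of_word ` ?L then 2 else 1)" by (intro recursive_intros)
  moreover have "nat_of_word w \<in> nat_of_word ` ?L \<longleftrightarrow> w \<in> ?L" for w
    by (auto simp: nat_of_word_eq_iff image_iff)
  then have "(if nat_of_word w \<in> nat_of_word ` ?L then 2 else 1) = nat_of_word [w \<in> ?L]" for w
    by simp
  ultimately show ?thesis unfolding computable_words_def by (rule recursive_machine)
qed

lemma effective_shift_forbidden:
  assumes X: "decidable (\<lambda>z. word_of_nat (psnd z) \<in> X (pfst z))"
  shows "effective_shift {0, 1} (avoiding {0, 1} (forbidden X))"
proof -
  have over: "\<forall>P\<in>forbidden X. pattern_over {0, 1} P" by (auto simp: forbidden_def level_forbidden_def)
  then have "is_shift {0, 1} (avoiding {0, 1} (forbidden X))"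
    by (intro is_shift_avoiding) (simp add: pattern_over_def)
  with over computable_words_forbidden[where X = X, OF X] show ?thesis
    unfolding effective_shift_def by blast
qed

section \<open>Complexity of the square patterns\<close>

lemma output_word_unique:
  assumes "output_word cfg x" "output_word cfg y" shows "x = y"
proof -
  have le: "length v \<le> length u" if "output_word cfg u" "output_word cfg v" for u v
  proof (rule ccontr)
    assume "\<not> length v \<le> length u"
    then have "snd (snd cfg ! 1) (int (length u)) = bit_symbol (v ! length u)"
      using that(2) by (simp add: output_word_def)
    moreover have "snd (snd cfg ! 1) (int (length u)) \<notin> range bit_symbol"
      using that(1) by (simp add: output_word_def)
    ultimately show False by simp
  qed
  have len: "length x = length y" using le[OF assms] le[OF assms(2,1)] by simp
  show ?thesis
  proof (rule nth_equalityI[OF len])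
    fix i assume "i < length x"
    then have "bit_symbol (x ! i) = bit_symbol (y ! i)"
      using assms len by (metis output_word_def)
    then show "x ! i = y ! i" by (auto simp: bit_symbol_def split: if_splits)
  qed
qed

text \<open>\<open>k\<close> is the level that has to avoid these words. The length bound is half
  the number of bits of the matrix \<open>R\<close> from which that level is built,
  \<open>side (k - 1) ^ 6 = 2 ^ (6 * 4 ^ (k - 1))\<close>.\<close>

definition quick_outputs :: "machine \<Rightarrow> (nat \<Rightarrow> nat) \<Rightarrow> nat \<Rightarrow> bool list set" where
  "quick_outputs U T k =
     {x. \<exists>p. length p < 2 ^ (6 * 4 ^ (k - 1) - 1) \<and> outputs_within U (T (side k)) p x}"

lemma nat_of_word_less:
  assumes "length w < s" shows "nat_of_word w < 2 ^ s"
proof -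
  have "Suc (nat_of_word w) < 2 ^ Suc (length w)" by (rule nat_of_word_bounds)
  also have "\<dots> \<le> 2 ^ s" using assms by (intro power_increasing) auto
  finally show ?thesis by simp
qed

text \<open>Machines are deterministic, so each program contributes at most one word, and words
  shorter than s have numbers below 2^s.\<close>

lemma quick_outputs_card:
  "finite (quick_outputs U T (Suc k))" "card (quick_outputs U T (Suc k)) \<le> 2 ^ 2 ^ (6 * 4 ^ k - 1)"
proof -
  let ?s = "2 ^ (6 * 4 ^ k - 1) :: nat"
  let ?f = "\<lambda>q. THE x. outputs_within U (T (side (Suc k))) (word_of_nat q) x"
  have sub: "quick_outputs U T (Suc k) \<subseteq> ?f ` {..<2 ^ ?s}"
  proof
    fix x assume "x \<in> quick_outputs U T (Suc k)"
    then obtain p where p: "length p < ?s" and x: "outputs_within U (T (side (Suc k))) p x"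
      unfolding quick_outputs_def by auto
    have "y = x" if "outputs_within U (T (side (Suc k))) p y" for y
      using that x output_word_unique unfolding outputs_within_iff by blast
    then have "?f (nat_of_word p) = x"
      unfolding word_of_nat_of_word by (rule the_equality[of "outputs_within U (T (side (Suc k))) p", OF x])
    moreover have "nat_of_word p \<in> {..<2 ^ ?s}" using nat_of_word_less[OF p] by (simp only: lessThan_iff)
    ultimately show "x \<in> ?f ` {..<2 ^ ?s}" by (rule image_eqI[OF sym])
  qed
  then show "finite (quick_outputs U T (Suc k))" by (rule finite_subset) (intro finite_imageI finite_lessThan)
  have "card (quick_outputs U T (Suc k)) \<le> card {..<(2 :: nat) ^ ?s}"
    by (rule order_trans[OF card_mono[OF _ sub] card_image_le]) (intro finite_imageI finite_lessThan)+
  then show "card (quick_outputs U T (Suc k)) \<le> 2 ^ ?s" by (simp only: card_lessThan)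
qed

lemma decidable_quick_outputs:
  assumes U: "turing_machine U" and T: "recursive T"
  shows "decidable (\<lambda>z. word_of_nat (psnd z) \<in> quick_outputs U T (pfst z))"
proof -
  let ?s = "\<lambda>z. 2 ^ (6 * 4 ^ (pfst z - 1) - 1) :: nat"
  have "decidable (\<lambda>z. \<exists>q<2 ^ ?s z. length (word_of_nat q) < ?s z \<and>
      outputs_within U (T (side (pfst z))) (word_of_nat q) (word_of_nat (psnd z)))"
    by (intro recursive_intros decidable_outputs_within[OF U] recursive_comp[OF T])
  moreover have "word_of_nat (psnd z) \<in> quick_outputs U T (pfst z) \<longleftrightarrow>
      (\<exists>q<2 ^ ?s z. length (word_of_nat q) < ?s z \<and>
        outputs_within U (T (side (pfst z))) (word_of_nat q) (word_of_nat (psnd z)))" for z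
  proof -
    have "(\<exists>p. length p < s \<and> Q p) \<longleftrightarrow> (\<exists>q<2 ^ s. length (word_of_nat q) < s \<and> Q (word_of_nat q))" for s Q
    proof
      assume "\<exists>p. length p < s \<and> Q p"
      then obtain p where "length p < s" "Q p" by blast
      then show "\<exists>q<2 ^ s. length (word_of_nat q) < s \<and> Q (word_of_nat q)"
        by (intro exI[of _ "nat_of_word p"]) (simp add: nat_of_word_less)
    qed blast
    then show ?thesis unfolding quick_outputs_def mem_Collect_eq by this
  qed
  ultimately show ?thesis by (simp only:)
qed

text \<open>The word numbered \<open>e\<close> is a program for the machine computing
  \<open>f\<close>, so objects are described by as many bits as their parameter number has.\<close>

lemma complexity_recursive_bound:
  assumes "optimal D" "recursive f"
  shows "\<exists>c::nat. \<forall>e x. f e = nat_of_word x \<longrightarrow> complexity D x \<le> enat (length (word_of_nat e) + c)"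
proof -
  obtain M where M: "turing_machine M" and out: "\<And>w. outputs M w (word_of_nat (f (nat_of_word w)))"
    using recursive_machine[OF assms(2), of "\<lambda>w. word_of_nat (f (nat_of_word w))"] by auto
  obtain c where c: "\<And>x. complexity D x \<le> complexity M x + enat c"
    using assms(1) M unfolding optimal_def by blast
  have "complexity D x \<le> enat (length (word_of_nat e) + c)" if "f e = nat_of_word x" for e x
  proof -
    have "outputs M (word_of_nat e) x" using out[of "word_of_nat e"] that by simp
    then have "complexity M x \<le> enat (length (word_of_nat e))"
      unfolding complexity_def by (intro INF_lower) simp
    then have "complexity M x + enat c \<le> enat (length (word_of_nat e)) + enat c" by (rule add_right_mono)
    with c[of x] show ?thesis by (metis order_trans plus_enat_simps(1))
  qed
  then show ?thesis by blast
qed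

text \<open>With M = n^r the code is at most \<open>triangle (2 * M) + M\<close>, hence at most 4
  M^2, and 4 is at most n^2.\<close>

lemma pair_le_power:
  assumes "2 \<le> n" "a \<le> n ^ r" "b \<le> n ^ r" shows "pair a b \<le> n ^ (2 * r + 2)"
proof -
  let ?M = "n ^ r"
  have "1 \<le> ?M" using assms(1) by simp
  have "triangle (a + b) \<le> triangle (2 * ?M)"
    unfolding triangle_def using assms by (intro div_le_mono mult_le_mono) auto
  also have "\<dots> = 2 * (?M * ?M) + ?M" by (simp add: triangle_def algebra_simps)
  finally have "pair a b \<le> 2 * (?M * ?M) + ?M + ?M"
    using assms(2) by (simp add: pair_def prod_encode_def)
  moreover have "?M \<le> ?M * ?M" using \<open>1 \<le> ?M\<close> by simp
  ultimately have "pair a b \<le> (?M * ?M) * 4" by linarith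
  also have "\<dots> \<le> (?M * ?M) * (n * n)" using mult_le_mono[OF assms(1,1)] by (intro mult_le_mono2) simp
  also have "\<dots> = n ^ (2 * r + 2)" by (simp add: power_add mult_2 power2_eq_square)
  finally show ?thesis .
qed

text \<open>For the least level whose side reaches \<open>n\<close>, the preceding side is below
  \<open>n\<close> and each side is the fourth power of its predecessor. At level 0 the side is
  2.\<close>

lemma ex_level:
  assumes "2 \<le> n" obtains k where "k \<le> n" "n \<le> side k" "side k \<le> n ^ 4"
proof -
  define k where "k = (LEAST k. n \<le> side k)"
  have ex: "n \<le> side n" using side_gt[of n] by simp
  then have "n \<le> side k" "k \<le> n" unfolding k_def by (rule LeastI, rule Least_le)
  moreover have "side k \<le> n ^ 4"
  proof (cases k)
    case 0
    have "n \<le> n ^ 4" using assms power_increasing[of 1 4 n] by simp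
    with 0 assms show ?thesis by (simp add: side_def)
  next
    case (Suc j)
    then have "\<not> n \<le> side j" unfolding k_def by (intro not_less_Least) (simp add: k_def)
    then have "side j ^ 4 \<le> n ^ 4" by (intro power_mono) auto
    moreover have "side k = side j ^ 4" unfolding Suc side_Suc by (simp add: eval_nat_numeral)
    ultimately show ?thesis by simp
  qed
  ultimately show ?thesis using that by blast
qed

text \<open>A square of side \<open>n\<close> is a corner of one of side \<open>side k\<close>,
  which is a window. So five numbers polynomial in \<open>n\<close> describe it: \<open>n\<close>,
  the level, the offset and the complementation; the block is recomputed.\<close>

lemma square_complexity_upper:
  assumes D: "optimal D" and X: "decidable (\<lambda>z. word_of_nat (psnd z) \<in> X (pfst z))"
  shows "\<exists>K::real. \<forall>n\<ge>2. \<forall>P. square_pattern n P \<and>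
     globally_admissible (avoiding {0, 1} (forbidden X)) P \<longrightarrow>
     ereal_of_enat (complexity D (pattern_code P)) \<le> ereal (K * log 2 (real n))"
proof -
  define f where "f e = nat_of_word (square_code (pfst e)
     (window (side (pfst (psnd e))) (block X (pfst (psnd e))) (pfst (psnd (psnd e)))
       (pfst (psnd (psnd (psnd e)))) (psnd (psnd (psnd (psnd e))))))" for e
  have "recursive f" unfolding f_def
    by (intro recursive_square_code recursive_intros recursive_block[OF X])
  from complexity_recursive_bound[OF D this] obtain c :: nat where c:
    "\<And>e x. f e = nat_of_word x \<Longrightarrow> complexity D x \<le> enat (length (word_of_nat e) + c)"
    by blast
  have "ereal_of_enat (complexity D (pattern_code P)) \<le> ereal ((95 + real c) * log 2 (real n))"
    if n: "2 \<le> n" and P: "square_pattern n P" "globally_admissible (avoiding {0, 1} (forbidden X)) P" for n P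
  proof -
    obtain x a b where x: "x \<in> avoiding {0, 1} (forbidden X)"
      and code: "pattern_code P = square_code n (\<lambda>i j. x (a + int i, b + int j) = 1)"
      by (rule admissible_square[OF _ P]) (use n in simp)
    obtain k where k: "k \<le> n" "n \<le> side k" "side k \<le> n ^ 4" using ex_level[OF n] .
    have "has_window_code X k (square_code (side k) (\<lambda>i j. x (a + int i, b + int j) = 1))"
      using in_avoiding_forbidden[OF x, of k] unfolding avoiding_level_iff by blast
    then obtain v1 v2 g where v: "v1 < side k" "v2 < side k" "g < 16"
      and w: "square_code (side k) (\<lambda>i j. x (a + int i, b + int j) = 1) =
        square_code (side k) (window (side k) (block X k) v1 v2 g)"
      unfolding has_window_code_def by blast
    \<comment> \<open>Equal codes mean equal cells on the large square, in particular on its part of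
      side \<open>n\<close>.\<close>
    from w k(2) have "pattern_code P = square_code n (window (side k) (block X k) v1 v2 g)"
      unfolding code square_code_eq_iff by auto
    then have f: "f (pair n (pair k (pair v1 (pair v2 g)))) = nat_of_word (pattern_code P)"
      by (simp add: f_def)
    let ?e = "pair n (pair k (pair v1 (pair v2 g)))"
    have pow: "n ^ i \<le> n ^ j" if "i \<le> j" for i j using n that by (intro power_increasing) auto
    \<comment> \<open>All five numbers are at most n^4. Each nesting of \<open>pair\<close> turns
      the exponent r into 2r + 2, giving 4, 10, 22, 46, 94; one more factor absorbs the
      \<open>Suc\<close>, whence 95.\<close>
    have "(16 :: nat) \<le> n ^ 4" using power_mono[OF n, of 4] by simp
    then have "pair v2 g \<le> n ^ (2 * 4 + 2)" using v k by (intro pair_le_power[OF n]) auto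
    then have "pair v1 (pair v2 g) \<le> n ^ (2 * 10 + 2)"
      using v k pow[of 4 10] by (intro pair_le_power[OF n]) auto
    then have "pair k (pair v1 (pair v2 g)) \<le> n ^ (2 * 22 + 2)"
      using k pow[of 1 22] by (intro pair_le_power[OF n]) auto
    then have "?e \<le> n ^ (2 * 46 + 2)"
      using pow[of 1 46] by (intro pair_le_power[OF n]) auto
    then have "?e \<le> n ^ 94" by simp
    moreover have "2 * n ^ 94 \<le> n * n ^ 94" using n by (intro mult_le_mono1)
    moreover have "1 \<le> n ^ 94" using n by simp
    ultimately have "Suc ?e \<le> n * n ^ 94" by linarith
    also have "\<dots> = n ^ 95" by (simp only: power_Suc[symmetric]) simp
    finally have "Suc ?e \<le> n ^ 95" .
    moreover have "2 ^ length (word_of_nat ?e) \<le> Suc ?e"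
      using nat_of_word_bounds(1)[of "word_of_nat ?e"] by simp
    ultimately have "2 ^ length (word_of_nat ?e) \<le> n ^ 95" by simp
    then have "real (2 ^ length (word_of_nat ?e)) \<le> real (n ^ 95)" by (rule of_nat_mono)
    then have "log 2 (2 ^ length (word_of_nat ?e)) \<le> log 2 (real n ^ 95)"
      using n by (intro log_mono) auto
    then have len: "real (length (word_of_nat ?e)) \<le> 95 * log 2 (real n)"
      using n by (simp add: log_nat_power)
    have "log 2 2 \<le> log 2 (real n)" using n by (intro log_mono) auto
    then have "real c * 1 \<le> real c * log 2 (real n)" by (intro mult_left_mono) auto
    with len have "real (length (word_of_nat ?e) + c) \<le> (95 + real c) * log 2 (real n)"
      by (simp add: algebra_simps)
    moreover have "ereal_of_enat (complexity D (pattern_code P)) \<le> ereal_of_enat (enat (length (word_of_nat ?e) + c))"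
      using c[OF f] by (simp only: ereal_of_enat_le_iff)
    ultimately show ?thesis by (simp add: order_trans)
  qed
  then show ?thesis by blast
qed

lemma square_complexity_lower:
  fixes U T
  defines "X \<equiv> quick_outputs U T"
  assumes P: "square_pattern (side (Suc k)) P" "globally_admissible (avoiding {0, 1} (forbidden X)) P"
  shows "enat (2 ^ (6 * 4 ^ k - 1)) \<le> complexity_within U (T (side (Suc k))) (pattern_code P)"
proof -
  let ?N = "side (Suc k)"
  obtain x a b where x: "x \<in> avoiding {0, 1} (forbidden X)"
    and code: "pattern_code P = square_code ?N (\<lambda>i j. x (a + int i, b + int j) = 1)"
    by (rule admissible_square[OF side_pos P])
  have "has_window_code X (Suc k) (pattern_code P)"
    using in_avoiding_forbidden[OF x, of "Suc k"] unfolding avoiding_level_iff code by blast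
  moreover have "good X k (block X k) (block X (Suc k))"
    unfolding X_def by (rule good_block) (rule quick_outputs_card)+
  ultimately have "pattern_code P \<notin> X (Suc k)"
    unfolding has_window_code_def good_def by metis
  then have "2 ^ (6 * 4 ^ k - 1) \<le> length p" if "outputs_within U (T ?N) p (pattern_code P)" for p
    using that by (auto simp: X_def quick_outputs_def not_less[symmetric])
  then show ?thesis unfolding complexity_within_def by (intro INF_greatest) simp
qed

text \<open>The side is 2^(4 * 4^k) and 1.5 times 4 is 6. The program length excluded by the
  construction is half of this power, which is why the theorem holds with c = 1/2.\<close>

lemma side_powr: "real (side (Suc k)) powr 1.5 = 2 * 2 ^ (6 * 4 ^ k - 1)"
proof -
  have "real (side (Suc k)) = 2 ^ 4 ^ Suc k" by (simp only: side_def of_nat_power of_nat_numeral)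
  also have "\<dots> = 2 powr real (4 ^ Suc k)" by (rule powr_realpow[symmetric]) simp
  finally have "real (side (Suc k)) powr 1.5 = (2 powr real (4 ^ Suc k)) powr 1.5" by (simp only:)
  also have "\<dots> = 2 powr real (6 * 4 ^ k)" by (simp add: powr_powr)
  also have "\<dots> = 2 ^ (6 * 4 ^ k)" by (rule powr_realpow) simp
  also have "6 * 4 ^ k = Suc (6 * 4 ^ k - 1 :: nat)" by simp
  finally show ?thesis by (simp only: power_Suc)
qed

theorem theorem7:
  fixes D U :: machine and T :: "nat \<Rightarrow> nat"
  assumes "optimal D"
    and "time_optimal U"
    and "\<forall>x t. complexity D x \<le> complexity_within U t x"
    and "computable_fun T"
  shows "\<exists>(A :: nat set) (S :: config2d set).
    finite A \<and> effective_shift A S \<and> S \<noteq> {} \<and>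
    (\<exists>K::real. \<forall>n\<ge>2. \<forall>P. square_pattern n P \<and> globally_admissible S P \<longrightarrow>
       ereal_of_enat (complexity D (pattern_code P)) \<le> ereal (K * log 2 (real n))) \<and>
    (\<exists>c::real. c > 0 \<and>
       infinite {n::nat. \<forall>P. square_pattern n P \<and> globally_admissible S P \<longrightarrow>
         ereal (c * real n powr 1.5)
           \<le> ereal_of_enat (complexity_within U (T n) (pattern_code P))})"
proof -
  define X where "X = quick_outputs U T"
  define S where "S = avoiding {0, 1} (forbidden X)"
  have "turing_machine U" using assms(2) by (simp add: time_optimal_def)
  then have X: "decidable (\<lambda>z. word_of_nat (psnd z) \<in> X (pfst z))"
    unfolding X_def by (intro decidable_quick_outputs computable_fun_recursive assms(4))
  have "good X k (block X k) (block X (Suc k))" for k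
    unfolding X_def by (rule good_block) (rule quick_outputs_card)+
  then have "S \<noteq> {}" unfolding S_def by (intro avoiding_nonempty) (simp add: good_def)
  moreover have "effective_shift {0, 1} S"
    unfolding S_def by (rule effective_shift_forbidden[where X = X, OF X])
  moreover have "\<exists>K::real. \<forall>n\<ge>2. \<forall>P. square_pattern n P \<and> globally_admissible S P \<longrightarrow>
       ereal_of_enat (complexity D (pattern_code P)) \<le> ereal (K * log 2 (real n))"
    unfolding S_def by (rule square_complexity_upper[where X = X, OF assms(1) X])
  moreover
  have "infinite {n::nat. \<forall>P. square_pattern n P \<and> globally_admissible S P \<longrightarrow>
         ereal (1 / 2 * real n powr 1.5) \<le> ereal_of_enat (complexity_within U (T n) (pattern_code P))}"
    (is "infinite ?I")
  proof (rule infinite_super)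
    \<comment> \<open>The sides of all levels but 0 are good values of \<open>n\<close>; level 0 is
      not built against any programs.\<close>
    show "range (\<lambda>k. side (Suc k)) \<subseteq> ?I"
    proof (rule image_subsetI, rule CollectI, intro allI impI, elim conjE)
      fix k P assume P: "square_pattern (side (Suc k)) P" "globally_admissible S P"
      have "enat (2 ^ (6 * 4 ^ k - 1)) \<le> complexity_within U (T (side (Suc k))) (pattern_code P)"
        by (rule square_complexity_lower) (use P in \<open>simp_all add: S_def X_def\<close>)
      then have "ereal_of_enat (enat (2 ^ (6 * 4 ^ k - 1)))
          \<le> ereal_of_enat (complexity_within U (T (side (Suc k))) (pattern_code P))"
        by (simp only: ereal_of_enat_le_iff)
      moreover have "ereal (1 / 2 * real (side (Suc k)) powr 1.5) = ereal_of_enat (enat (2 ^ (6 * 4 ^ k - 1)))"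
        unfolding side_powr by simp
      ultimately show "ereal (1 / 2 * real (side (Suc k)) powr 1.5)
          \<le> ereal_of_enat (complexity_within U (T (side (Suc k))) (pattern_code P))" by (simp only:)
    qed
    show "infinite (range (\<lambda>k. side (Suc k)))"
      by (rule range_inj_infinite) (simp add: inj_def side_def)
  qed
  then have "\<exists>c::real. c > 0 \<and>
       infinite {n::nat. \<forall>P. square_pattern n P \<and> globally_admissible S P \<longrightarrow>
         ereal (c * real n powr 1.5)
           \<le> ereal_of_enat (complexity_within U (T n) (pattern_code P))}"
    by (intro exI[of _ "1 / 2 :: real"] conjI) simp
  moreover have "finite {0, 1 :: nat}" by simp
  ultimately show ?thesis by (intro exI[of _ "{0, 1}"] exI[of _ S] conjI)
qed

end
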